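(* Let $m\le n$ be positive integers, $U\subset\mathbb R^n$ open and $V$ an integral $m$-varifold in $U$ which is a curvature varifold. If $\mathbf b(V)(x)=0$ for $\|V\|$-almost every $x\in U$, then for each $a\in U$ there exist $r>0$, a nonnegative integer $N$, positive integers $k_1,\dots,k_N$ and affine $m$-planes $A_1,\dots,A_N$ such that $$V\llcorner(B(a,r)\times\mathbf G(n,m))=\sum_{j=1}^N\mathbf v(A_j,k_j)\llcorner(B(a,r)\times\mathbf G(n,m)).$$
   Context: Notation: $B(a,r)$ open ball; $\|V\|$ weight measure of $V$, $\delta V$ first variation, $\|\delta V\|$ its total variation; $\mathbf v(R,\theta)$ denotes the rectifiable $m$-varifold associated to an $\mathcal H^m$-rectifiable set $R$ with multiplicity $\theta$. $Y$ is the space of symmetric linear maps $\mathbb R^n\to\mathbb R^n$; $P_\natural\in Y$ is the orthogonal projection onto $P\in\mathbf G(n,m)$. For an integral varifold $V$, let $T_V$ be the set of $x\in U$ where the approximate tangent plane $\operatorname{Tan}^m(\|V\|,x)$ is an element of $\mathbf G(n,m)$, and $\tau_V:T_V\to Y$, $\tau_V(x)=\operatorname{Tan}^m(\|V\|,x)_\natural$. $V$ is a curvature varifold if $\|\delta V\|$ is a Radon measure absolutely continuous with respect to $\|V\|$ and $\tau_V\in\mathbf T(V,Y)$, i.e. $\tau_V$ is generalised $V$-weakly differentiable in the sense of Menne (Indiana Univ. Math. J. 2016, Def. 8.3); its generalised weak derivative $\mathbf b(V)=V\mathbf D\tau_V$ is called the generalised second fundamental form (this is equivalent to Hutchinson's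 definition of curvature varifold). Here the generalised weak derivative $V\mathbf Df$ of $f\in\mathbf T(V,Y)$ satisfies $\delta V((\gamma\circ f)\theta)=\int\gamma(f(x))P_\natural\bullet D\theta(x)dV(x,P)+\int\langle\theta(x),D\gamma(f(x))\circ V\mathbf Df(x)\rangle d\|V\|(x)$ for $\theta\in C_c^\infty(U,\mathbb R^n)$ and smooth $\gamma$ with $\operatorname{spt}D\gamma$ compact. *)

theory Defs
  imports "HOL-Analysis.Analysis"
begin

primrec Ck :: "nat \<Rightarrow> ('a::real_normed_vector \<Rightarrow> 'b::real_normed_vector) \<Rightarrow> bool" where
  "Ck 0 f = continuous_on UNIV f"
| "Ck (Suc k) f = ((\<forall>x. f differentiable (at x)) \<and>
                    (\<forall>v. Ck k (\<lambda>x. frechet_derivative f (at x) v)))"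

definition smooth_map :: "('a::real_normed_vector \<Rightarrow> 'b::real_normed_vector) \<Rightarrow> bool" where
  "smooth_map f \<longleftrightarrow> (\<forall>k. Ck k f)"

definition test_field :: "'a::euclidean_space set \<Rightarrow> ('a \<Rightarrow> 'a) \<Rightarrow> bool" where
  "test_field U \<phi> \<longleftrightarrow> smooth_map \<phi> \<and>
     (\<exists>K. compact K \<and> K \<subseteq> U \<and> (\<forall>x. x \<notin> K \<longrightarrow> \<phi> x = 0))"

definition Grass :: "nat \<Rightarrow> 'a::euclidean_space set set" where
  "Grass m = {P. subspace P \<and> dim P = m}"

definition orth_proj :: "'a::euclidean_space set \<Rightarrow> ('a \<Rightarrow>\<^sub>L 'a)" where
  "orth_proj P = (THE L. \<forall>x. blinfun_apply L x \<in> P \<and> (\<forall>y\<in>P. inner (x - blinfun_apply L x) y = 0))"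

definition Ysym :: "('a::euclidean_space \<Rightarrow>\<^sub>L 'a) set" where
  "Ysym = {L. \<forall>x y. inner (blinfun_apply L x) y = inner x (blinfun_apply L y)}"

text \<open>The inner product  S \<bullet> L = trace (S^* o L)  of linear maps.\<close>
definition lin_dot :: "('a::euclidean_space \<Rightarrow>\<^sub>L 'a) \<Rightarrow> ('a \<Rightarrow> 'a) \<Rightarrow> real" where
  "lin_dot S L = (\<Sum>i\<in>Basis. inner (blinfun_apply S i) (L i))"

definition Hm_delta :: "nat \<Rightarrow> real \<Rightarrow> 'a::euclidean_space set \<Rightarrow> ennreal" where
  "Hm_delta m \<delta> A = (INF S\<in>{S :: nat \<Rightarrow> 'a set. A \<subseteq> (\<Union>i. S i) \<and>
        (\<forall>i. bounded (S i) \<and> diameter (S i) \<le> \<delta>)}.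
      (\<Sum>i. ennreal (unit_ball_vol (real m) * (diameter (S i) / 2) ^ m)))"

definition Hm :: "nat \<Rightarrow> 'a::euclidean_space set \<Rightarrow> ennreal" where
  "Hm m A = (SUP \<delta>\<in>{0<..}. Hm_delta m \<delta> A)"

definition HM :: "nat \<Rightarrow> 'a::euclidean_space measure" where
  "HM m = completion (measure_of UNIV (sets borel) (Hm m))"

section \<open>Approximate tangent cones (Federer 3.1.21, 2.10.19, 3.2.16)\<close>

definition outer_meas :: "'a measure \<Rightarrow> 'a set \<Rightarrow> ennreal" where
  "outer_meas M A = (INF E\<in>{E\<in>sets M. A \<subseteq> E}. emeasure M E)"

definition tan_cone :: "'a::euclidean_space set \<Rightarrow> 'a \<Rightarrow> 'a set" where
  "tan_cone S a = {v. \<forall>\<epsilon>>0. \<exists>x\<in>S. \<exists>r>0. norm (x - a) < \<epsilon> \<and> norm (r *\<^sub>R (x - a) - v) < \<epsilon>}"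

definition upper_density :: "nat \<Rightarrow> ('a::euclidean_space set \<Rightarrow> ennreal) \<Rightarrow> 'a \<Rightarrow> ennreal" where
  "upper_density m \<nu> a =
     Limsup (at_right (0::real)) (\<lambda>r. \<nu> (cball a r) / ennreal (unit_ball_vol (real m) * r ^ m))"

definition approx_tan :: "nat \<Rightarrow> 'a::euclidean_space measure \<Rightarrow> 'a \<Rightarrow> 'a set" where
  "approx_tan m \<mu> a = \<Inter> {tan_cone S a | S.
       upper_density m (\<lambda>B. outer_meas \<mu> (B \<inter> (UNIV - S))) a = 0}"

definition count_rectifiable :: "nat \<Rightarrow> 'a::euclidean_space set \<Rightarrow> bool" where
  "count_rectifiable m R \<longleftrightarrow> (\<exists>E N (f :: nat \<Rightarrow> 'a \<Rightarrow> 'a).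
      E \<in> Grass m \<and> Hm m N = 0 \<and> (\<forall>i. \<exists>C. lipschitz_on C E (f i)) \<and>
      R \<subseteq> N \<union> (\<Union>i. f i ` E))"

text \<open>Weight measure \<parallel>V\<parallel> = \<theta> H^m restricted to R, of V = v(R,\<theta>).\<close>
definition vweight :: "nat \<Rightarrow> 'a::euclidean_space set \<Rightarrow> ('a \<Rightarrow> nat) \<Rightarrow> 'a measure" where
  "vweight m R \<theta> = density (HM m) (\<lambda>x. indicator R x * ennreal (real (\<theta> x)))"

definition rtan :: "nat \<Rightarrow> 'a::euclidean_space set \<Rightarrow> 'a \<Rightarrow> 'a set" where
  "rtan m R x = approx_tan m (density (HM m) (indicator R)) x"

definition vint :: "nat \<Rightarrow> 'a::euclidean_space set \<Rightarrow> ('a \<Rightarrow> nat)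
                     \<Rightarrow> ('a \<Rightarrow> ('a \<Rightarrow>\<^sub>L 'a) \<Rightarrow> real) \<Rightarrow> real" where
  "vint m R \<theta> g = (\<integral>x. (if x \<in> R \<and> rtan m R x \<in> Grass m
       then real (\<theta> x) * g x (orth_proj (rtan m R x)) else 0) \<partial>HM m)"

text \<open>The varifold v(R,\<theta>) evaluated on a subset E of R^n x G(n,m), G(n,m) being
  identified with {P_natural}.\<close>
definition vmeas :: "nat \<Rightarrow> 'a::euclidean_space set \<Rightarrow> ('a \<Rightarrow> nat)
                     \<Rightarrow> ('a \<times> ('a \<Rightarrow>\<^sub>L 'a)) set \<Rightarrow> ennreal" where
  "vmeas m R \<theta> E = (\<integral>\<^sup>+x. (if x \<in> R \<and> rtan m R x \<in> Grass m \<and> (x, orth_proj (rtan m R x)) \<in> E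
       then ennreal (real (\<theta> x)) else 0) \<partial>HM m)"

definition integral_varifold :: "nat \<Rightarrow> 'a::euclidean_space set \<Rightarrow> 'a set \<Rightarrow> ('a \<Rightarrow> nat) \<Rightarrow> bool" where
  "integral_varifold m U R \<theta> \<longleftrightarrow> R \<subseteq> U \<and> R \<in> sets borel \<and> count_rectifiable m R \<and>
     \<theta> \<in> borel_measurable borel \<and> (\<forall>x\<in>R. 1 \<le> \<theta> x) \<and>
     (\<forall>K. compact K \<and> K \<subseteq> U \<longrightarrow> emeasure (vweight m R \<theta>) K < \<infinity>)"

text \<open>\<parallel>\<delta>V\<parallel> is a Radon measure absolutely continuous w.r.t. \<parallel>V\<parallel>, with
  \<delta>V(\<phi>) = \<integral> \<phi> \<bullet> h d\<parallel>V\<parallel>  (h locally \<parallel>V\<parallel>-integrable).\<close>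
definition first_var_rep :: "nat \<Rightarrow> 'a::euclidean_space set \<Rightarrow> 'a set \<Rightarrow> ('a \<Rightarrow> nat) \<Rightarrow> ('a \<Rightarrow> 'a) \<Rightarrow> bool" where
  "first_var_rep m U R \<theta> h \<longleftrightarrow> h \<in> borel_measurable (vweight m R \<theta>) \<and>
     (\<forall>K. compact K \<and> K \<subseteq> U \<longrightarrow> (\<integral>\<^sup>+x\<in>K. ennreal (norm (h x)) \<partial>vweight m R \<theta>) < \<infinity>) \<and>
     (\<forall>\<phi>. test_field U \<phi> \<longrightarrow>
        vint m R \<theta> (\<lambda>x S. lin_dot S (frechet_derivative \<phi> (at x)))
          = (\<integral>x. inner (\<phi> x) (h x) \<partial>vweight m R \<theta>))"

definition tauV :: "nat \<Rightarrow> 'a::euclidean_space set \<Rightarrow> ('a \<Rightarrow> nat) \<Rightarrow> 'a \<Rightarrow> ('a \<Rightarrow>\<^sub>L 'a)" where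
  "tauV m R \<theta> x = (if approx_tan m (vweight m R \<theta>) x \<in> Grass m
      then orth_proj (approx_tan m (vweight m R \<theta>) x) else 0)"

text \<open>Admissible \<gamma>: smooth on Y (restrictions of smooth maps of the ambient space) with
  spt D\<gamma> compact in Y.\<close>
definition admissible_gamma :: "(('a::euclidean_space \<Rightarrow>\<^sub>L 'a) \<Rightarrow> real) \<Rightarrow> bool" where
  "admissible_gamma \<gamma> \<longleftrightarrow> smooth_map \<gamma> \<and>
     compact (closure {y\<in>Ysym. \<exists>v\<in>Ysym. frechet_derivative \<gamma> (at y) v \<noteq> 0})"

text \<open>F is a generalised V weak derivative of f (Menne, Def. 8.3), where \<delta>V is represented
  by h.\<close>
definition gen_weak_deriv :: "nat \<Rightarrow> 'a::euclidean_space set \<Rightarrow> 'a set \<Rightarrow> ('a \<Rightarrow> nat) \<Rightarrow> ('a \<Rightarrow> 'a)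
     \<Rightarrow> ('a \<Rightarrow> ('a \<Rightarrow>\<^sub>L 'a)) \<Rightarrow> ('a \<Rightarrow> ('a \<Rightarrow>\<^sub>L ('a \<Rightarrow>\<^sub>L 'a))) \<Rightarrow> bool" where
  "gen_weak_deriv m U R \<theta> h f F \<longleftrightarrow>
     f \<in> borel_measurable (vweight m R \<theta>) \<and> F \<in> borel_measurable (vweight m R \<theta>) \<and>
     (\<forall>x v. blinfun_apply (F x) v \<in> Ysym) \<and>
     (\<forall>K s. compact K \<and> K \<subseteq> U \<and> 0 \<le> s \<longrightarrow>
        (\<integral>\<^sup>+x\<in>K \<inter> {x. norm (f x) \<le> s}. ennreal (norm (F x)) + ennreal (norm (h x)) \<partial>vweight m R \<theta>) < \<infinity>) \<and>
     (\<forall>\<phi> \<gamma>. test_field U \<phi> \<and> admissible_gamma \<gamma> \<longrightarrow>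
        (\<integral>x. \<gamma> (f x) * inner (\<phi> x) (h x) \<partial>vweight m R \<theta>)
        = vint m R \<theta> (\<lambda>x S. \<gamma> (f x) * lin_dot S (frechet_derivative \<phi> (at x)))
          + (\<integral>x. frechet_derivative \<gamma> (at (f x)) (blinfun_apply (F x) (\<phi> x)) \<partial>vweight m R \<theta>))"

definition second_fund_form :: "nat \<Rightarrow> 'a::euclidean_space set \<Rightarrow> 'a set \<Rightarrow> ('a \<Rightarrow> nat)
     \<Rightarrow> ('a \<Rightarrow> ('a \<Rightarrow>\<^sub>L ('a \<Rightarrow>\<^sub>L 'a))) \<Rightarrow> bool" where
  "second_fund_form m U R \<theta> b \<longleftrightarrow>
     (\<exists>h. first_var_rep m U R \<theta> h \<and> gen_weak_deriv m U R \<theta> h (tauV m R \<theta>) b)"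

definition curvature_varifold :: "nat \<Rightarrow> 'a::euclidean_space set \<Rightarrow> 'a set \<Rightarrow> ('a \<Rightarrow> nat) \<Rightarrow> bool" where
  "curvature_varifold m U R \<theta> \<longleftrightarrow> integral_varifold m U R \<theta> \<and> (\<exists>b. second_fund_form m U R \<theta> b)"

definition affine_plane :: "nat \<Rightarrow> 'a::euclidean_space set \<Rightarrow> bool" where
  "affine_plane m A \<longleftrightarrow> (\<exists>c P. P \<in> Grass m \<and> A = (+) c ` P)"

end

theory Submission
  imports Defs "HOL-Computational_Algebra.Polynomial"
begin

text \<open>
  Write \<open>\<mu>\<close> for the weight and \<open>\<tau>\<close> for the field of tangent projections. Since the second fundamental form
  vanishes, every \<open>\<gamma> \<circ> \<tau>\<close> is a constant for the first variation: if it is represented by \<open>h\<close>, then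
  \<open>\<integral> \<gamma> (\<tau> x) D\<psi> (x) (\<tau> x w) d\<mu> = \<integral> \<gamma> (\<tau> x) \<psi> x (w \<bullet> h x) d\<mu>\<close>. Hence the distribution of \<open>(\<tau> x, x)\<close> is
  Lipschitz in total variation under \<open>(T, x) \<mapsto> (T, x + T w)\<close>, also after restriction to a set of pairs
  determined by the affine plane \<open>x + im T\<close>.

  Averaging over small \<open>w\<close> shows that for almost every \<open>x\<close> the plane \<open>x + im (\<tau> x)\<close> meets \<open>R\<close> in positive
  Hausdorff measure, and there are only countably many such planes. On a single plane the multiplicity is an
  integer valued function whose translates differ in \<open>L\<^sup>1\<close> by \<open>o(\<bar>w\<bar>)\<close>, because its derivative is an integrable
  function; by telescoping it is constant on balls. Each plane of positive multiplicity close to the centre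
  carries a fixed amount of mass, so there are finitely many.
\<close>

section \<open>Hausdorff measure\<close>

text \<open>The field \<open>h\<close> representing the first variation is never shown to vanish.
  Only its integrability enters: its total integral makes the translations Lipschitz, and absolute
  continuity of the integral improves the Lipschitz bound to \<open>o(norm w)\<close>. The obstacle
  is that the tangent planes form a merely measurable field. A priori they might be spread over
  uncountably many parallel planes, none of which carries mass. This is excluded because the mass
  sits on a set of locally finite m-dimensional measure and two distinct m-planes meet in a null
  set. Integrality enters twice: a multiplicity of at least 1 bounds the measure of \<open>R\<close>
  by the mass, and a jump of at least 1 bounds the measure of the jump set by the total jump. The
  translation vector depends on the point through its tangent plane. Hence the weak identity is
  first carried from test functions to Borel sets of pairs (tangent projection, position). Fubini
  and translation invariance are applied to Borel data, while \<open>HM\<close> is a completion;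
  Borel versions of the tangent field and of \<open>h\<close> bridge the two.\<close>

lemma ennreal_less_add_pos: "x < top \<Longrightarrow> 0 < c \<Longrightarrow> x < x + ennreal c"
  using ennreal_add_left_cancel_less[of x 0 "ennreal c"] by auto

lemma Hm_delta_le:
  assumes "A \<subseteq> (\<Union>i. S i)" "\<And>i. bounded (S i)" "\<And>i. diameter (S i) \<le> \<delta>"
  shows "Hm_delta m \<delta> A \<le> (\<Sum>i. ennreal (unit_ball_vol (real m) * (diameter (S i) / 2) ^ m))"
  unfolding Hm_delta_def by (rule INF_lower) (use assms in auto)

lemma Hm_delta_less_cover:
  fixes A :: "'a::euclidean_space set"
  assumes "Hm_delta m \<delta> A < c"
  obtains S :: "nat \<Rightarrow> 'a set" where "A \<subseteq> (\<Union>i. S i)" "\<And>i. bounded (S i)" "\<And>i. diameter (S i) \<le> \<delta>"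
    "(\<Sum>i. ennreal (unit_ball_vol (real m) * (diameter (S i) / 2) ^ m)) < c"
  using assms unfolding Hm_delta_def INF_less_iff by auto

lemma Hm_delta_mono: "A \<subseteq> B \<Longrightarrow> Hm_delta m \<delta> A \<le> Hm_delta m \<delta> B"
  unfolding Hm_delta_def by (rule INF_superset_mono) auto

lemma Hm_delta_antimono: "\<delta> \<le> \<epsilon> \<Longrightarrow> Hm_delta m \<epsilon> A \<le> Hm_delta m \<delta> A"
  unfolding Hm_delta_def by (rule INF_superset_mono) (auto intro: order_trans)

lemma Hm_mono: "A \<subseteq> B \<Longrightarrow> Hm m A \<le> Hm m B"
  unfolding Hm_def by (intro SUP_mono) (use Hm_delta_mono in blast)

lemma Hm_delta_le_Hm: "0 < \<delta> \<Longrightarrow> Hm_delta m \<delta> A \<le> Hm m A"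
  unfolding Hm_def by (intro SUP_upper) auto

lemma Hm_leI: "(\<And>\<delta>. 0 < \<delta> \<Longrightarrow> Hm_delta m \<delta> A \<le> c) \<Longrightarrow> Hm m A \<le> c"
  unfolding Hm_def by (intro SUP_least) auto

text \<open>Covers are infinite sequences, so the cover by empty sets is free only because
  \<open>0 ^ m = 0\<close> for positive \<open>m\<close>.\<close>

lemma Hm_empty: "1 \<le> m \<Longrightarrow> Hm m {} = 0"
proof -
  assume m: "1 \<le> m"
  have "Hm m ({}::'a set) \<le> 0"
  proof (rule Hm_leI)
    fix \<delta> :: real assume "0 < \<delta>"
    then show "Hm_delta m \<delta> ({}::'a set) \<le> 0"
      using Hm_delta_le[of "{}" "\<lambda>_. {}" \<delta> m] m by (simp add: power_0_left)
  qed
  then show ?thesis by simp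
qed

lemma Hm_delta_subadditive:
  fixes A :: "nat \<Rightarrow> 'a::euclidean_space set"
  shows "Hm_delta m \<delta> (\<Union>i. A i) \<le> (\<Sum>i. Hm_delta m \<delta> (A i))"
proof (rule ennreal_le_epsilon)
  fix e :: real assume e: "0 < e" and fin: "(\<Sum>i. Hm_delta m \<delta> (A i)) < top"
  have fi: "Hm_delta m \<delta> (A i) < top" for i
  proof (rule ccontr)
    assume "\<not> ?thesis"
    then have "Hm_delta m \<delta> (A i) = top" by (simp add: not_less top_unique)
    then show False using ennreal_suminf_lessD[OF fin, of i] by simp
  qed
  have "\<forall>i. \<exists>S :: nat \<Rightarrow> 'a set. A i \<subseteq> (\<Union>k. S k) \<and> (\<forall>k. bounded (S k) \<and> diameter (S k) \<le> \<delta>) \<and>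
    (\<Sum>k. ennreal (unit_ball_vol (real m) * (diameter (S k) / 2) ^ m)) < Hm_delta m \<delta> (A i) + ennreal (e * (1/2)^Suc i)"
  proof
    fix i
    have "Hm_delta m \<delta> (A i) < Hm_delta m \<delta> (A i) + ennreal (e * (1/2)^Suc i)"
      using fi[of i] e by (intro ennreal_less_add_pos) auto
    then show "\<exists>S :: nat \<Rightarrow> 'a set. A i \<subseteq> (\<Union>k. S k) \<and> (\<forall>k. bounded (S k) \<and> diameter (S k) \<le> \<delta>) \<and>
      (\<Sum>k. ennreal (unit_ball_vol (real m) * (diameter (S k) / 2) ^ m)) < Hm_delta m \<delta> (A i) + ennreal (e * (1/2)^Suc i)"
      by (elim Hm_delta_less_cover) blast
  qed
  from choice[OF this] obtain S :: "nat \<Rightarrow> nat \<Rightarrow> 'a set" where S: "\<And>i. A i \<subseteq> (\<Union>k. S i k)" "\<And>i k. bounded (S i k)" "\<And>i k. diameter (S i k) \<le> \<delta>"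
    "\<And>i. (\<Sum>k. ennreal (unit_ball_vol (real m) * (diameter (S i k) / 2) ^ m)) < Hm_delta m \<delta> (A i) + ennreal (e * (1/2)^Suc i)"
    by blast
  \<comment> \<open>The countably many covers are merged into one sequence by the pairing bijection
    \<open>prod_decode\<close>.\<close>
  define f where "f = (\<lambda>(i,k). ennreal (unit_ball_vol (real m) * (diameter (S i k) / 2) ^ m))"
  have "Hm_delta m \<delta> (\<Union>i. A i) \<le> (\<Sum>n. ennreal (unit_ball_vol (real m) * (diameter (case_prod S (prod_decode n)) / 2) ^ m))"
  proof (rule Hm_delta_le)
    show "\<Union> (range A) \<subseteq> (\<Union>i. case prod_decode i of (x, xa) \<Rightarrow> S x xa)"
    proof
      fix x assume "x \<in> \<Union> (range A)"
      then obtain i where "x \<in> A i" by auto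
      then have "x \<in> (\<Union>k. S i k)" by (rule subsetD[OF S(1)])
      then obtain k where "x \<in> S i k" by auto
      then have "x \<in> (case prod_decode (prod_encode (i,k)) of (x, xa) \<Rightarrow> S x xa)" by simp
      then show "x \<in> (\<Union>i. case prod_decode i of (x, xa) \<Rightarrow> S x xa)" by (rule UN_I[OF UNIV_I])
    qed
  qed (use S in \<open>auto split: prod.split\<close>)
  also have "\<dots> = (\<Sum>n. f (prod_decode n))"
    by (intro suminf_cong) (auto simp: f_def split: prod.split)
  also have "\<dots> = (\<Sum>i. \<Sum>k. f (i,k))"
    by (rule suminf_ennreal_2dimen) simp
  also have "\<dots> \<le> (\<Sum>i. Hm_delta m \<delta> (A i) + ennreal (e * (1/2)^Suc i))"
    by (intro suminf_le) (use S(4) in \<open>auto simp: f_def intro: less_imp_le\<close>)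
  also have "\<dots> = (\<Sum>i. Hm_delta m \<delta> (A i)) + (\<Sum>i. ennreal (e * (1/2)^Suc i))"
    by (intro suminf_add[symmetric]) auto
  also have "(\<Sum>i. ennreal (e * (1/2)^Suc i)) = ennreal e"
    using sums_mult[OF power_half_series, of e] e
    by (intro suminf_ennreal_eq) simp_all
  finally show "Hm_delta m \<delta> (\<Union>i. A i) \<le> (\<Sum>i. Hm_delta m \<delta> (A i)) + ennreal e" .
qed

lemma Hm_subadditive:
  fixes A :: "nat \<Rightarrow> 'a::euclidean_space set"
  shows "Hm m (\<Union>i. A i) \<le> (\<Sum>i. Hm m (A i))"
proof (rule Hm_leI)
  fix \<delta> :: real assume "0 < \<delta>"
  then show "Hm_delta m \<delta> (\<Union>i. A i) \<le> (\<Sum>i. Hm m (A i))"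
    by (intro order_trans[OF Hm_delta_subadditive] suminf_le Hm_delta_le_Hm) auto
qed

lemma Hm_subadditive2:
  assumes m: "1 \<le> m" shows "Hm m (A \<union> B) \<le> Hm m A + Hm m B"
proof -
  have "A \<union> B = (\<Union>i::nat. if i = 0 then A else if i = 1 then B else {})" by (auto split: if_splits)
  then have "Hm m (A \<union> B) \<le> (\<Sum>i::nat. Hm m (if i = 0 then A else if i = 1 then B else {}))"
    using Hm_subadditive by metis
  also have "\<dots> = (\<Sum>i\<in>{0,1}. Hm m (if i = (0::nat) then A else if i = 1 then B else {}))"
    by (rule suminf_finite) (auto simp: Hm_empty[OF m])
  finally show ?thesis by simp
qed

text \<open>If two sets are separated by more than \<open>\<delta>\<close>, a set of diameter at most \<open>\<delta>\<close> meets only one of them.\<close>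

lemma Hm_metric_additive:
  fixes A B :: "'a::euclidean_space set"
  assumes m: "1 \<le> m" and e: "0 < \<eta>" and sep: "\<And>x y. x \<in> A \<Longrightarrow> y \<in> B \<Longrightarrow> \<eta> \<le> dist x y"
  shows "Hm m A + Hm m B \<le> Hm m (A \<union> B)"
proof -
  let ?w = "\<lambda>S. ennreal (unit_ball_vol (real m) * (diameter S / 2) ^ m)"
  have 1: "Hm_delta m \<delta> A + Hm_delta m \<delta> B \<le> Hm_delta m \<delta> (A \<union> B)" if d: "0 < \<delta>" "\<delta> < \<eta>" for \<delta>
  proof (unfold Hm_delta_def[of _ _ "A \<union> B"], rule INF_greatest)
    fix S :: "nat \<Rightarrow> 'a set" assume "S \<in> {S. A \<union> B \<subseteq> (\<Union>i. S i) \<and> (\<forall>i. bounded (S i) \<and> diameter (S i) \<le> \<delta>)}"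
    then have S: "A \<union> B \<subseteq> (\<Union>i. S i)" "\<And>i. bounded (S i)" "\<And>i. diameter (S i) \<le> \<delta>" by auto
    define SA where "SA i = (if S i \<inter> A = {} then {} else S i)" for i
    define SB where "SB i = (if S i \<inter> B = {} then {} else S i)" for i
    have "Hm_delta m \<delta> A \<le> (\<Sum>i. ?w (SA i))"
      by (rule Hm_delta_le) (use S d in \<open>auto simp: SA_def split: if_splits\<close>, blast?)
    moreover have "Hm_delta m \<delta> B \<le> (\<Sum>i. ?w (SB i))"
      by (rule Hm_delta_le) (use S d in \<open>auto simp: SB_def split: if_splits\<close>, blast?)
    ultimately have "Hm_delta m \<delta> A + Hm_delta m \<delta> B \<le> (\<Sum>i. ?w (SA i)) + (\<Sum>i. ?w (SB i))"
      by (rule add_mono)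
    also have "\<dots> = (\<Sum>i. ?w (SA i) + ?w (SB i))"
      by (intro suminf_add) auto
    also have "\<dots> \<le> (\<Sum>i. ?w (S i))"
    proof (intro suminf_le)
      fix i
      have "SA i = {} \<or> SB i = {}"
      proof (rule ccontr)
        assume "\<not> ?thesis"
        then obtain x y where xy: "x \<in> S i" "x \<in> A" "y \<in> S i" "y \<in> B" by (auto simp: SA_def SB_def split: if_splits)
        then have "dist x y \<le> \<delta>" using diameter_bounded_bound[OF S(2)] S(3) order_trans by blast
        with sep[OF xy(2,4)] d show False by simp
      qed
      moreover have w: "?w (SA i) \<le> ?w (S i)" "?w (SB i) \<le> ?w (S i)" and 0: "?w {} = 0"
        using m by (auto simp: SA_def SB_def power_0_left)
      ultimately show "?w (SA i) + ?w (SB i) \<le> ?w (S i)"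
        by (elim disjE) (use w in \<open>simp_all only: 0 add_0 add_0_right\<close>)
    qed auto
    finally show "Hm_delta m \<delta> A + Hm_delta m \<delta> B \<le> (\<Sum>i. ?w (S i))" .
  qed
  \<comment> \<open>The two suprema defining \<open>Hm\<close> run over independent scales, so the
    bound is proved for two scales by lowering both to a common one below
    \<open>\<eta>\<close>.\<close>
  have "Hm_delta m \<delta> A + Hm_delta m \<delta>' B \<le> Hm m (A \<union> B)" if "0 < \<delta>" "0 < \<delta>'" for \<delta> \<delta>'
  proof -
    let ?d = "min (min \<delta> \<delta>') (\<eta>/2)"
    have "Hm_delta m \<delta> A + Hm_delta m \<delta>' B \<le> Hm_delta m ?d A + Hm_delta m ?d B"
      by (intro add_mono Hm_delta_antimono) auto
    also have "\<dots> \<le> Hm_delta m ?d (A \<union> B)" by (rule 1) (use that e in auto)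
    also have "\<dots> \<le> Hm m (A \<union> B)" by (rule Hm_delta_le_Hm) (use that e in auto)
    finally show ?thesis .
  qed
  then have "Hm m A + Hm_delta m \<delta>' B \<le> Hm m (A \<union> B)" if "0 < \<delta>'" for \<delta>'
    unfolding Hm_def[of _ A] using that
    by (subst ennreal_SUP_add_left[symmetric]) (auto intro!: SUP_least)
  then show ?thesis
    unfolding Hm_def[of _ B] add.commute[of "Hm m A"]
    by (subst ennreal_SUP_add_left[symmetric]) (auto intro!: SUP_least simp: add.commute)
qed

text \<open>Caratheodory's criterion: the shells \<open>D k\<close> of even (odd) index are separated from each other, so
  their measures are summable and the tails vanish.\<close>

lemma Hm_closed_caratheodory:
  fixes A C :: "'a::euclidean_space set"
  assumes m: "1 \<le> m" and C: "closed C" "C \<noteq> {}" and fin: "Hm m A < top"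
  shows "Hm m (A \<inter> C) + Hm m (A - C) \<le> Hm m A"
proof -
  \<comment> \<open>Since \<open>C\<close> is closed, the sets \<open>E k\<close> exhaust
    \<open>A - C\<close>, and each keeps a positive distance from \<open>C\<close>. The shells
    \<open>D i\<close> with \<open>i \<ge> k\<close> fill what \<open>E k\<close> leaves
    out.\<close>
  define E where "E k = {x \<in> A. 1 / (real k + 1) \<le> infdist x C}" for k :: nat
  define D where "D k = {x \<in> A. 1 / (real k + 2) \<le> infdist x C \<and> infdist x C < 1 / (real k + 1)}" for k :: nat
  \<comment> \<open>\<open>infdist\<close> is 1-Lipschitz, so two shells with one shell omitted
    between them are at least as far apart as the omitted shell is thick.\<close>
  have sepD: "1 / (real k + 2) - 1 / (real k + 3) \<le> dist x y"
    if "infdist x C \<ge> 1 / (real k + 2)" "infdist y C \<le> 1 / (real k + 3)" for x y k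
    using infdist_triangle[of x C y] that by (simp add: dist_commute)
  have pos: "0 < 1 / (real k + 2) - 1 / (real k + 3)" for k by (simp add: frac_less2)
  have sumD: "(\<Sum>i<n. Hm m (D (2 * i + p))) \<le> Hm m (\<Union>i<n. D (2 * i + p))" for n p
  proof (induction n)
    case 0 then show ?case by simp
  next
    case (Suc n)
    show ?case
    proof (cases n)
      case 0 then show ?thesis by (simp add: lessThan_Suc)
    next
      case (Suc n')
      have "(\<Sum>i<Suc n. Hm m (D (2 * i + p))) \<le> Hm m (\<Union>i<n. D (2 * i + p)) + Hm m (D (2 * n + p))"
        using Suc.IH by (simp add: add_right_mono)
      also have "\<dots> \<le> Hm m ((\<Union>i<n. D (2 * i + p)) \<union> D (2 * n + p))"
      proof (rule Hm_metric_additive[OF m pos[of "2 * n' + p"]])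
        fix x y assume x: "x \<in> (\<Union>i<n. D (2 * i + p))" and y: "y \<in> D (2 * n + p)"
        from x obtain i where i: "i \<le> n'" "x \<in> D (2 * i + p)" using Suc by (auto simp: less_Suc_eq_le)
        have "1 / (real (2 * n' + p) + 2) \<le> 1 / (real (2 * i + p) + 2)"
          using i by (intro divide_left_mono) auto
        then have "1 / (real (2 * n' + p) + 2) \<le> infdist x C" using i by (auto simp: D_def)
        moreover have "infdist y C \<le> 1 / (real (2 * n' + p) + 3)"
          using y by (auto simp: D_def Suc add.commute)
        ultimately show "1 / (real (2 * n' + p) + 2) - 1 / (real (2 * n' + p) + 3) \<le> dist x y"
          by (rule sepD)
      qed
      finally show ?thesis by (simp add: lessThan_Suc Un_commute)
    qed
  qed
  have sub: "(\<Sum>i<n. Hm m (D (2 * i + p))) \<le> Hm m A" for n p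
    by (rule order_trans[OF sumD Hm_mono]) (auto simp: D_def)
  have "(\<Sum>i<n. Hm m (D i)) \<le> Hm m A + Hm m A" for n
  proof -
    have "(\<Sum>i<n. Hm m (D i)) \<le> (\<Sum>i<2*n. Hm m (D i))" by (intro sum_mono2) auto
    also have "\<dots> = (\<Sum>i<n. Hm m (D (2 * i))) + (\<Sum>i<n. Hm m (D (2 * i + 1)))"
      by (induction n) (auto simp: ac_simps)
    also have "\<dots> \<le> Hm m A + Hm m A" using sub[where n=n and p=0] sub[where n=n and p=1] by (intro add_mono) auto
    finally show ?thesis .
  qed
  then have "(\<Sum>i. Hm m (D i)) \<le> Hm m A + Hm m A"
    unfolding suminf_eq_SUP by (intro SUP_least)
  then have sfin: "(\<Sum>i. Hm m (D i)) < top" using fin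
    by (auto simp: less_top[symmetric] top_unique)
  have tail: "(\<lambda>k. \<Sum>i. Hm m (D (i + k))) \<longlonglongrightarrow> 0"
  proof -
    have eq: "(\<Sum>i. Hm m (D (i + k))) = (\<Sum>i. Hm m (D i)) - (\<Sum>i<k. Hm m (D i))" for k
    proof -
      have *: "(\<Sum>i. Hm m (D i)) = (\<Sum>i. Hm m (D (i + k))) + (\<Sum>i<k. Hm m (D i))"
        by (rule suminf_offset) auto
      then have "(\<Sum>i<k. Hm m (D i)) \<noteq> top" using sfin by (metis ennreal_add_eq_top less_irrefl)
      then show ?thesis unfolding * by simp
    qed
    have "(\<lambda>k. (\<Sum>i. Hm m (D i)) - (\<Sum>i<k. Hm m (D i))) \<longlonglongrightarrow> (\<Sum>i. Hm m (D i)) - (\<Sum>i. Hm m (D i))"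
      using sfin by (intro tendsto_diff_ennreal tendsto_const summable_LIMSEQ) (auto simp: less_top)
    then show ?thesis using sfin by (simp add: eq less_top )
  qed
  have step: "Hm m (A \<inter> C) + Hm m (A - C) \<le> Hm m A + (\<Sum>i. Hm m (D (i + k)))" for k
  proof -
    have "A - C \<subseteq> E k \<union> (\<Union>i. D (i + k))"
    proof
      fix x assume x: "x \<in> A - C"
      then have p: "0 < infdist x C" using C infdist_pos_not_in_closed by blast
      show "x \<in> E k \<union> (\<Union>i. D (i + k))"
      proof (cases "1 / (real k + 1) \<le> infdist x C")
        case True then show ?thesis using x by (auto simp: E_def)
      next
        case False
        obtain n0 :: nat where "1 / (real n0 + 1) < infdist x C"
          using p by (metis nat_approx_posE of_nat_Suc add.commute)
        then have ex: "\<exists>n. 1 / (real n + 1) \<le> infdist x C" by (auto intro: less_imp_le)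
        \<comment> \<open>For the least such \<open>n\<close> the bound fails at
          \<open>n - 1\<close>, which is exactly membership in the shell \<open>D (n - 1)\<close>;
          as \<open>n\<close> exceeds \<open>k\<close>, this shell belongs to the tail.\<close>
        define n where "n = (LEAST n. 1 / (real n + 1) \<le> infdist x C)"
        have n: "1 / (real n + 1) \<le> infdist x C" unfolding n_def using ex by (rule LeastI_ex)
        have nk: "k < n"
        proof (rule ccontr)
          assume "\<not> k < n"
          then have "1 / (real k + 1) \<le> 1 / (real n + 1)" by (intro divide_left_mono) auto
          with n False show False by simp
        qed
        have "\<not> 1 / (real (n - 1) + 1) \<le> infdist x C"
          using nk by (intro not_less_Least[of "n-1" "\<lambda>n. 1 / (real n + 1) \<le> infdist x C", folded n_def]) auto
        then have "x \<in> D (n - 1)" using n nk x by (auto simp: D_def of_nat_diff algebra_simps)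
        moreover have "n - 1 = (n - 1 - k) + k" using nk by simp
        ultimately have "x \<in> D ((n - 1 - k) + k)" by simp
        then show ?thesis by blast
      qed
    qed
    then have "Hm m (A - C) \<le> Hm m (E k) + (\<Sum>i. Hm m (D (i + k)))"
      by (intro order_trans[OF Hm_mono order_trans[OF Hm_subadditive2[OF m] add_left_mono[OF Hm_subadditive]]])
    then have "Hm m (A \<inter> C) + Hm m (A - C) \<le> (Hm m (A \<inter> C) + Hm m (E k)) + (\<Sum>i. Hm m (D (i + k)))"
      by (simp add: add_left_mono add.assoc)
    also have "Hm m (A \<inter> C) + Hm m (E k) \<le> Hm m ((A \<inter> C) \<union> E k)"
    proof (rule Hm_metric_additive[OF m])
      fix x y assume "x \<in> A \<inter> C" "y \<in> E k"
      then show "1 / (real k + 1) \<le> dist x y" using infdist_le[of x C y] by (auto simp: E_def dist_commute)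
    qed simp
    also have "Hm m ((A \<inter> C) \<union> E k) \<le> Hm m A" by (rule Hm_mono) (auto simp: E_def)
    finally show ?thesis by (simp add: add_right_mono)
  qed
  have "(\<lambda>k. Hm m A + (\<Sum>i. Hm m (D (i + k)))) \<longlonglongrightarrow> Hm m A + 0"
    using tail by (intro tendsto_add) auto
  then show ?thesis using step by (intro LIMSEQ_le_const) auto
qed

text \<open>The measure on Borel sets whose completion is \<open>HM\<close>. Translations and Fubini
  are handled here, away from the completed sigma-algebra.\<close>

definition HB :: "nat \<Rightarrow> 'a::euclidean_space measure" where
  "HB m = measure_of UNIV (sets borel) (Hm m)"

text \<open>Closed sets satisfy Caratheodory's condition and generate the Borel sets, while the
  measurable sets of an outer measure form a sigma-algebra on which it is countably
  additive.\<close>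

lemma measure_space_Hm:
  assumes m: "1 \<le> m"
  shows "measure_space UNIV (sets borel) (Hm m :: 'a::euclidean_space set \<Rightarrow> ennreal)"
proof -
  let ?f = "Hm m :: 'a set \<Rightarrow> ennreal"
  interpret sigma_algebra "UNIV :: 'a set" "Pow UNIV" by (rule sigma_algebra_Pow)
  have oms: "outer_measure_space (Pow UNIV) ?f"
    unfolding outer_measure_space_def positive_def increasing_def countably_subadditive_def
    using Hm_empty[OF m] by (auto intro: Hm_mono Hm_subadditive)
  have ms: "measure_space UNIV (lambda_system UNIV (Pow UNIV) ?f) ?f"
    by (rule caratheodory_lemma[OF oms])
  have "Collect closed \<subseteq> lambda_system UNIV (Pow UNIV) ?f"
  proof
    fix C :: "'a set" assume "C \<in> Collect closed"
    then have C: "closed C" by simp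
    have "?f (X \<inter> C) + ?f (X - C) = ?f X" for X
    proof (rule antisym)
      show "?f (X \<inter> C) + ?f (X - C) \<le> ?f X"
      proof (cases "C = {} \<or> ?f X = top")
        case True then show ?thesis by (auto simp: Hm_empty[OF m])
      next
        case False then show ?thesis by (intro Hm_closed_caratheodory[OF m C]) (auto simp: less_top)
      qed
      have "X = (X \<inter> C) \<union> (X - C)" by auto
      then show "?f X \<le> ?f (X \<inter> C) + ?f (X - C)" by (metis Hm_subadditive2[OF m])
    qed
    then show "C \<in> lambda_system UNIV (Pow UNIV) ?f" unfolding lambda_system_eq by simp
  qed
  moreover have "sigma_algebra UNIV (lambda_system UNIV (Pow UNIV) ?f)"
    using ms by (simp add: measure_space_def)
  ultimately have "sigma_sets UNIV (Collect closed) \<subseteq> lambda_system UNIV (Pow UNIV) ?f"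
    by (intro sigma_algebra.sigma_sets_subset)
  moreover have "sets (borel :: 'a measure) = sigma_sets UNIV (Collect closed)"
    unfolding borel_eq_closed by (intro sets_measure_of) auto
  ultimately show ?thesis
    using sets.sigma_algebra_axioms[of "borel :: 'a measure"] by (intro measure_down[OF ms]) simp_all
qed

lemma sets_HB [simp, measurable_cong]: "sets (HB m) = sets borel"
  unfolding HB_def by (metis sets.sigma_sets_eq sets_measure_of space_borel sets.space_closed)

lemma space_HB [simp]: "space (HB m) = UNIV"
  using sets_eq_imp_space_eq[OF sets_HB] by simp

lemma emeasure_HB:
  assumes "1 \<le> m" "X \<in> sets borel" shows "emeasure (HB m) X = Hm m X"
  unfolding HB_def
  by (rule emeasure_measure_of_sigma)
     (use measure_space_Hm[OF assms(1)] assms(2) in \<open>auto simp: measure_space_def\<close>)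

lemma HM_eq: "HM m = completion (HB m)"
  by (simp add: HM_def HB_def)

text \<open>Passing to closures does not change diameters, so covers of cost below
  \<open>1 / Suc k\<close> may be taken closed; intersecting their unions over \<open>k\<close>
  gives the Borel hull.\<close>

lemma Hm_null_borel:
  fixes N :: "'a::euclidean_space set"
  assumes "Hm m N = 0"
  obtains N' where "N' \<in> sets borel" "N \<subseteq> N'" "Hm m N' = 0"
proof -
  let ?w = "\<lambda>S. ennreal (unit_ball_vol (real m) * (diameter S / 2) ^ m)"
  have "\<forall>k. \<exists>S :: nat \<Rightarrow> 'a set. N \<subseteq> (\<Union>i. S i) \<and> (\<forall>i. bounded (S i) \<and> diameter (S i) \<le> 1 / real (Suc k)) \<and>
      (\<Sum>i. ?w (S i)) < ennreal (1 / real (Suc k))"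
  proof
    fix k
    have "Hm_delta m (1 / real (Suc k)) N \<le> 0"
      using Hm_delta_le_Hm[of "1 / real (Suc k)" m N] assms by simp
    then have "Hm_delta m (1 / real (Suc k)) N < ennreal (1 / real (Suc k))" by (simp add: order_le_less_trans)
    then show "\<exists>S :: nat \<Rightarrow> 'a set. N \<subseteq> (\<Union>i. S i) \<and> (\<forall>i. bounded (S i) \<and> diameter (S i) \<le> 1 / real (Suc k)) \<and>
      (\<Sum>i. ?w (S i)) < ennreal (1 / real (Suc k))" by (elim Hm_delta_less_cover) blast
  qed
  from choice[OF this] obtain S :: "nat \<Rightarrow> nat \<Rightarrow> 'a set" where S: "\<And>k. N \<subseteq> (\<Union>i. S k i)"
    "\<And>k i. bounded (S k i)" "\<And>k i. diameter (S k i) \<le> 1 / real (Suc k)"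
    "\<And>k. (\<Sum>i. ?w (S k i)) < ennreal (1 / real (Suc k))" by blast
  define N' where "N' = (\<Inter>k. \<Union>i. closure (S k i))"
  have "Hm m N' \<le> 0"
  proof (rule Hm_leI, rule ennreal_le_epsilon)
    fix \<delta> e :: real assume d: "0 < \<delta>" and e: "0 < e"
    obtain k where k: "1 / real (Suc k) < min \<delta> e" using d e nat_approx_posE[of "min \<delta> e"] by auto
    have "Hm_delta m \<delta> N' \<le> (\<Sum>i. ?w (closure (S k i)))"
    proof (rule Hm_delta_le)
      show "diameter (closure (S k i)) \<le> \<delta>" for i
        using S(2,3)[of k i] k by (simp add: diameter_closure)
    qed (use S(2) in \<open>auto simp: N'_def\<close>)
    also have "\<dots> = (\<Sum>i. ?w (S k i))" using S(2) by (simp add: diameter_closure)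
    also have "\<dots> \<le> ennreal e"
      using S(4)[of k] k by (meson ennreal_leI less_imp_le min_less_iff_conj order_trans)
    finally show "Hm_delta m \<delta> N' \<le> 0 + ennreal e" by simp
  qed
  then show ?thesis
    by (intro that[of N']) (use S(1) closure_subset in \<open>auto simp: N'_def, blast\<close>)
qed

text \<open>Meant for exceptional sets such as those of tangent cones, whose Borel measurability is
  not at hand.\<close>

lemma Hm_null_sets_HM:
  assumes "1 \<le> m" "Hm m N = 0" shows "N \<in> null_sets (HM m)"
proof -
  obtain N' where "N' \<in> sets borel" "N \<subseteq> N'" "Hm m N' = 0" using Hm_null_borel[OF assms(2)] .
  then have "N' \<in> null_sets (HB m)" using emeasure_HB[OF assms(1), of N'] by (simp add: null_sets_def)
  then show ?thesis unfolding HM_eq using \<open>N \<subseteq> N'\<close> by (auto simp: null_sets_completion_iff2)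
qed

lemma Hm_lipschitz:
  fixes f :: "'a::euclidean_space \<Rightarrow> 'a"
  assumes L: "0 < L" and f: "\<And>x y. x \<in> X \<Longrightarrow> y \<in> X \<Longrightarrow> dist (f x) (f y) \<le> L * dist x y"
  shows "Hm m (f ` X) \<le> ennreal (L ^ m) * Hm m X"
proof (rule Hm_leI, rule ennreal_le_epsilon)
  let ?w = "\<lambda>S. ennreal (unit_ball_vol (real m) * (diameter S / 2) ^ m)"
  fix \<delta> e :: real assume d: "0 < \<delta>" and e: "0 < e" and fin: "ennreal (L ^ m) * Hm m X < top"
  have "Hm m X < top" using fin L by (auto simp: ennreal_mult_less_top)
  then have "Hm m X < Hm m X + ennreal (e / L ^ m)"
    using e L by (intro ennreal_less_add_pos) auto
  then have "Hm_delta m (\<delta> / L) X < Hm m X + ennreal (e / L ^ m)"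
    using Hm_delta_le_Hm[of "\<delta> / L" m X] d L by (meson divide_pos_pos le_less_trans)
  then obtain S where S: "X \<subseteq> (\<Union>i. S i)" "\<And>i. bounded (S i)" "\<And>i. diameter (S i) \<le> \<delta> / L"
    and s: "(\<Sum>i. ?w (S i)) < Hm m X + ennreal (e / L ^ m)"
    by (rule Hm_delta_less_cover) blast
  \<comment> \<open>\<open>f\<close> is Lipschitz on \<open>X\<close> only, so the covering sets are
    cut down to \<open>X\<close> before they are mapped.\<close>
  have di: "dist (f x) (f y) \<le> L * diameter (S i)" if "x \<in> S i \<inter> X" "y \<in> S i \<inter> X" for x y i
    using f[of x y] diameter_bounded_bound[OF S(2), of x i y] L that
    by (meson IntD1 IntD2 mult_left_mono order_trans less_imp_le)
  have dg: "diameter (f ` (S i \<inter> X)) \<le> L * diameter (S i)" for i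
    using di L diameter_ge_0[OF S(2)] by (intro diameter_le) (auto simp: dist_norm)
  have bd: "bounded (f ` (S i \<inter> X))" for i
  proof (cases "S i \<inter> X = {}")
    case False
    then obtain y where "y \<in> S i \<inter> X" by blast
    then have "\<forall>z\<in>f ` (S i \<inter> X). dist (f y) z \<le> L * diameter (S i)" using di by auto
    then show ?thesis unfolding bounded_def by blast
  qed auto
  have "Hm_delta m \<delta> (f ` X) \<le> (\<Sum>i. ?w (f ` (S i \<inter> X)))"
  proof (rule Hm_delta_le)
    show "diameter (f ` (S i \<inter> X)) \<le> \<delta>" for i
      using dg[of i] S(3)[of i] L by (simp add: field_simps)
    show "f ` X \<subseteq> (\<Union>i. f ` (S i \<inter> X))"
    proof (rule image_subsetI)
      fix x assume x: "x \<in> X"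
      then obtain i where "x \<in> S i" using subsetD[OF S(1)] by auto
      then have "f x \<in> f ` (S i \<inter> X)" using x by simp
      then show "f x \<in> (\<Union>i. f ` (S i \<inter> X))" by (rule UN_I[OF UNIV_I])
    qed
  qed (rule bd)
  also have "\<dots> \<le> (\<Sum>i. ennreal (L ^ m) * ?w (S i))"
  proof (intro suminf_le)
    fix i
    have "(diameter (f ` (S i \<inter> X)) / 2) ^ m \<le> (L * (diameter (S i) / 2)) ^ m"
      using dg[of i] diameter_ge_0[OF bd[of i]] by (intro power_mono) auto
    then have "(diameter (f ` (S i \<inter> X)) / 2) ^ m \<le> L ^ m * (diameter (S i) / 2) ^ m"
      by (simp only: power_mult_distrib)
    then have "unit_ball_vol (real m) * (diameter (f ` (S i \<inter> X)) / 2) ^ m \<le> L ^ m * (unit_ball_vol (real m) * (diameter (S i) / 2) ^ m)"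
      using mult_left_mono[of _ _ "unit_ball_vol (real m)"] by (simp only: mult.left_commute[of _ "unit_ball_vol (real m)"]) simp
    then show "?w (f ` (S i \<inter> X)) \<le> ennreal (L ^ m) * ?w (S i)"
      using L by (simp add: ennreal_mult' ennreal_leI flip: ennreal_mult')
  qed auto
  also have "\<dots> = ennreal (L ^ m) * (\<Sum>i. ?w (S i))" by simp
  also have "\<dots> \<le> ennreal (L ^ m) * (Hm m X + ennreal (e / L ^ m))"
    using s by (intro mult_left_mono) auto
  also have "\<dots> = ennreal (L ^ m) * Hm m X + ennreal e"
    using L e by (simp add: distrib_left ennreal_mult'[symmetric])
  finally show "Hm_delta m \<delta> (f ` X) \<le> ennreal (L ^ m) * Hm m X + ennreal e" .
qed

lemma Hm_translate: "Hm m ((+) v ` X) = Hm m (X :: 'a::euclidean_space set)"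
proof (rule antisym)
  have 1: "Hm m ((+) v ` X) \<le> Hm m X" for v and X :: "'a set"
    using Hm_lipschitz[of 1 X "(+) v" m] by simp
  show "Hm m ((+) v ` X) \<le> Hm m X" by (rule 1)
  have "X = (+) (-v) ` (+) v ` X" by (auto simp: image_image)
  then show "Hm m X \<le> Hm m ((+) v ` X)" using 1[of "-v" "(+) v ` X"] by simp
qed

section \<open>Planes: bounded pieces have finite measure, balls positive measure, intersections are
  null\<close>

lemma norm_le_sum_basis_subset:
  assumes "B0 \<subseteq> Basis" "x \<in> span B0"
  shows "norm (x::'a::euclidean_space) \<le> (\<Sum>b\<in>B0. \<bar>x \<bullet> b\<bar>)"
proof -
  have fB: "finite B0" using assms(1) finite_Basis finite_subset by blast
  have "x = (\<Sum>b\<in>B0. (x \<bullet> b) *\<^sub>R b)"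
    using assms(2)
  proof (induction rule: span_induct_alt)
    case base then show ?case by simp
  next
    case (step c y z)
    have "(\<Sum>b\<in>B0. ((c *\<^sub>R y + z) \<bullet> b) *\<^sub>R b) = c *\<^sub>R (\<Sum>b\<in>B0. (y \<bullet> b) *\<^sub>R b) + (\<Sum>b\<in>B0. (z \<bullet> b) *\<^sub>R b)"
      by (simp add: inner_add_left scaleR_add_left sum.distrib scaleR_sum_right)
    also have "(\<Sum>b\<in>B0. (y \<bullet> b) *\<^sub>R b) = (\<Sum>b\<in>B0. if b = y then y else 0)"
      using step assms(1) by (intro sum.cong) (auto simp: inner_Basis subset_iff)
    also have "\<dots> = y" using step fB by simp
    finally show ?case using step by simp
  qed
  then have "norm x \<le> (\<Sum>b\<in>B0. norm ((x \<bullet> b) *\<^sub>R b))" by (metis norm_sum)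
  also have "\<dots> = (\<Sum>b\<in>B0. \<bar>x \<bullet> b\<bar>)" using assms(1) by (intro sum.cong) auto
  finally show ?thesis .
qed

definition coord_cube :: "'a::euclidean_space set \<Rightarrow> 'a set" where
  "coord_cube B0 = {x \<in> span B0. \<forall>b\<in>B0. 0 \<le> x \<bullet> b \<and> x \<bullet> b \<le> 1}"

text \<open>Cutting the cube into \<open>N ^ m\<close> cubes of side \<open>1 / N\<close>, each of
  diameter at most \<open>m / N\<close>, costs a total that does not depend on
  \<open>N\<close>.\<close>

lemma Hm_coord_cube_finite:
  fixes B0 :: "'a::euclidean_space set"
  assumes B0: "B0 \<subseteq> Basis" "card B0 = m" and m: "1 \<le> m"
  shows "Hm m (coord_cube B0) < top"
proof -
  have fB: "finite B0" using B0 finite_Basis finite_subset by blast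
  let ?w = "\<lambda>S. ennreal (unit_ball_vol (real m) * (diameter S / 2) ^ m)"
  have "Hm m (coord_cube B0) \<le> ennreal (unit_ball_vol (real m) * (real m / 2) ^ m)"
  proof (rule Hm_leI)
    fix \<delta> :: real assume d: "0 < \<delta>"
    obtain N0 :: nat where "real m / \<delta> < real N0" using reals_Archimedean2 by blast
    define N where "N = Suc N0"
    have N: "0 < N" "real m / real N \<le> \<delta>"
      using \<open>real m / \<delta> < real N0\<close> d by (auto simp: N_def field_simps)
    define Q where "Q k = {x \<in> span B0. \<forall>b\<in>B0. real (k b) \<le> real N * (x \<bullet> b) \<and> real N * (x \<bullet> b) \<le> real (k b) + 1}" for k :: "'a \<Rightarrow> nat"
    define K where "K = PiE B0 (\<lambda>_. {..<N})"
    have fK: "finite K" and cK: "card K = N ^ m" using fB B0 by (auto simp: K_def card_PiE intro: finite_PiE)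
    have dQ: "norm (x - y) \<le> real m / real N" if "x \<in> Q k" "y \<in> Q k" for x y k
    proof -
      have "norm (x - y) \<le> (\<Sum>b\<in>B0. \<bar>(x - y) \<bullet> b\<bar>)"
        using that by (intro norm_le_sum_basis_subset[OF B0(1)] span_diff) (auto simp: Q_def)
      also have "\<dots> \<le> (\<Sum>b\<in>B0. 1 / real N)"
      proof (intro sum_mono)
        fix b assume "b \<in> B0"
        then have "real (k b) \<le> real N * (x \<bullet> b)" "real N * (x \<bullet> b) \<le> real (k b) + 1"
          "real (k b) \<le> real N * (y \<bullet> b)" "real N * (y \<bullet> b) \<le> real (k b) + 1"
          using that by (auto simp: Q_def)
        then have "\<bar>real N * (x \<bullet> b) - real N * (y \<bullet> b)\<bar> \<le> 1" by linarith
        then have "real N * \<bar>(x - y) \<bullet> b\<bar> \<le> 1"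
          by (simp add: inner_diff_left abs_mult flip: right_diff_distrib)
        then show "\<bar>(x - y) \<bullet> b\<bar> \<le> 1 / real N" using N by (simp add: field_simps)
      qed
      finally show ?thesis using B0 by simp
    qed
    have diaQ: "diameter (Q k) \<le> real m / real N" for k
      using dQ by (intro diameter_le) auto
    have bQ: "bounded (Q k)" for k
    proof (cases "Q k = {}")
      case False
      then obtain y where y: "y \<in> Q k" by blast
      then have "\<forall>x\<in>Q k. dist y x \<le> real m / real N" using dQ by (auto simp: dist_norm)
      then show ?thesis unfolding bounded_def by blast
    qed auto
    obtain g where g: "bij_betw g {0..<N ^ m} K" using ex_bij_betw_nat_finite[OF fK] cK by auto
    define S where "S i = (if i < N ^ m then Q (g i) else {})" for i
    have "Hm_delta m \<delta> (coord_cube B0) \<le> (\<Sum>i. ?w (S i))"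
    proof (rule Hm_delta_le)
      show "coord_cube B0 \<subseteq> (\<Union>i. S i)"
      proof
        fix x assume x: "x \<in> coord_cube B0"
        \<comment> \<open>The minimum with \<open>N - 1\<close> assigns points of the face
          \<open>x \<bullet> b = 1\<close>, where the floor is \<open>N\<close>, to the last
          cube.\<close>
        define k where "k = restrict (\<lambda>b. min (N - 1) (nat \<lfloor>real N * (x \<bullet> b)\<rfloor>)) B0"
        have kK: "k \<in> K" using N by (auto simp: k_def K_def)
        have "x \<in> Q k"
        proof -
          have "real (k b) \<le> real N * (x \<bullet> b) \<and> real N * (x \<bullet> b) \<le> real (k b) + 1" if b: "b \<in> B0" for b
          proof -
            have xb: "0 \<le> x \<bullet> b" "x \<bullet> b \<le> 1" using x b by (auto simp: coord_cube_def)
            then have up: "real N * (x \<bullet> b) \<le> real N" "0 \<le> real N * (x \<bullet> b)" by (auto simp: mult_left_le)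
            have fl: "real (nat \<lfloor>real N * (x \<bullet> b)\<rfloor>) \<le> real N * (x \<bullet> b)"
              "real N * (x \<bullet> b) \<le> real (nat \<lfloor>real N * (x \<bullet> b)\<rfloor>) + 1" using up by linarith+
            show ?thesis
            proof (cases "nat \<lfloor>real N * (x \<bullet> b)\<rfloor> \<le> N - 1")
              case True then show ?thesis using fl b by (simp add: k_def)
            next
              case False
              then have "k b = N - 1" using b by (simp add: k_def)
              then have "real (k b) = real N - 1" using N by (simp add: of_nat_diff)
              moreover have "real N \<le> real (nat \<lfloor>real N * (x \<bullet> b)\<rfloor>)" using False N by linarith
              ultimately show ?thesis using fl up by linarith
            qed
          qed
          then show ?thesis using x by (auto simp: Q_def coord_cube_def)
        qed
        moreover obtain i where "i < N ^ m" "g i = k" using g kK by (auto simp: bij_betw_def)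
        ultimately have "x \<in> S i" by (simp add: S_def)
        then show "x \<in> (\<Union>i. S i)" by blast
      qed
      show "bounded (S i)" for i using bQ by (simp add: S_def)
      show "diameter (S i) \<le> \<delta>" for i using diaQ[of "g i"] N d by (simp add: S_def)
    qed
    also have "(\<Sum>i. ?w (S i)) = (\<Sum>i<N^m. ?w (S i))"
      by (rule suminf_finite) (use m in \<open>auto simp: S_def power_0_left\<close>)
    also have "\<dots> \<le> (\<Sum>i<N^m. ennreal (unit_ball_vol (real m) * (real m / real N / 2) ^ m))"
      by (intro sum_mono ennreal_leI mult_left_mono power_mono divide_right_mono)
         (use diaQ in \<open>auto simp: S_def intro!: diameter_ge_0 bQ\<close>)
    also have "\<dots> = ennreal (real (N^m) * (unit_ball_vol (real m) * (real m / real N / 2) ^ m))"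
      by (simp add: ennreal_mult' ennreal_of_nat_eq_real_of_nat)
    also have "real (N^m) * (unit_ball_vol (real m) * (real m / real N / 2) ^ m) = unit_ball_vol (real m) * (real m / 2) ^ m"
      using N by (simp add: power_divide)
    finally show "Hm_delta m \<delta> (coord_cube B0) \<le> ennreal (unit_ball_vol (real m) * (real m / 2) ^ m)" .
  qed
  then show ?thesis by (rule le_less_trans) simp
qed

text \<open>A set of diameter \<open>d\<close> in the coordinate plane lies in a cube of side \<open>2 d\<close>, so comparing volumes of
  cylinders over the plane bounds any cover from below.\<close>

lemma Hm_coord_cube_pos:
  fixes B0 :: "'a::euclidean_space set"
  assumes B0: "B0 \<subseteq> Basis" "card B0 = m" and m: "1 \<le> m"
  shows "ennreal (unit_ball_vol (real m) / 4 ^ m) \<le> Hm m (coord_cube B0)"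
proof -
  let ?w = "\<lambda>S. ennreal (unit_ball_vol (real m) * (diameter S / 2) ^ m)"
  have fB: "finite B0" using B0 finite_Basis finite_subset by blast
  have "ennreal (unit_ball_vol (real m) / 4 ^ m) \<le> Hm_delta m 1 (coord_cube B0)"
  proof (unfold Hm_delta_def, rule INF_greatest)
    fix S :: "nat \<Rightarrow> 'a set" assume "S \<in> {S. coord_cube B0 \<subseteq> (\<Union>i. S i) \<and> (\<forall>i. bounded (S i) \<and> diameter (S i) \<le> 1)}"
    then have S: "coord_cube B0 \<subseteq> (\<Union>i. S i)" "\<And>i. bounded (S i)" by auto
    define s where "s i = (SOME x. x \<in> S i)" for i
    \<comment> \<open>In the directions outside \<open>B0\<close> the box always has the side from 0
      to 1. Its Lebesgue measure is then \<open>(2 * diameter (S i)) ^ m\<close>, and the boxes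
      cover the full unit cube as soon as the sets \<open>S i\<close> cover its coordinate
      face.\<close>
    define l where "l i = (\<Sum>b\<in>Basis. (if b \<in> B0 then s i \<bullet> b - diameter (S i) else 0) *\<^sub>R b)" for i
    define u where "u i = (\<Sum>b\<in>Basis. (if b \<in> B0 then s i \<bullet> b + diameter (S i) else 1) *\<^sub>R b)" for i
    define T where "T i = (if S i = {} then {} else cbox (l i) (u i))" for i
    have d0: "0 \<le> diameter (S i)" for i using S(2) by (rule diameter_ge_0)
    have lu: "l i \<bullet> b = (if b \<in> B0 then s i \<bullet> b - diameter (S i) else 0)"
      "u i \<bullet> b = (if b \<in> B0 then s i \<bullet> b + diameter (S i) else 1)" if "b \<in> Basis" for i b
      using that by (simp_all add: l_def u_def)
    have vol: "emeasure lborel (T i) \<le> ennreal ((2 * diameter (S i)) ^ m)" for i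
    proof (cases "S i = {}")
      case False
      have "emeasure lborel (cbox (l i) (u i)) = ennreal (\<Prod>b\<in>Basis. (u i - l i) \<bullet> b)"
        using d0 by (intro emeasure_lborel_cbox) (auto simp: lu intro: order_trans)
      also have "(\<Prod>b\<in>Basis. (u i - l i) \<bullet> b) = (\<Prod>b\<in>Basis. if b \<in> B0 then 2 * diameter (S i) else 1)"
        by (intro prod.cong) (auto simp: inner_diff_left lu)
      also have "\<dots> = (\<Prod>b\<in>Basis \<inter> B0. 2 * diameter (S i))"
        by (simp add: prod.If_cases)
      also have "\<dots> = (2 * diameter (S i)) ^ m" using B0 by (simp add: Int_absorb1)
      finally show ?thesis using False by (simp add: T_def)
    qed (simp add: T_def)
    have "cbox 0 One \<subseteq> (\<Union>i. T i)"
    proof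
      fix x :: 'a assume x: "x \<in> cbox 0 One"
      define y where "y = (\<Sum>b\<in>B0. (x \<bullet> b) *\<^sub>R b)"
      have yb: "y \<bullet> b = x \<bullet> b" if "b \<in> B0" for b
      proof -
        have "y \<bullet> b = (\<Sum>c\<in>B0. if c = b then x \<bullet> b else 0)"
          unfolding y_def inner_sum_left using that B0(1) by (intro sum.cong) (auto simp: inner_Basis subset_iff)
        then show ?thesis using that fB by simp
      qed
      have "y \<in> span B0" unfolding y_def by (intro span_sum span_scale span_base)
      then have "y \<in> coord_cube B0" using x yb B0(1) by (auto simp: coord_cube_def mem_box)
      then obtain i where i: "y \<in> S i" using S(1) by blast
      then have si: "s i \<in> S i" unfolding s_def by (rule someI)
      have "\<bar>x \<bullet> b - s i \<bullet> b\<bar> \<le> diameter (S i)" if "b \<in> B0" for b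
      proof -
        have "\<bar>(y - s i) \<bullet> b\<bar> \<le> norm (y - s i)" using that B0(1) by (intro Basis_le_norm) auto
        also have "\<dots> \<le> diameter (S i)" using diameter_bounded_bound[OF S(2) i si] by (simp add: dist_norm)
        finally show ?thesis using yb[OF that] by (simp add: inner_diff_left)
      qed
      then have "x \<in> cbox (l i) (u i)" using x by (fastforce simp: mem_box lu abs_le_iff)
      then have "x \<in> T i" using i by (auto simp: T_def)
      then show "x \<in> (\<Union>i. T i)" by blast
    qed
    then have "emeasure lborel (cbox 0 One :: 'a set) \<le> emeasure lborel (\<Union>i. T i)"
      by (rule emeasure_mono) (auto simp: T_def)
    also have "\<dots> \<le> (\<Sum>i. emeasure lborel (T i))"
      by (rule emeasure_subadditive_countably) (auto simp: T_def)
    also have "\<dots> \<le> (\<Sum>i. ennreal ((2 * diameter (S i)) ^ m))"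
      by (intro suminf_le vol) auto
    finally have "1 \<le> (\<Sum>i. ennreal ((2 * diameter (S i)) ^ m))"
      by (simp add: emeasure_lborel_cbox)
    \<comment> \<open>The factor \<open>4 ^ m\<close> converts \<open>(2 * d) ^ m\<close>, the
      volume of a box, into \<open>(d / 2) ^ m\<close>, the weight in the definition of Hausdorff
      measure.\<close>
    then have "ennreal (unit_ball_vol (real m) / 4 ^ m) * 1 \<le> ennreal (unit_ball_vol (real m) / 4 ^ m) * (\<Sum>i. ennreal ((2 * diameter (S i)) ^ m))"
      by (intro mult_left_mono) auto
    also have "\<dots> = (\<Sum>i. ennreal (unit_ball_vol (real m) / 4 ^ m) * ennreal ((2 * diameter (S i)) ^ m))"
      by simp
    also have "\<dots> = (\<Sum>i. ?w (S i))"
    proof (intro suminf_cong)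
      fix i
      have "(2 * diameter (S i)) ^ m = 4 ^ m * (diameter (S i) / 2) ^ m"
        unfolding power_mult_distrib[symmetric] by simp
      then show "ennreal (unit_ball_vol (real m) / 4 ^ m) * ennreal ((2 * diameter (S i)) ^ m) = ?w (S i)"
        using d0 by (simp add: ennreal_mult'[symmetric])
    qed
    finally show "ennreal (unit_ball_vol (real m) / 4 ^ m) \<le> (\<Sum>i. ?w (S i))" by simp
  qed
  also have "\<dots> \<le> Hm m (coord_cube B0)" by (rule Hm_delta_le_Hm) simp
  finally show ?thesis .
qed

text \<open>Reduces every plane to a coordinate plane of the same dimension; linear isometries
  between the two are Lipschitz with constant 1 in both directions.\<close>

lemma Grass_isometry_coord:
  fixes P :: "'a::euclidean_space set"
  assumes "P \<in> Grass m"
  obtains B0 :: "'a set" and f g :: "'a \<Rightarrow> 'a" where "B0 \<subseteq> Basis" "card B0 = m" "linear f" "linear g" "f ` span B0 = P" "g ` P = span B0"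
    "\<And>x. x \<in> span B0 \<Longrightarrow> norm (f x) = norm x" "\<And>x. x \<in> P \<Longrightarrow> norm (g x) = norm x"
    "\<And>x. x \<in> span B0 \<Longrightarrow> g (f x) = x" "\<And>x. x \<in> P \<Longrightarrow> f (g x) = x"
proof -
  have P: "subspace P" "dim P = m" using assms by (auto simp: Grass_def)
  have "m \<le> card (Basis :: 'a set)" using P(2) dim_subset_UNIV[of P] by simp
  then obtain B0 :: "'a set" where B0: "B0 \<subseteq> Basis" "card B0 = m" by (rule obtain_subset_with_card_n)
  have "independent B0" using independent_Basis B0(1) independent_mono by blast
  then have "dim (span B0) = m" using B0 by (simp add: dim_eq_card_independent)
  then have "dim (span B0) = dim P" using P by simp
  then show ?thesis
    using isometries_subspaces[OF subspace_span P(1)] that[OF B0] by blast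
qed

text \<open>A convenient lower bound, not the sharp density: \<open>4 ^ m\<close> is lost in
  comparing with Lebesgue measure and \<open>(m + 1) ^ m\<close> in fitting a cube into the
  ball.\<close>

definition plane_const :: "nat \<Rightarrow> real" where
  "plane_const m = unit_ball_vol (real m) / 4 ^ m / (real m + 1) ^ m"

lemma plane_const_pos: "0 < plane_const m"
  by (simp add: plane_const_def)

text \<open>The unit coordinate cube, scaled by \<open>s / (m + 1)\<close> and placed isometrically
  with a corner at \<open>p\<close>, lies in the ball. The map back has Lipschitz constant
  \<open>1 / c\<close> and transfers the lower bound for the cube.\<close>

lemma Hm_plane_ball_ge:
  fixes P :: "'a::euclidean_space set"
  assumes P: "P \<in> Grass m" and m: "1 \<le> m" and s: "0 < s"
  shows "ennreal (plane_const m * s ^ m) \<le> Hm m ((+) p ` P \<inter> ball p s)"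
proof -
  obtain B0 :: "'a set" and f g :: "'a \<Rightarrow> 'a" where B0: "B0 \<subseteq> Basis" "card B0 = m" and fg: "linear f" "linear g" "f ` span B0 = P" "g ` P = span B0"
    "\<And>x. x \<in> span B0 \<Longrightarrow> norm (f x) = norm x" "\<And>x. x \<in> P \<Longrightarrow> norm (g x) = norm x"
    "\<And>x. x \<in> span B0 \<Longrightarrow> g (f x) = x" "\<And>x. x \<in> P \<Longrightarrow> f (g x) = x"
    by (rule Grass_isometry_coord[OF P]) (rule that)
  have sP: "subspace P" using P by (auto simp: Grass_def)
  define c where "c = s / (real m + 1)"
  have c: "0 < c" using s by (simp add: c_def)
  define X where "X = (+) p ` P \<inter> ball p s"
  define G where "G y = (1 / c) *\<^sub>R g (y - p)" for y
  have "coord_cube B0 \<subseteq> G ` X"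
  proof
    fix x assume x: "x \<in> coord_cube B0"
    then have xs: "x \<in> span B0" by (simp add: coord_cube_def)
    have "norm x \<le> (\<Sum>b\<in>B0. \<bar>x \<bullet> b\<bar>)" by (rule norm_le_sum_basis_subset[OF B0(1) xs])
    also have "\<dots> \<le> (\<Sum>b\<in>B0. 1)" using x by (intro sum_mono) (auto simp: coord_cube_def)
    finally have nx: "norm x \<le> real m" using B0 by simp
    let ?y = "p + c *\<^sub>R f x"
    have "f x \<in> P" using xs fg(3) by blast
    then have "?y \<in> (+) p ` P" using sP by (auto intro: subspace_scale)
    moreover have "dist p ?y < s"
    proof -
      have "dist p ?y = c * norm x" using c fg(5)[OF xs] by (simp add: dist_norm)
      also have "\<dots> \<le> c * real m" using nx c by simp
      also have "\<dots> < c * (real m + 1)" using c by simp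
      also have "\<dots> = s" by (simp add: c_def)
      finally show ?thesis .
    qed
    ultimately have "?y \<in> X" by (simp add: X_def)
    moreover have "G ?y = x" using c fg(7)[OF xs] linear_scale[OF fg(2)] by (simp add: G_def)
    ultimately show "x \<in> G ` X" by (metis image_eqI)
  qed
  then have "Hm m (coord_cube B0) \<le> Hm m (G ` X)" by (rule Hm_mono)
  also have "\<dots> \<le> ennreal ((1 / c) ^ m) * Hm m X"
  proof (rule Hm_lipschitz)
    fix x y assume "x \<in> X" "y \<in> X"
    then have "x - p \<in> P" "y - p \<in> P" by (auto simp: X_def)
    then have "(x - p) - (y - p) \<in> P" using sP subspace_diff by blast
    then have "norm (g ((x - p) - (y - p))) = norm (x - y)" using fg(6) by simp
    moreover have "g (x - p) - g (y - p) = g ((x - p) - (y - p))" by (simp only: linear_diff[OF fg(2)])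
    ultimately show "dist (G x) (G y) \<le> 1 / c * dist x y"
      using c by (simp add: G_def dist_norm flip: scaleR_diff_right)
  qed (use c in simp)
  finally have "ennreal (unit_ball_vol (real m) / 4 ^ m) \<le> ennreal ((1 / c) ^ m) * Hm m X"
    using Hm_coord_cube_pos[OF B0 m] by order
  then have "ennreal (c ^ m) * ennreal (unit_ball_vol (real m) / 4 ^ m) \<le> ennreal (c ^ m) * (ennreal ((1 / c) ^ m) * Hm m X)"
    by (intro mult_left_mono) auto
  also have "\<dots> = Hm m X" using c by (simp add: mult.assoc[symmetric] ennreal_mult'[symmetric] power_mult_distrib[symmetric])
  also have "ennreal (c ^ m) * ennreal (unit_ball_vol (real m) / 4 ^ m) = ennreal (plane_const m * s ^ m)"
    using c by (simp add: ennreal_mult'[symmetric] plane_const_def c_def power_divide mult.commute)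
  finally show ?thesis by (simp add: X_def)
qed

lemma Hm_plane_ball_finite:
  fixes P :: "'a::euclidean_space set"
  assumes P: "P \<in> Grass m" and m: "1 \<le> m"
  shows "Hm m ((+) p ` P \<inter> ball q s) < top"
proof -
  obtain B0 :: "'a set" and f g :: "'a \<Rightarrow> 'a" where B0: "B0 \<subseteq> Basis" "card B0 = m" and fg: "linear f" "linear g" "f ` span B0 = P" "g ` P = span B0"
    "\<And>x. x \<in> span B0 \<Longrightarrow> norm (f x) = norm x" "\<And>x. x \<in> P \<Longrightarrow> norm (g x) = norm x"
    "\<And>x. x \<in> span B0 \<Longrightarrow> g (f x) = x" "\<And>x. x \<in> P \<Longrightarrow> f (g x) = x"
    by (rule Grass_isometry_coord[OF P]) (rule that)
  have fB: "finite B0" using B0 finite_Basis finite_subset by blast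
  \<comment> \<open>Side length of a cube centred at \<open>p\<close> that contains the piece: each
    of its points has distance at most \<open>c / 2\<close> from \<open>p\<close>.\<close>
  define c where "c = 2 * (dist p q + \<bar>s\<bar> + 1)"
  have c: "0 < c" unfolding c_def using zero_le_dist[of p q] abs_ge_zero[of s] by argo
  \<comment> \<open>\<open>coord_cube\<close> has a corner at the origin; subtracting its midpoint
    \<open>e\<close> centres it.\<close>
  define e where "e = (1/2) *\<^sub>R (\<Sum>b\<in>B0. b)"
  have es: "e \<in> span B0" unfolding e_def by (intro span_sum span_scale span_base)
  have eb: "e \<bullet> b = 1/2" if "b \<in> B0" for b
  proof -
    have "(\<Sum>c\<in>B0. c \<bullet> b) = (\<Sum>c\<in>B0. if c = b then 1 else 0)"
      using that B0(1) by (intro sum.cong) (auto simp: inner_Basis subset_iff)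
    then show ?thesis using that fB by (simp add: e_def inner_sum_left)
  qed
  define G where "G x = p + c *\<^sub>R f (x - e)" for x
  have "(+) p ` P \<inter> ball q s \<subseteq> G ` coord_cube B0"
  proof
    fix y assume y: "y \<in> (+) p ` P \<inter> ball q s"
    then have yP: "y - p \<in> P" by auto
    have "norm (y - p) \<le> dist y q + dist p q" using dist_triangle2[of y p q] by (simp add: dist_norm)
    also have "\<dots> \<le> c / 2" using y abs_ge_self[of s] by (simp add: c_def dist_commute)
    finally have ny: "norm (y - p) \<le> c / 2" .
    define x where "x = (1/c) *\<^sub>R g (y - p) + e"
    have gs: "g (y - p) \<in> span B0" using yP fg(4) by blast
    have xs: "x \<in> span B0" unfolding x_def using gs es by (intro span_add span_scale)
    have "0 \<le> x \<bullet> b \<and> x \<bullet> b \<le> 1" if b: "b \<in> B0" for b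
    proof -
      have "\<bar>g (y - p) \<bullet> b\<bar> \<le> norm (g (y - p))" using b B0(1) by (intro Basis_le_norm) auto
      also have "\<dots> \<le> c / 2" using fg(6)[OF yP] ny by simp
      finally have "\<bar>(1/c) * (g (y - p) \<bullet> b)\<bar> \<le> 1 / 2" using c by (simp add: abs_mult field_simps)
      moreover have "x \<bullet> b = (1/c) * (g (y - p) \<bullet> b) + 1/2" by (simp add: x_def inner_add_left eb[OF b])
      ultimately show ?thesis by linarith
    qed
    then have "x \<in> coord_cube B0" using xs by (simp add: coord_cube_def)
    moreover have "G x = y"
      using c fg(8)[OF yP] linear_scale[OF fg(1)] by (simp add: G_def x_def)
    ultimately show "y \<in> G ` coord_cube B0" by blast
  qed
  then have "Hm m ((+) p ` P \<inter> ball q s) \<le> Hm m (G ` coord_cube B0)" by (rule Hm_mono)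
  also have "\<dots> \<le> ennreal (c ^ m) * Hm m (coord_cube B0)"
  proof (rule Hm_lipschitz[OF c])
    fix x y assume "x \<in> coord_cube B0" "y \<in> coord_cube B0"
    then have "x - y \<in> span B0" by (auto simp: coord_cube_def intro: span_diff)
    then have "norm (f (x - y)) = norm (x - y)" using fg(5) by simp
    moreover have "f (x - e) - f (y - e) = f (x - y)" by (simp flip: linear_diff[OF fg(1)])
    ultimately show "dist (G x) (G y) \<le> c * dist x y"
      using c by (simp add: G_def dist_norm flip: scaleR_diff_right)
  qed
  also have "\<dots> < top" using Hm_coord_cube_finite[OF B0 m] by (simp add: ennreal_mult_less_top)
  finally show ?thesis .
qed

lemma closed_plane: "P \<in> Grass m \<Longrightarrow> closed ((+) p ` P)"
  by (auto simp: Grass_def intro: closed_translation closed_subspace)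

lemma ennreal_suminf_const_top:
  assumes "c \<noteq> 0" shows "(\<Sum>i::nat. c :: ennreal) = top"
proof -
  have "(\<Sum>i::nat. c) = (SUP n. of_nat n * c)" by (simp add: suminf_eq_SUP)
  also have "\<dots> = (SUP n. of_nat n) * c" by (rule SUP_mult_right_ennreal[symmetric])
  also have "\<dots> = top" using assms by (simp add: ennreal_SUP_of_nat_eq_top ennreal_top_mult)
  finally show ?thesis .
qed

text \<open>Infinitely many disjoint translates of a bounded piece of \<open>P \<inter> P'\<close> fit into a bounded piece of \<open>P\<close>.\<close>

lemma Hm_subspace_Int_null:
  fixes P P' :: "'a::euclidean_space set"
  assumes P: "P \<in> Grass m" "P' \<in> Grass m" "P \<noteq> P'" and m: "1 \<le> m"
  shows "Hm m (P \<inter> P') = 0"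
proof -
  have sP: "subspace P" "subspace P'" and dP: "dim P = dim P'" using P by (auto simp: Grass_def)
  have "\<not> P \<subseteq> P'" using subspace_dim_equal[OF sP] dP P(3) by auto
  then obtain u where u: "u \<in> P" "u \<notin> P'" by blast
  define W where "W = P \<inter> P'"
  have sW: "subspace W" unfolding W_def using sP by (rule subspace_inter)
  have uW: "u \<notin> W" using u by (simp add: W_def)
  have z: "Hm m (W \<inter> ball 0 k) = 0" for k :: real
  proof (rule ccontr)
    assume nz: "Hm m (W \<inter> ball 0 k) \<noteq> 0"
    \<comment> \<open>\<open>u\<close> lies in \<open>P\<close> but not in \<open>W\<close>, so
      different multiples of \<open>u\<close> belong to different cosets of \<open>W\<close>; the
      factors \<open>1 / Suc i\<close> keep all translates in one ball.\<close>
    define X where "X i = (+) ((1 / real (Suc i)) *\<^sub>R u) ` (W \<inter> ball 0 k)" for i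
    have Wb: "W \<inter> ball 0 k \<in> sets borel" using closed_subspace[OF sW] by auto
    have Xb: "X i \<in> sets borel" for i
    proof -
      have "X i = (\<lambda>x. x - (1 / real (Suc i)) *\<^sub>R u) -` (W \<inter> ball 0 k) \<inter> space borel"
        by (force simp: X_def image_iff algebra_simps)
      also have "\<dots> \<in> sets borel" by (rule measurable_sets[OF _ Wb]) simp
      finally show ?thesis .
    qed
    have dj: "disjoint_family X"
    proof (unfold disjoint_family_on_def, intro ballI impI, rule ccontr)
      fix i j :: nat assume ij: "i \<noteq> j" and "X i \<inter> X j \<noteq> {}"
      then obtain w w' where w: "w \<in> W" "w' \<in> W" "(1 / real (Suc i)) *\<^sub>R u + w = (1 / real (Suc j)) *\<^sub>R u + w'"
        by (auto simp: X_def)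
      then have "(1 / real (Suc i) - 1 / real (Suc j)) *\<^sub>R u = w' - w" by (simp add: algebra_simps)
      moreover have "w' - w \<in> W" using w sW subspace_diff by blast
      ultimately have "(1 / real (Suc i) - 1 / real (Suc j)) *\<^sub>R u \<in> W" by simp
      moreover have "1 / real (Suc i) - 1 / real (Suc j) \<noteq> 0" using ij by simp
      ultimately have "u \<in> W" using sW by (metis subspace_scale scaleR_scaleR left_inverse scaleR_one)
      with uW show False ..
    qed
    have "(\<Sum>i. emeasure (HB m) (X i)) = emeasure (HB m) (\<Union>i. X i)"
      by (rule suminf_emeasure) (use Xb dj in auto)
    also have "\<dots> = Hm m (\<Union>i. X i)" using Xb by (intro emeasure_HB[OF m]) auto
    also have "\<dots> \<le> Hm m ((+) 0 ` P \<inter> ball 0 (k + norm u))"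
    proof (rule Hm_mono, rule subsetI)
      fix x assume "x \<in> (\<Union>i. X i)"
      then obtain i where "x \<in> X i" by blast
      then obtain w where w: "w \<in> W" "norm w < k" "x = (1 / real (Suc i)) *\<^sub>R u + w" unfolding X_def by auto
      have "norm x \<le> norm ((1 / real (Suc i)) *\<^sub>R u) + norm w" unfolding w by (rule norm_triangle_ineq)
      also have "norm ((1 / real (Suc i)) *\<^sub>R u) \<le> norm u" by (simp add: mult_left_le_one_le field_simps)
      finally have "norm x < k + norm u" using w by simp
      moreover have "x \<in> P" unfolding w using w u sP by (auto simp: W_def intro!: subspace_add subspace_scale)
      ultimately show "x \<in> (+) 0 ` P \<inter> ball 0 (k + norm u)" by auto
    qed
    also have "\<dots> < top" by (rule Hm_plane_ball_finite[OF P(1) m])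
    finally have "(\<Sum>i. emeasure (HB m) (X i)) < top" .
    moreover have "emeasure (HB m) (X i) = Hm m (W \<inter> ball 0 k)" for i
      unfolding emeasure_HB[OF m Xb] by (simp add: X_def Hm_translate)
    ultimately show False using ennreal_suminf_const_top[OF nz] by simp
  qed
  have "W = (\<Union>k::nat. W \<inter> ball 0 (real k))" using reals_Archimedean2 by auto
  then have "Hm m W \<le> (\<Sum>k::nat. Hm m (W \<inter> ball 0 (real k)))" using Hm_subadditive by metis
  then have "Hm m W = 0" by (simp add: z)
  then show ?thesis by (simp add: W_def)
qed

text \<open>Two planes with a common point \<open>q\<close> can both be based at \<open>q\<close>,
  and translation by \<open>q\<close> reduces the claim to linear subspaces.\<close>

lemma Hm_plane_Int_null:
  fixes P P' :: "'a::euclidean_space set"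
  assumes P: "P \<in> Grass m" "P' \<in> Grass m" "(+) p ` P \<noteq> (+) p' ` P'" and m: "1 \<le> m"
  shows "Hm m ((+) p ` P \<inter> (+) p' ` P') = 0"
proof (cases "(+) p ` P \<inter> (+) p' ` P' = {}")
  case True then show ?thesis by (simp add: Hm_empty[OF m])
next
  case False
  then obtain q where "q \<in> (+) p ` P" "q \<in> (+) p' ` P'" by blast
  then have q: "q - p \<in> P" "q - p' \<in> P'" by (metis add_diff_cancel_left' imageE)+
  have tr: "(+) c ` Q = (+) q ` Q" if "subspace Q" "q - c \<in> Q" for c and Q :: "'a set"
  proof -
    have "x - q \<in> Q \<longleftrightarrow> x - c \<in> Q" for x
      using subspace_add[OF that(1), of "x - q" "q - c"] subspace_diff[OF that(1), of "x - c" "q - c"] that(2)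
      by auto
    then show ?thesis by (auto simp: image_iff) (metis add_diff_cancel_left' diff_add_cancel add.commute)+
  qed
  have "(+) p ` P = (+) q ` P" "(+) p' ` P' = (+) q ` P'" using tr q P by (auto simp: Grass_def)
  moreover have "(+) q ` P \<inter> (+) q ` P' = (+) q ` (P \<inter> P')" by auto
  ultimately show ?thesis using Hm_subspace_Int_null[OF P(1,2) _ m] P(3) by (auto simp: Hm_translate)
qed

section \<open>Upper densities and approximate tangent cones\<close>

lemma unit_ball_vol_nat_pos: "0 < unit_ball_vol (real m)" and unit_ball_vol_nat_neq_0: "unit_ball_vol (real m) \<noteq> 0"
  using less_imp_neq[OF unit_ball_vol_pos[OF of_nat_0_le_iff[of m]]] by simp_all

text \<open>Trades the upper limit of a quotient of extended reals for a family of eventual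
  inequalities, which can be added and compared.\<close>

lemma upper_density_zero_iff:
  "upper_density m \<nu> a = 0 \<longleftrightarrow>
    (\<forall>e>0. \<forall>\<^sub>F r in at_right 0. \<nu> (cball a r) \<le> ennreal (e * (unit_ball_vol (real m) * r ^ m)))"
  (is "?L \<longleftrightarrow> ?R")
proof
  assume L: ?L
  show ?R
  proof (intro allI impI)
    fix e :: real assume e: "0 < e"
    have "Limsup (at_right 0) (\<lambda>r. \<nu> (cball a r) / ennreal (unit_ball_vol (real m) * r ^ m)) < ennreal e"
      using L e by (simp add: upper_density_def)
    then have "\<forall>\<^sub>F r in at_right 0. \<nu> (cball a r) / ennreal (unit_ball_vol (real m) * r ^ m) < ennreal e"
      by (rule Limsup_lessD)
    moreover have "\<forall>\<^sub>F r in at_right 0. (0::real) < r" by (simp add: eventually_at_right_less)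
    ultimately show "\<forall>\<^sub>F r in at_right 0. \<nu> (cball a r) \<le> ennreal (e * (unit_ball_vol (real m) * r ^ m))"
    proof eventually_elim
      case (elim r)
      then have "\<nu> (cball a r) < ennreal e * ennreal (unit_ball_vol (real m) * r ^ m)"
        by (subst (asm) divide_less_ennreal) (auto simp: unit_ball_vol_nat_neq_0)
      then show ?case using e elim by (simp add: ennreal_mult'[symmetric])
    qed
  qed
next
  assume R: ?R
  have "Limsup (at_right 0) (\<lambda>r. \<nu> (cball a r) / ennreal (unit_ball_vol (real m) * r ^ m)) \<le> 0"
  proof (rule ennreal_le_epsilon)
    fix e :: real assume e: "0 < e"
    have "\<forall>\<^sub>F r in at_right 0. \<nu> (cball a r) / ennreal (unit_ball_vol (real m) * r ^ m) \<le> ennreal e"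
      using R[rule_format, OF e] eventually_at_right_less
    proof eventually_elim
      case (elim r)
      then show ?case using e
        by (intro divide_le_posI_ennreal) (auto simp: ennreal_mult'[symmetric] mult.commute)
    qed
    then show "Limsup (at_right 0) (\<lambda>r. \<nu> (cball a r) / ennreal (unit_ball_vol (real m) * r ^ m)) \<le> 0 + ennreal e"
      using Limsup_bounded by simp
  qed
  then show ?L by (simp add: upper_density_def)
qed

lemma outer_meas_le: "E \<in> sets M \<Longrightarrow> A \<subseteq> E \<Longrightarrow> outer_meas M A \<le> emeasure M E"
  unfolding outer_meas_def by (rule INF_lower) auto

lemma outer_meas_ge: "F \<in> sets M \<Longrightarrow> F \<subseteq> A \<Longrightarrow> emeasure M F \<le> outer_meas M A"
  unfolding outer_meas_def by (rule INF_greatest) (auto intro!: emeasure_mono)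

lemma ennreal_le_zeroI: "(\<And>e. 0 < e \<Longrightarrow> x \<le> ennreal e) \<Longrightarrow> x = 0"
  using ennreal_le_epsilon[of 0 x] by simp

text \<open>Vitali's covering lemma turns a positive upper density on a \<open>\<nu>\<close>-null set into a bound of the
  Hausdorff measure by \<open>\<nu>\<close> of a small neighbourhood.\<close>

lemma upper_density_null_set:
  fixes \<nu> :: "'a::euclidean_space measure"
  assumes m: "1 \<le> m" and \<nu>: "sets \<nu> = sets borel" "emeasure \<nu> UNIV < top"
    and E: "E \<in> sets borel" "emeasure \<nu> E = 0"
  shows "Hm m {x\<in>E. upper_density m (emeasure \<nu>) x \<noteq> 0} = 0"
proof -
  let ?\<omega> = "unit_ball_vol (real m)"
  have sp: "space \<nu> = UNIV" using sets_eq_imp_space_eq[OF \<nu>(1)] by simp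
  define D where "D k = {x\<in>E. \<not> (\<forall>\<^sub>F r in at_right 0. emeasure \<nu> (cball x r) \<le> ennreal (1 / real (Suc k) * (?\<omega> * r ^ m)))}" for k
  have cov: "{x\<in>E. upper_density m (emeasure \<nu>) x \<noteq> 0} \<subseteq> (\<Union>k. D k)"
  proof
    fix x assume "x \<in> {x\<in>E. upper_density m (emeasure \<nu>) x \<noteq> 0}"
    then have xE: "x \<in> E" and "upper_density m (emeasure \<nu>) x \<noteq> 0" by auto
    then obtain e where e: "0 < e" "\<not> (\<forall>\<^sub>F r in at_right 0. emeasure \<nu> (cball x r) \<le> ennreal (e * (?\<omega> * r ^ m)))"
      unfolding upper_density_zero_iff by blast
    obtain k where k: "1 / real (Suc k) < e" using nat_approx_posE[OF e(1)] by blast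
    have "x \<in> D k"
    proof (rule ccontr)
      assume "x \<notin> D k"
      then have "\<forall>\<^sub>F r in at_right 0. emeasure \<nu> (cball x r) \<le> ennreal (1 / real (Suc k) * (?\<omega> * r ^ m))"
        using xE by (auto simp: D_def)
      then have "\<forall>\<^sub>F r in at_right 0. emeasure \<nu> (cball x r) \<le> ennreal (e * (?\<omega> * r ^ m))"
        using eventually_at_right_less
      proof eventually_elim
        case (elim r)
        have "1 / real (Suc k) * (?\<omega> * r ^ m) \<le> e * (?\<omega> * r ^ m)"
          using k elim by (intro mult_right_mono) auto
        then show ?case using elim(1) ennreal_leI order_trans by blast
      qed
      with e show False by blast
    qed
    then show "x \<in> (\<Union>k. D k)" by blast
  qed
  have D0: "Hm m (D k) \<le> 0" for k
  proof (rule Hm_leI)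
    fix \<delta> :: real assume d: "0 < \<delta>"
    define t where "t = 1 / real (Suc k)"
    have t: "0 < t" by (simp add: t_def)
    have "Hm_delta m \<delta> (D k) \<le> ennreal e" if e: "0 < e" for e
    proof -
      \<comment> \<open>The fivefold enlargement in the covering lemma costs \<open>5 ^ m\<close>
        and the density threshold costs \<open>1 / t\<close>; this choice of \<open>\<eta>\<close>
        cancels both and leaves \<open>e\<close>.\<close>
      define \<eta> where "\<eta> = e * t / 5 ^ m"
      have \<eta>: "0 < \<eta>" using e t by (simp add: \<eta>_def)
      have "(INF G \<in> {G. E \<subseteq> G \<and> open G}. emeasure \<nu> G) < ennreal \<eta>"
        using outer_regular[OF \<nu>(1) _ E(1)] \<nu>(2) E(2) \<eta> by (simp add: sp)
      then obtain G where G: "E \<subseteq> G" "open G" "emeasure \<nu> G < ennreal \<eta>"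
        by (auto simp: INF_less_iff)
      \<comment> \<open>Radii up to \<open>\<delta> / 10\<close> are taken because the enlarged
        balls have diameter ten times the radius.\<close>
      have "\<forall>x\<in>D k. \<exists>r>0. r \<le> \<delta> / 10 \<and> cball x r \<subseteq> G \<and> ennreal (t * (?\<omega> * r ^ m)) \<le> emeasure \<nu> (cball x r)"
      proof
        fix x assume x: "x \<in> D k"
        then have "x \<in> G" using G by (auto simp: D_def)
        then obtain s where s: "0 < s" "cball x s \<subseteq> G" using G(2) open_contains_cball by blast
        have "\<exists>r>0. r < min s (\<delta> / 10) \<and> \<not> emeasure \<nu> (cball x r) \<le> ennreal (t * (?\<omega> * r ^ m))"
        proof (rule ccontr)
          assume "\<not> ?thesis"
          then have "\<forall>r>0. r < min s (\<delta> / 10) \<longrightarrow> emeasure \<nu> (cball x r) \<le> ennreal (t * (?\<omega> * r ^ m))" by blast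
          moreover have "0 < min s (\<delta> / 10)" using s d by simp
          ultimately have "\<forall>\<^sub>F r in at_right 0. emeasure \<nu> (cball x r) \<le> ennreal (t * (?\<omega> * r ^ m))"
            unfolding eventually_at_right_field by (intro exI[of _ "min s (\<delta> / 10)"]) auto
          with x show False by (auto simp: D_def t_def)
        qed
        then obtain r where r: "0 < r" "r < min s (\<delta> / 10)" "\<not> emeasure \<nu> (cball x r) \<le> ennreal (t * (?\<omega> * r ^ m))"
          by blast
        moreover have "cball x r \<subseteq> G" using s r by (meson subset_cball less_imp_le min_less_iff_conj order_trans)
        ultimately show "\<exists>r>0. r \<le> \<delta> / 10 \<and> cball x r \<subseteq> G \<and> ennreal (t * (?\<omega> * r ^ m)) \<le> emeasure \<nu> (cball x r)"
          by (intro exI[of _ r]) auto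
      qed
      from bchoice[OF this] obtain \<rho> where \<rho>: "\<And>x. x \<in> D k \<Longrightarrow> 0 < \<rho> x" "\<And>x. x \<in> D k \<Longrightarrow> \<rho> x \<le> \<delta> / 10"
        "\<And>x. x \<in> D k \<Longrightarrow> cball x (\<rho> x) \<subseteq> G" "\<And>x. x \<in> D k \<Longrightarrow> ennreal (t * (?\<omega> * \<rho> x ^ m)) \<le> emeasure \<nu> (cball x (\<rho> x))"
        by blast
      have "D k \<subseteq> (\<Union>x\<in>D k. cball x (\<rho> x))" using \<rho>(1) by (force intro: less_imp_le)
      then obtain C where C: "countable C" "C \<subseteq> D k" "pairwise (\<lambda>i j. disjnt (cball i (\<rho> i)) (cball j (\<rho> j))) C"
        "D k \<subseteq> (\<Union>i\<in>C. cball i (5 * \<rho> i))"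
        by (rule Vitali_covering_lemma_cballs[where a="\<lambda>x. x" and B="\<delta> / 10"]) (use \<rho> in auto)
      define A where "A = to_nat_on C ` C"
      define S where "S i = (if i \<in> A then cball (from_nat_into C i) (5 * \<rho> (from_nat_into C i)) else {})" for i
      define T where "T i = (if i \<in> A then cball (from_nat_into C i) (\<rho> (from_nat_into C i)) else {})" for i
      have inC: "from_nat_into C i \<in> C" if "i \<in> A" for i using that C(1) by (auto simp: A_def)
      have "Hm_delta m \<delta> (D k) \<le> (\<Sum>i. ennreal (?\<omega> * (diameter (S i) / 2) ^ m))"
      proof (rule Hm_delta_le)
        show "D k \<subseteq> (\<Union>i. S i)"
        proof
          fix x assume "x \<in> D k"
          then obtain c where c: "c \<in> C" "x \<in> cball c (5 * \<rho> c)" using C(4) by blast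
          then have "x \<in> S (to_nat_on C c)" using C(1) by (simp add: S_def A_def)
          then show "x \<in> (\<Union>i. S i)" by (rule UN_I[OF UNIV_I])
        qed
        show "bounded (S i)" for i by (simp add: S_def)
        show "diameter (S i) \<le> \<delta>" for i
          using \<rho>(1,2)[of "from_nat_into C i"] inC[of i] C(2) d by (auto simp: S_def diameter_cball)
      qed
      also have "\<dots> \<le> (\<Sum>i. ennreal (5 ^ m / t) * emeasure \<nu> (T i))"
      proof (intro suminf_le)
        fix i
        show "ennreal (?\<omega> * (diameter (S i) / 2) ^ m) \<le> ennreal (5 ^ m / t) * emeasure \<nu> (T i)"
        proof (cases "i \<in> A")
          case False then show ?thesis using m by (simp add: S_def power_0_left)
        next
          case True
          let ?c = "from_nat_into C i"
          have cD: "?c \<in> D k" using inC[OF True] C(2) by blast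
          have "?\<omega> * (diameter (S i) / 2) ^ m = 5 ^ m / t * (t * (?\<omega> * \<rho> ?c ^ m))"
            using True \<rho>(1)[OF cD] t by (simp add: S_def diameter_cball power_mult_distrib)
          then have "ennreal (?\<omega> * (diameter (S i) / 2) ^ m) = ennreal (5 ^ m / t) * ennreal (t * (?\<omega> * \<rho> ?c ^ m))"
            using t \<rho>(1)[OF cD] by (simp only: ennreal_mult'[of "5 ^ m / t"]) (simp add: ennreal_mult'[symmetric])
          also have "\<dots> \<le> ennreal (5 ^ m / t) * emeasure \<nu> (T i)"
            using \<rho>(4)[OF cD] True by (intro mult_left_mono) (auto simp: T_def)
          finally show ?thesis .
        qed
      qed auto
      also have "\<dots> = ennreal (5 ^ m / t) * (\<Sum>i. emeasure \<nu> (T i))" by simp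
      also have "(\<Sum>i. emeasure \<nu> (T i)) = emeasure \<nu> (\<Union>i. T i)"
      proof (rule suminf_emeasure)
        show "range T \<subseteq> sets \<nu>" by (auto simp: \<nu>(1) T_def)
        show "disjoint_family T"
        proof (unfold disjoint_family_on_def, intro ballI impI)
          fix i j :: nat assume ij: "i \<noteq> j"
          show "T i \<inter> T j = {}"
          proof (cases "i \<in> A \<and> j \<in> A")
            case True
            then have "from_nat_into C i \<noteq> from_nat_into C j" using ij C(1)
              by (auto simp: A_def)
            then have "disjnt (cball (from_nat_into C i) (\<rho> (from_nat_into C i))) (cball (from_nat_into C j) (\<rho> (from_nat_into C j)))"
              using pairwiseD[OF C(3)] inC True by blast
            then show ?thesis using True by (simp add: T_def disjnt_def)
          qed (auto simp: T_def)
        qed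
      qed
      also have "emeasure \<nu> (\<Union>i. T i) \<le> ennreal \<eta>"
      proof -
        have "(\<Union>i. T i) \<subseteq> G" using \<rho>(3) inC C(2) by (force simp: T_def split: if_splits)
        then have "emeasure \<nu> (\<Union>i. T i) \<le> emeasure \<nu> G" by (rule emeasure_mono) (simp add: \<nu>(1) G(2))
        then show ?thesis using G(3) by simp
      qed
      also have "ennreal (5 ^ m / t) * ennreal \<eta> = ennreal e"
        using t e by (simp add: ennreal_mult'[symmetric] \<eta>_def)
      finally show ?thesis by (simp add: mult_left_mono)
    qed
    then have "Hm_delta m \<delta> (D k) = 0" by (rule ennreal_le_zeroI)
    then show "Hm_delta m \<delta> (D k) \<le> 0" by simp
  qed
  have "Hm m {x\<in>E. upper_density m (emeasure \<nu>) x \<noteq> 0} \<le> (\<Sum>k. Hm m (D k))"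
    by (rule order_trans[OF Hm_mono[OF cov] Hm_subadditive])
  then show ?thesis using D0 by simp
qed

lemma sets_HM_borel: "X \<in> sets borel \<Longrightarrow> X \<in> sets (HM m)"
  by (simp add: HM_eq)

lemma emeasure_HM:
  assumes "1 \<le> m" "X \<in> sets borel" shows "emeasure (HM m) X = Hm m X"
  using assms by (simp add: HM_eq emeasure_HB)

lemma measurable_HM_borel: "f \<in> borel_measurable borel \<Longrightarrow> f \<in> borel_measurable (HM m)"
  unfolding HM_eq by (rule measurable_completion) (simp cong: measurable_cong_sets)

text \<open>The plane itself is an admissible \<open>S\<close>, which gives one inclusion.
  Conversely, if a direction \<open>v\<close> of \<open>P\<close> were missing from the cone of an
  admissible \<open>S\<close>, then \<open>S\<close> would avoid the balls of radius
  \<open>t * \<epsilon>\<close> around \<open>x + t *\<^sub>R v\<close> in the plane for all small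
  \<open>t\<close>, and the complement of \<open>S\<close> would have positive upper
  density.\<close>

lemma rtan_plane:
  fixes P :: "'a::euclidean_space set"
  assumes P: "P \<in> Grass m" and m: "1 \<le> m" and x: "x \<in> (+) c ` P"
  shows "rtan m ((+) c ` P) x = P"
proof -
  let ?A = "(+) c ` P"
  let ?M = "density (HM m) (indicator ?A)"
  have sP: "subspace P" using P by (simp add: Grass_def)
  have xc: "x - c \<in> P" using x by auto
  have tr: "y \<in> ?A \<longleftrightarrow> y - x \<in> P" for y
  proof -
    have "y \<in> ?A \<longleftrightarrow> y - c \<in> P" by (auto simp: image_iff) (metis add_diff_cancel_left' diff_add_cancel add.commute)
    also have "\<dots> \<longleftrightarrow> y - x \<in> P"
      using subspace_add[OF sP, of "y - x" "x - c"] subspace_diff[OF sP, of "y - c" "x - c"] xc by auto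
    finally show ?thesis .
  qed
  have Ab: "?A \<in> sets borel" using closed_plane[OF P] by auto
  have AM: "?A \<in> sets (HM m)" using Ab by (rule sets_HM_borel)
  have emM: "emeasure ?M X = Hm m (X \<inter> ?A)" if "X \<in> sets borel" for X
  proof -
    have "emeasure ?M X = (\<integral>\<^sup>+y. indicator ?A y * indicator X y \<partial>HM m)"
      using AM sets_HM_borel[OF that] by (intro emeasure_density) auto
    also have "\<dots> = (\<integral>\<^sup>+y. indicator (X \<inter> ?A) y \<partial>HM m)"
      by (intro nn_integral_cong) (auto split: split_indicator)
    also have "\<dots> = Hm m (X \<inter> ?A)" using Ab that by (simp add: nn_integral_indicator sets_HM_borel emeasure_HM[OF m])
    finally show ?thesis .
  qed
  show ?thesis
  proof
    have "upper_density m (\<lambda>B. outer_meas ?M (B \<inter> (UNIV - ?A))) x = 0"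
    proof -
      have "outer_meas ?M (B \<inter> (UNIV - ?A)) = 0" for B
      proof -
        have "outer_meas ?M (B \<inter> (UNIV - ?A)) \<le> emeasure ?M (UNIV - ?A)"
          using Ab by (intro outer_meas_le) (auto intro!: sets_HM_borel)
        also have "\<dots> = Hm m ((UNIV - ?A) \<inter> ?A)" using Ab by (intro emM) auto
        also have "(UNIV - ?A) \<inter> ?A = {}" by blast
        also have "Hm m ({} :: 'a set) = 0" by (rule Hm_empty[OF m])
        finally show ?thesis by simp
      qed
      then show ?thesis unfolding upper_density_zero_iff by simp
    qed
    then have "rtan m ?A x \<subseteq> tan_cone ?A x" unfolding rtan_def approx_tan_def by blast
    also have "\<dots> \<subseteq> P"
    proof
      fix v assume v: "v \<in> tan_cone ?A x"
      have "v \<in> closure P"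
        unfolding closure_approachable
      proof (intro allI impI)
        fix e :: real assume "0 < e"
        then obtain y r where "y \<in> ?A" "0 < r" "norm (r *\<^sub>R (y - x) - v) < e"
          using v unfolding tan_cone_def by blast
        then show "\<exists>y\<in>P. dist y v < e" using tr sP by (intro bexI[of _ "r *\<^sub>R (y - x)"]) (auto simp: dist_norm subspace_scale)
      qed
      then show "v \<in> P" using closed_subspace[OF sP] by simp
    qed
    finally show "rtan m ?A x \<subseteq> P" .
    show "P \<subseteq> rtan m ?A x"
    proof
      fix v assume v: "v \<in> P"
      show "v \<in> rtan m ?A x"
        unfolding rtan_def approx_tan_def
      proof (clarify)
        fix S assume S: "upper_density m (\<lambda>B. outer_meas ?M (B \<inter> (UNIV - S))) x = 0"
        show "v \<in> tan_cone S x"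
          unfolding tan_cone_def
        proof (rule CollectI, intro allI impI, rule ccontr)
          fix \<epsilon> :: real assume \<epsilon>: "0 < \<epsilon>"
            and no: "\<not> (\<exists>xa\<in>S. \<exists>r>0. norm (xa - x) < \<epsilon> \<and> norm (r *\<^sub>R (xa - x) - v) < \<epsilon>)"
          let ?\<omega> = "unit_ball_vol (real m)"
          define k where "k = norm v + \<epsilon>"
          have k: "0 < k" using \<epsilon> by (simp add: k_def add_nonneg_pos)
          \<comment> \<open>Half of the density that the balls missed by \<open>S\<close> contribute
            inside \<open>cball x (t * k)\<close>, so that the final comparison is off by a factor
            of 2.\<close>
          define e where "e = plane_const m * \<epsilon> ^ m / (2 * ?\<omega> * k ^ m)"
          have e: "0 < e" using plane_const_pos[of m] \<epsilon> k by (simp add: e_def)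
          have "\<forall>\<^sub>F r in at_right 0. outer_meas ?M (cball x r \<inter> (UNIV - S)) \<le> ennreal (e * (?\<omega> * r ^ m))"
            using S e unfolding upper_density_zero_iff by blast
          then obtain b where b: "0 < b" "\<And>r. 0 < r \<Longrightarrow> r < b \<Longrightarrow> outer_meas ?M (cball x r \<inter> (UNIV - S)) \<le> ennreal (e * (?\<omega> * r ^ m))"
            unfolding eventually_at_right_field by auto
          \<comment> \<open>Chosen so that \<open>t * k\<close>, which bounds the distance of the
            small ball from \<open>x\<close>, lies below both \<open>b\<close> and
            \<open>\<epsilon>\<close>.\<close>
          define t where "t = min b \<epsilon> / (2 * k)"
          have t: "0 < t" using b \<epsilon> k by (simp add: t_def)
          have tk: "t * k = min b \<epsilon> / 2" using k by (simp add: t_def)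
          have tk': "t * k < b" "t * k < \<epsilon>" "0 < t * k" using b \<epsilon> by (auto simp: tk)
          let ?F = "(+) (x + t *\<^sub>R v) ` P \<inter> ball (x + t *\<^sub>R v) (t * \<epsilon>)"
          have FA: "(+) (x + t *\<^sub>R v) ` P \<subseteq> ?A"
            using v sP by (auto simp: tr subspace_add subspace_scale)
          have Fd: "?F \<subseteq> cball x (t * k) \<inter> (UNIV - S)"
          proof
            fix y assume y: "y \<in> ?F"
            then have ny: "norm (y - (x + t *\<^sub>R v)) < t * \<epsilon>" by (auto simp: dist_norm norm_minus_commute)
            have "norm (y - x) \<le> norm (y - (x + t *\<^sub>R v)) + norm (t *\<^sub>R v)"
              using norm_triangle_ineq[of "y - (x + t *\<^sub>R v)" "t *\<^sub>R v"] by (simp add: algebra_simps)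
            also have "\<dots> < t * \<epsilon> + t * norm v" using ny t by simp
            finally have n1: "norm (y - x) < t * k" by (simp add: k_def algebra_simps)
            have "(1 / t) *\<^sub>R (y - x) - v = (1 / t) *\<^sub>R (y - (x + t *\<^sub>R v))"
              using t by (simp add: algebra_simps)
            then have "norm ((1 / t) *\<^sub>R (y - x) - v) = norm (y - (x + t *\<^sub>R v)) / t" using t by simp
            also have "\<dots> < \<epsilon>" using ny t by (simp add: field_simps)
            finally have "norm ((1 / t) *\<^sub>R (y - x) - v) < \<epsilon>" .
            moreover have "norm (y - x) < \<epsilon>" using n1 tk' by simp
            ultimately have "y \<notin> S" using no t by (metis zero_less_divide_1_iff)
            then show "y \<in> cball x (t * k) \<inter> (UNIV - S)" using n1 by (simp add: dist_norm norm_minus_commute)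
          qed
          have Fb: "?F \<in> sets borel" using closed_plane[OF P] by auto
          have "ennreal (plane_const m * (t * \<epsilon>) ^ m) \<le> Hm m ?F"
            by (rule Hm_plane_ball_ge[OF P m]) (use t \<epsilon> in simp)
          also have "?F = ?F \<inter> ?A" using FA by blast
          also have "Hm m (?F \<inter> ?A) = emeasure ?M ?F" using emM[OF Fb] by simp
          also have "\<dots> \<le> outer_meas ?M (cball x (t * k) \<inter> (UNIV - S))"
            using Fb Fd by (intro outer_meas_ge) (auto intro!: sets_HM_borel)
          also have "\<dots> \<le> ennreal (e * (?\<omega> * (t * k) ^ m))" using b(2) tk' by blast
          finally have "plane_const m * (t * \<epsilon>) ^ m \<le> e * (?\<omega> * (t * k) ^ m)"
            using e tk' by (subst (asm) ennreal_le_iff) auto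
          also have "\<dots> = plane_const m * (t * \<epsilon>) ^ m / 2"
            using k unit_ball_vol_nat_neq_0[of m] by (simp add: e_def power_mult_distrib)
          finally show False using plane_const_pos[of m] t \<epsilon> by simp
        qed
      qed
    qed
  qed
qed


section \<open>The weight measure and its approximate tangent planes\<close>

lemma integral_varifoldD:
  assumes "integral_varifold m U R \<theta>"
  shows "R \<subseteq> U" "R \<in> sets borel" "\<theta> \<in> borel \<rightarrow>\<^sub>M count_space UNIV" "\<And>x. x \<in> R \<Longrightarrow> 1 \<le> \<theta> x"
    "\<And>K. compact K \<Longrightarrow> K \<subseteq> U \<Longrightarrow> emeasure (vweight m R \<theta>) K < \<infinity>"
  using assms unfolding integral_varifold_def measurable_cong_sets[OF refl sets_borel_eq_count_space] by auto

lemma vweight_density_measurable: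
  assumes "R \<in> sets borel" "\<theta> \<in> borel \<rightarrow>\<^sub>M count_space UNIV"
  shows "(\<lambda>x. indicator R x * ennreal (real (\<theta> x))) \<in> borel_measurable borel"
  using assms by measurable

lemma sets_vweight [simp]: "sets (vweight m R \<theta>) = sets (HM m)"
  by (simp add: vweight_def)

lemma emeasure_vweight:
  assumes "R \<in> sets borel" "\<theta> \<in> borel \<rightarrow>\<^sub>M count_space UNIV" "X \<in> sets (HM m)"
  shows "emeasure (vweight m R \<theta>) X = (\<integral>\<^sup>+x. indicator R x * ennreal (real (\<theta> x)) * indicator X x \<partial>HM m)"
  unfolding vweight_def
  by (rule emeasure_density[OF measurable_HM_borel[OF vweight_density_measurable[OF assms(1,2)]] assms(3)])

text \<open>Almost every point of \<open>R \<inter> {\<theta> = k}\<close> is a point of \<open>\<parallel>V\<parallel>\<close>-density zero of \<open>{\<theta> \<noteq> k}\<close>, and there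
  \<open>\<parallel>V\<parallel>\<close> and the restriction of Hausdorff measure to \<open>R\<close> have the same sets of density zero.\<close>

lemma approx_tan_vweight_eq_rtan:
  fixes R U :: "'a::euclidean_space set"
  assumes m: "1 \<le> m" and V: "integral_varifold m U R \<theta>" and B: "cball a \<rho> \<subseteq> U"
  shows "Hm m {x\<in>R \<inter> ball a \<rho>. approx_tan m (vweight m R \<theta>) x \<noteq> rtan m R x} = 0"
proof -
  note V' = integral_varifoldD[OF V]
  note [measurable] = V'(2,3)
  let ?\<omega> = "unit_ball_vol (real m)"
  let ?H = "density (HM m) (indicator R)"
  let ?W = "vweight m R \<theta>"
  have [measurable]: "ball a \<rho> \<in> sets borel" by simp
  have RM: "R \<in> sets (HM m)" using V'(2) by (rule sets_HM_borel)
  define \<nu> where "\<nu> k = density (HB m) (\<lambda>x. indicator {x \<in> R \<inter> ball a \<rho>. \<theta> x \<noteq> k} x * ennreal (real (\<theta> x)))" for k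
  define D where "D k = {x \<in> R \<inter> ball a \<rho>. \<theta> x = k}" for k
  define N where "N k = {x \<in> D k. upper_density m (emeasure (\<nu> k)) x \<noteq> 0}" for k
  have Db: "D k \<in> sets borel" for k unfolding D_def by measurable
  have m\<nu>: "(\<lambda>x. indicator {x \<in> R \<inter> ball a \<rho>. \<theta> x \<noteq> k} x * ennreal (real (\<theta> x))) \<in> borel_measurable (HB m)" for k
  proof -
    have "(\<lambda>x. indicator {x \<in> R \<inter> ball a \<rho>. \<theta> x \<noteq> k} x * ennreal (real (\<theta> x))) \<in> borel_measurable borel"
      by measurable
    then show ?thesis by (simp cong: measurable_cong_sets)
  qed
  have e\<nu>: "emeasure (\<nu> k) X = (\<integral>\<^sup>+x. indicator {x \<in> R \<inter> ball a \<rho>. \<theta> x \<noteq> k} x * ennreal (real (\<theta> x)) * indicator X x \<partial>HM m)"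
    if "X \<in> sets borel" for k X
    unfolding \<nu>_def HM_eq nn_integral_completion by (rule emeasure_density[OF m\<nu>]) (use that in simp)
  have N0: "Hm m (N k) = 0" for k
    unfolding N_def
  proof (rule upper_density_null_set[OF m _ _ Db])
    show "sets (\<nu> k) = sets borel" by (simp add: \<nu>_def)
    have "emeasure (\<nu> k) UNIV \<le> emeasure ?W (cball a \<rho>)"
      unfolding e\<nu>[OF borel_open[OF open_UNIV]] emeasure_vweight[OF V'(2,3) sets_HM_borel[OF borel_closed[OF closed_cball]]]
      by (intro nn_integral_mono) (auto split: split_indicator)
    also have "\<dots> < top" using V'(5)[OF compact_cball B] by simp
    finally show "emeasure (\<nu> k) UNIV < top" .
    have "emeasure (\<nu> k) (D k) = (\<integral>\<^sup>+x. 0 \<partial>(HM m :: 'a measure))"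
      unfolding e\<nu>[OF Db] by (intro nn_integral_cong) (auto simp: D_def split: split_indicator)
    then show "emeasure (\<nu> k) (D k) = 0" by simp
  qed
  \<comment> \<open>Multiplicities are at least 1 on \<open>R\<close>, so smallness for the weight
    implies smallness for Hausdorff measure on \<open>R\<close>; the converse direction needs the
    point to be generic.\<close>
  have le: "outer_meas ?H X \<le> outer_meas ?W X" for X
  proof -
    have "emeasure ?H E \<le> emeasure ?W E" if E: "E \<in> sets (HM m)" for E
    proof -
      have "emeasure ?H E = (\<integral>\<^sup>+x. indicator R x * indicator E x \<partial>HM m)"
        using RM E by (intro emeasure_density) auto
      also have "\<dots> \<le> (\<integral>\<^sup>+x. indicator R x * ennreal (real (\<theta> x)) * indicator E x \<partial>HM m)"
        using V'(4) by (intro nn_integral_mono) (auto split: split_indicator)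
      finally show ?thesis unfolding emeasure_vweight[OF V'(2,3) E] .
    qed
    then show ?thesis unfolding outer_meas_def by (intro INF_mono) (auto simp: vweight_def)
  qed
  have eq: "approx_tan m ?W x = rtan m R x" if x: "x \<in> D k - N k" for x k
  proof -
    have xB: "x \<in> ball a \<rho>" using x by (auto simp: D_def)
    then obtain s where s: "0 < s" "ball x s \<subseteq> ball a \<rho>" using open_contains_ball open_ball by blast
    have dn: "upper_density m (emeasure (\<nu> k)) x = 0" using x by (auto simp: N_def)
    have "upper_density m (\<lambda>B. outer_meas ?W (B \<inter> (UNIV - S))) x = 0
        \<longleftrightarrow> upper_density m (\<lambda>B. outer_meas ?H (B \<inter> (UNIV - S))) x = 0" (is "?l \<longleftrightarrow> ?r") for S
    proof
      assume ?l
      then show ?r unfolding upper_density_zero_iff using le by (blast intro: eventually_mono order_trans)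
    next
      assume r: ?r
      show ?l
        unfolding upper_density_zero_iff
      proof (intro allI impI)
        fix e :: real assume e: "0 < e"
        \<comment> \<open>With \<open>2 * e'\<close> in place of \<open>e'\<close> for a nearly
          optimal Borel hull, the part of multiplicity \<open>k\<close> contributes at most
          \<open>e / 2\<close>; the denominator stays positive for \<open>k = 0\<close>.\<close>
        define e' where "e' = e / (4 * real k + 4)"
        have e': "0 < e'" using e by (simp add: e'_def)
        have "\<forall>\<^sub>F r in at_right 0. outer_meas ?H (cball x r \<inter> (UNIV - S)) \<le> ennreal (e' * (?\<omega> * r ^ m))"
          using r e' unfolding upper_density_zero_iff by blast
        moreover have "\<forall>\<^sub>F r in at_right 0. emeasure (\<nu> k) (cball x r) \<le> ennreal (e / 2 * (?\<omega> * r ^ m))"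
          using dn e unfolding upper_density_zero_iff by (metis half_gt_zero)
        moreover have "\<forall>\<^sub>F r in at_right 0. 0 < r \<and> r < s"
          unfolding eventually_at_right_field using s by auto
        ultimately show "\<forall>\<^sub>F r in at_right 0. outer_meas ?W (cball x r \<inter> (UNIV - S)) \<le> ennreal (e * (?\<omega> * r ^ m))"
        proof eventually_elim
          case (elim r)
          define c where "c = ?\<omega> * r ^ m"
          have c: "0 < c" using elim(3) unit_ball_vol_nat_pos[of m] by (simp add: c_def)
          have "outer_meas ?H (cball x r \<inter> (UNIV - S)) < ennreal (2 * e' * c)"
            using elim(1)[folded c_def] e' c by (elim le_less_trans) (simp add: ennreal_less_iff)
          then obtain E where E: "E \<in> sets (HM m)" "cball x r \<inter> (UNIV - S) \<subseteq> E" "emeasure ?H E < ennreal (2 * e' * c)"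
            unfolding outer_meas_def INF_less_iff by auto
          have [measurable]: "cball x r \<in> sets borel" by simp
          have cb: "cball x r \<in> sets (HM m)" by (rule sets_HM_borel) simp
          have cB: "cball x r \<subseteq> ball a \<rho>" using elim(3) s(2) by (meson cball_subset_ball_iff order_trans subset_iff mem_cball mem_ball le_less_trans)
          have "outer_meas ?W (cball x r \<inter> (UNIV - S)) \<le> emeasure ?W (E \<inter> cball x r)"
            using E cb by (intro outer_meas_le) auto
          also have "\<dots> = (\<integral>\<^sup>+y. indicator R y * ennreal (real (\<theta> y)) * indicator (E \<inter> cball x r) y \<partial>HM m)"
            by (rule emeasure_vweight[OF V'(2,3)]) (use E cb in auto)
          \<comment> \<open>Within the hull, points of multiplicity \<open>k\<close> are bounded by
            \<open>k\<close> times Hausdorff measure, and all other points are left to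
            \<open>\<nu> k\<close>, which has density zero at \<open>x\<close>.\<close>
          also have "\<dots> \<le> (\<integral>\<^sup>+y. ennreal (real k) * (indicator R y * indicator E y)
              + indicator {x \<in> R \<inter> ball a \<rho>. \<theta> x \<noteq> k} y * ennreal (real (\<theta> y)) * indicator (cball x r) y \<partial>HM m)"
            using cB by (intro nn_integral_mono) (auto split: split_indicator)
          also have "\<dots> = (\<integral>\<^sup>+y. ennreal (real k) * (indicator R y * indicator E y) \<partial>HM m)
              + (\<integral>\<^sup>+y. indicator {x \<in> R \<inter> ball a \<rho>. \<theta> x \<noteq> k} y * ennreal (real (\<theta> y)) * indicator (cball x r) y \<partial>HM m)"
          proof (rule nn_integral_add)
            show "(\<lambda>y. ennreal (real k) * (indicator R y * indicator E y)) \<in> borel_measurable (HM m)"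
              using RM E(1) by measurable
            show "(\<lambda>y. indicator {x \<in> R \<inter> ball a \<rho>. \<theta> x \<noteq> k} y * ennreal (real (\<theta> y)) * indicator (cball x r) y) \<in> borel_measurable (HM m)"
              by (rule measurable_HM_borel) measurable
          qed
          also have "\<dots> = ennreal (real k) * emeasure ?H E + emeasure (\<nu> k) (cball x r)"
            using RM E(1) by (subst nn_integral_cmult) (auto simp: e\<nu> emeasure_density)
          also have "\<dots> \<le> ennreal (real k) * ennreal (2 * e' * c) + ennreal (e / 2 * c)"
            using E(3) elim(2) by (intro add_mono mult_left_mono) (auto simp: c_def)
          also have "\<dots> = ennreal (real k * (2 * e' * c) + e / 2 * c)"
            using c e e' by (simp add: ennreal_mult'[symmetric] ennreal_plus[symmetric] del: ennreal_plus)
          also have "\<dots> \<le> ennreal (e * c)"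
          proof (rule ennreal_leI)
            have "real k * (2 * e') \<le> e / 2" using e by (simp add: e'_def field_simps)
            then have "(real k * (2 * e')) * c \<le> e / 2 * c" using c by (intro mult_right_mono) auto
            then show "real k * (2 * e' * c) + e / 2 * c \<le> e * c" by (simp add: algebra_simps)
          qed
          finally show ?case by (simp add: c_def)
        qed
      qed
    qed
    then show ?thesis unfolding rtan_def approx_tan_def by simp
  qed
  have "{x\<in>R \<inter> ball a \<rho>. approx_tan m ?W x \<noteq> rtan m R x} \<subseteq> (\<Union>k. N k)"
    using eq by (auto simp: D_def)
  then have "Hm m {x\<in>R \<inter> ball a \<rho>. approx_tan m ?W x \<noteq> rtan m R x} \<le> (\<Sum>k. Hm m (N k))"
    by (intro order_trans[OF Hm_mono Hm_subadditive])
  then show ?thesis by (simp add: N0)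
qed

section \<open>A countable base for the space of linear maps\<close>

lemma separable_imp_second_countable:
  fixes D :: "'b::metric_space set"
  assumes D: "countable D" "\<And>x e. 0 < e \<Longrightarrow> \<exists>d\<in>D. dist x d < e"
  shows "\<exists>B::'b set set. countable B \<and> open = generate_topology B"
proof (intro exI conjI)
  let ?B = "(\<lambda>(d, n). ball d (1 / real (Suc n))) ` (D \<times> (UNIV :: nat set))"
  show "countable ?B" using D(1) by auto
  show "open = generate_topology ?B"
  proof (intro ext iffI)
    fix S :: "'b set" assume S: "open S"
    have "S = \<Union> {b \<in> ?B. b \<subseteq> S}"
    proof
      show "S \<subseteq> \<Union> {b \<in> ?B. b \<subseteq> S}"
      proof
        fix x assume "x \<in> S"
        then obtain e where e: "0 < e" "ball x e \<subseteq> S" using S open_contains_ball by blast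
        obtain n where n: "1 / real (Suc n) < e / 2" using e nat_approx_posE[of "e/2"] by auto
        obtain d where d: "d \<in> D" "dist x d < 1 / real (Suc n)" using D(2)[of "1 / real (Suc n)" x] by auto
        have "ball d (1 / real (Suc n)) \<subseteq> ball x e"
        proof
          fix y assume "y \<in> ball d (1 / real (Suc n))"
          then have "dist x y < 1 / real (Suc n) + 1 / real (Suc n)"
            using d dist_triangle[of x y d] by (simp add: dist_commute)
          then show "y \<in> ball x e" using n by simp
        qed
        then have "ball d (1 / real (Suc n)) \<in> {b \<in> ?B. b \<subseteq> S}" using e d by auto
        moreover have "x \<in> ball d (1 / real (Suc n))" using d by (simp add: dist_commute)
        ultimately show "x \<in> \<Union> {b \<in> ?B. b \<subseteq> S}" by (rule UnionI)
      qed
    qed auto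
    also have "generate_topology ?B \<dots>"
      by (rule generate_topology.UN) (auto intro: generate_topology.Basis)
    finally show "generate_topology ?B S" .
  next
    fix S assume "generate_topology ?B S"
    then show "open S" by induction auto
  qed
qed

text \<open>Closed balls are compact in finite dimension, so finite nets at all scales give a
  countable dense set. Measurability of pairs involving linear maps, such as
  \<open>blinfun_apply\<close> in both arguments, rests on this.\<close>

instance blinfun :: (euclidean_space, euclidean_space) second_countable_topology
proof
  have "\<forall>n. \<exists>F. finite F \<and> cball (0 :: 'a \<Rightarrow>\<^sub>L 'b) (real n) \<subseteq> (\<Union>x\<in>F. ball x (1 / real (Suc n)))"
  proof
    fix n
    have "compact (cball (0 :: 'a \<Rightarrow>\<^sub>L 'b) (real n))" by simp
    then show "\<exists>F. finite F \<and> cball (0 :: 'a \<Rightarrow>\<^sub>L 'b) (real n) \<subseteq> (\<Union>x\<in>F. ball x (1 / real (Suc n)))"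
    proof (rule compactE_image[of _ UNIV "\<lambda>x. ball x (1 / real (Suc n))"])
      show "cball 0 (real n) \<subseteq> (\<Union>x :: 'a \<Rightarrow>\<^sub>L 'b. ball x (1 / real (Suc n)))"
      proof
        fix x :: "'a \<Rightarrow>\<^sub>L 'b"
        have "x \<in> ball x (1 / real (Suc n))" by simp
        then show "x \<in> (\<Union>x. ball x (1 / real (Suc n)))" by (rule UN_I[OF UNIV_I])
      qed
    qed (auto intro: exI)
  qed
  from choice[OF this] obtain F :: "nat \<Rightarrow> ('a \<Rightarrow>\<^sub>L 'b) set" where F: "\<And>n. finite (F n)"
    "\<And>n. cball 0 (real n) \<subseteq> (\<Union>x\<in>F n. ball x (1 / real (Suc n)))" by blast
  show "\<exists>B::('a \<Rightarrow>\<^sub>L 'b) set set. countable B \<and> open = generate_topology B"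
  proof (rule separable_imp_second_countable)
    show "countable (\<Union>n. F n)" using F(1) by (auto intro: countable_finite)
    fix x :: "'a \<Rightarrow>\<^sub>L 'b" and e :: real assume e: "0 < e"
    obtain n1 where n1: "1 / real (Suc n1) < e" using nat_approx_posE[OF e] by blast
    obtain n2 where n2: "norm x \<le> real n2" using real_arch_simple by blast
    define n where "n = max n1 n2"
    have "x \<in> cball 0 (real n)" using n2 by (simp add: n_def)
    then obtain d where d: "d \<in> F n" "dist d x < 1 / real (Suc n)" using F(2)[of n] by auto
    have "1 / real (Suc n) \<le> 1 / real (Suc n1)" by (intro divide_left_mono) (auto simp: n_def)
    then show "\<exists>d\<in>(\<Union>n. F n). dist x d < e" using d n1 by (auto simp: dist_commute intro!: bexI[of _ d])
  qed
qed

section \<open>Smooth functions\<close>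

text \<open>Lets the derivative be supplied explicitly, so that \<open>frechet_derivative\<close>
  need not be computed in each induction step.\<close>

lemma Ck_SucI:
  assumes "\<And>x. (f has_derivative f' x) (at x)" "\<And>v. Ck k (\<lambda>x. f' x v)"
  shows "Ck (Suc k) f"
proof -
  have "frechet_derivative f (at x) = f' x" for x using frechet_derivative_at[OF assms(1)] by simp
  then show ?thesis using assms by (auto simp: differentiable_def)
qed

lemma Ck_SucD: "Ck (Suc k) f \<Longrightarrow> (f has_derivative frechet_derivative f (at x)) (at x)"
  "Ck (Suc k) f \<Longrightarrow> Ck k (\<lambda>x. frechet_derivative f (at x) v)"
  by (auto simp: frechet_derivative_works[symmetric])

lemma Ck_Suc_imp: "Ck (Suc k) f \<Longrightarrow> Ck k f"
proof (induction k arbitrary: f)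
  case 0
  then show ?case by (auto intro!: differentiable_imp_continuous_on simp: differentiable_on_def differentiable_at_imp_differentiable_on)
next
  case (Suc k)
  then show ?case by (metis Ck.simps(2))
qed

lemma Ck_const: "Ck k (\<lambda>x. c)"
proof (induction k arbitrary: c)
  case (Suc k) show ?case by (rule Ck_SucI[where f' = "\<lambda>_ _. 0"]) (auto intro: Suc)
qed simp

lemma Ck_bounded_linear: "bounded_linear f \<Longrightarrow> Ck k f"
proof (cases k)
  case 0 then show "bounded_linear f \<Longrightarrow> Ck k f" by (simp add: linear_continuous_on)
next
  case (Suc j)
  assume "bounded_linear f"
  then show "Ck k f" unfolding Suc
    by (intro Ck_SucI[where f' = "\<lambda>_. f"]) (auto intro: Ck_const bounded_linear_imp_has_derivative)
qed

lemma Ck_add: "Ck k f \<Longrightarrow> Ck k g \<Longrightarrow> Ck k (\<lambda>x. f x + g x)"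
proof (induction k arbitrary: f g)
  case (Suc k)
  show ?case
    by (rule Ck_SucI[OF has_derivative_add[OF Ck_SucD(1)[OF Suc.prems(1)] Ck_SucD(1)[OF Suc.prems(2)]]])
       (intro Suc.IH Ck_SucD(2) Suc.prems)
qed (auto intro: continuous_intros)

lemma Ck_mult: "Ck k f \<Longrightarrow> Ck k g \<Longrightarrow> Ck k (\<lambda>x. f x * g x :: real)"
proof (induction k arbitrary: f g)
  case (Suc k)
  show ?case
    by (rule Ck_SucI[OF has_derivative_mult[OF Ck_SucD(1)[OF Suc.prems(1)] Ck_SucD(1)[OF Suc.prems(2)]]])
       (intro Ck_add Suc.IH Ck_SucD(2) Suc.prems Ck_Suc_imp)
qed (auto intro: continuous_intros)

lemma Ck_scaleR_const: "Ck k f \<Longrightarrow> Ck k (\<lambda>x. f x *\<^sub>R w)"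
proof (induction k arbitrary: f)
  case (Suc k)
  show ?case
    by (rule Ck_SucI[OF has_derivative_scaleR_left[OF Ck_SucD(1)[OF Suc.prems(1)]]])
       (intro Suc.IH Ck_SucD(2) Suc.prems)
qed (auto intro: continuous_intros)

lemma Ck_sum: "(\<And>i. i \<in> I \<Longrightarrow> Ck k (f i)) \<Longrightarrow> Ck k (\<lambda>x. \<Sum>i\<in>I. f i x)"
  by (induction I rule: infinite_finite_induct) (auto intro: Ck_const Ck_add)

lemma smooth_map_const: "smooth_map (\<lambda>x. c)"
  and smooth_map_bounded_linear: "bounded_linear l \<Longrightarrow> smooth_map l"
  and smooth_map_add: "smooth_map f \<Longrightarrow> smooth_map g \<Longrightarrow> smooth_map (\<lambda>x. f x + g x)"
  and smooth_map_sum: "(\<And>i. i \<in> I \<Longrightarrow> smooth_map (s i)) \<Longrightarrow> smooth_map (\<lambda>x. \<Sum>i\<in>I. s i x)"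
  and smooth_map_scaleR_const: "smooth_map p \<Longrightarrow> smooth_map (\<lambda>x. p x *\<^sub>R w)"
  and smooth_map_mult: "smooth_map p \<Longrightarrow> smooth_map q \<Longrightarrow> smooth_map (\<lambda>x. p x * q x :: real)"
  by (auto simp: smooth_map_def intro: Ck_const Ck_bounded_linear Ck_add Ck_sum Ck_scaleR_const Ck_mult)

lemma smooth_map_has_derivative: "smooth_map f \<Longrightarrow> (f has_derivative frechet_derivative f (at x)) (at x)"
  unfolding smooth_map_def using Ck_SucD(1) by blast

lemma smooth_map_continuous: "smooth_map f \<Longrightarrow> continuous_on UNIV f"
  unfolding smooth_map_def by (metis Ck.simps(1))

lemma smooth_map_derivative: "smooth_map f \<Longrightarrow> smooth_map (\<lambda>x. frechet_derivative f (at x) v)"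
  unfolding smooth_map_def using Ck_SucD(2) by blast

text \<open>With a polynomial factor the class of these functions is closed under differentiation.\<close>

definition flat_exp :: "real poly \<Rightarrow> real \<Rightarrow> real" where
  "flat_exp p t = (if t \<le> 0 then 0 else poly p (1 / t) * exp (- (1 / t)))"

lemma poly_exp_tendsto_0: "((\<lambda>s. poly p s * exp (- s)) \<longlongrightarrow> 0) (at_top :: real filter)"
proof -
  have "((\<lambda>s. \<Sum>i\<le>degree p. coeff p i * (s ^ i / exp s)) \<longlongrightarrow> (\<Sum>i\<le>degree p. coeff p i * 0)) (at_top :: real filter)"
    by (intro tendsto_intros tendsto_power_div_exp_0)
  moreover have "poly p s * exp (- s) = (\<Sum>i\<le>degree p. coeff p i * (s ^ i / exp s))" for s :: real
    by (simp add: poly_altdef sum_distrib_right exp_minus divide_inverse mult.assoc)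
  ultimately show ?thesis by simp
qed

text \<open>With \<open>s = 1 / t\<close> the derivative of \<open>p(s) exp(-s)\<close> in
  \<open>t\<close> is \<open>s^2 (p - p')(s) exp(-s)\<close>, again of the same form.\<close>

lemma flat_exp_has_derivative:
  "(flat_exp p has_real_derivative flat_exp ([:0, 0, 1:] * (p - pderiv p)) t) (at t)"
proof -
  let ?q = "[:0, 0, 1:] * (p - pderiv p)"
  consider "t < 0" | "t = 0" | "0 < t" by linarith
  then show ?thesis
  proof cases
    case 1
    have "((\<lambda>_. 0) has_real_derivative 0) (at t)" by simp
    then have "(flat_exp p has_real_derivative 0) (at t)"
      by (rule has_field_derivative_transform_within_open[where S="{..<0}"]) (use 1 in \<open>auto simp: flat_exp_def\<close>)
    then show ?thesis using 1 by (simp add: flat_exp_def)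
  next
    case 3
    have "((\<lambda>t. poly p (1 / t) * exp (- (1 / t))) has_real_derivative
        (poly (pderiv p) (1 / t) * (- 1 / t\<^sup>2) * exp (- (1 / t)) + poly p (1 / t) * (exp (- (1 / t)) * (1 / t\<^sup>2)))) (at t)"
      using 3 by (auto intro!: derivative_eq_intros simp: power2_eq_square)
    also have "poly (pderiv p) (1 / t) * (- 1 / t\<^sup>2) * exp (- (1 / t)) + poly p (1 / t) * (exp (- (1 / t)) * (1 / t\<^sup>2))
        = flat_exp ?q t"
      using 3 by (simp add: flat_exp_def power2_eq_square field_simps)
    finally have "((\<lambda>t. poly p (1 / t) * exp (- (1 / t))) has_real_derivative flat_exp ?q t) (at t)" .
    then show ?thesis
      by (rule has_field_derivative_transform_within_open[where S="{0<..}"]) (use 3 in \<open>auto simp: flat_exp_def\<close>)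
  next
    case 2
    have "((\<lambda>y. flat_exp p y / y) \<longlongrightarrow> 0) (at 0)"
    proof (rule filterlim_split_at)
      have "\<forall>\<^sub>F y in at_left (0::real). flat_exp p y / y = 0"
        by (auto simp: eventually_at_left_field flat_exp_def intro!: exI[of _ "-1"])
      then show "((\<lambda>y. flat_exp p y / y) \<longlongrightarrow> 0) (at_left 0)" by (rule tendsto_eventually)
      \<comment> \<open>From the right the difference quotient at 0 is \<open>s p(s) exp(-s)\<close>
        with \<open>s = 1 / y\<close>, so polynomial growth loses against the exponential.\<close>
      have "((\<lambda>y. poly ([:0, 1:] * p) (inverse y) * exp (- (inverse y))) \<longlongrightarrow> 0) (at_right (0::real))"
        by (rule filterlim_compose[OF poly_exp_tendsto_0 filterlim_inverse_at_top_right])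
      moreover have "\<forall>\<^sub>F y in at_right (0::real). poly ([:0, 1:] * p) (inverse y) * exp (- (inverse y)) = flat_exp p y / y"
        by (auto simp: eventually_at_right_field flat_exp_def field_simps intro!: exI[of _ 1])
      ultimately show "((\<lambda>y. flat_exp p y / y) \<longlongrightarrow> 0) (at_right 0)" by (rule Lim_transform_eventually)
    qed
    then show ?thesis using 2 by (simp add: has_field_derivative_iff flat_exp_def)
  qed
qed

text \<open>The induction runs over all polynomials at once because each derivative replaces
  \<open>p\<close> by another one.\<close>

lemma Ck_flat_exp_comp:
  assumes "smooth_map q" shows "Ck k (\<lambda>x. flat_exp p (q x))"
proof (induction k arbitrary: p)
  case 0
  have "continuous_on UNIV (flat_exp p)"
    using flat_exp_has_derivative by (auto intro!: continuous_at_imp_continuous_on DERIV_isCont)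
  then show ?case using smooth_map_continuous[OF assms] by (auto intro: continuous_on_compose2)
next
  case (Suc k)
  show ?case
  proof (rule Ck_SucI)
    show "((\<lambda>x. flat_exp p (q x)) has_derivative
        (\<lambda>v. flat_exp ([:0, 0, 1:] * (p - pderiv p)) (q x) * frechet_derivative q (at x) v)) (at x)" for x
      using has_derivative_compose[OF smooth_map_has_derivative[OF assms, of x]
        flat_exp_has_derivative[of p "q x", unfolded has_field_derivative_def]] .
    show "Ck k (\<lambda>x. flat_exp ([:0, 0, 1:] * (p - pderiv p)) (q x) * frechet_derivative q (at x) v)" for v
      using smooth_map_derivative[OF assms, of v] by (intro Ck_mult Suc.IH) (auto simp: smooth_map_def)
  qed
qed

text \<open>Pointwise bounded convergence suffices, as limits are taken under integrals. Exact
  vanishing outside \<open>F\<close> confines the supports, which keeps the functions admissible as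
  test functions.\<close>

definition smooth_inner_approx :: "'a::real_normed_vector set \<Rightarrow> (nat \<Rightarrow> 'a \<Rightarrow> real) \<Rightarrow> bool" where
  "smooth_inner_approx F \<psi> \<longleftrightarrow> (\<forall>k. smooth_map (\<psi> k)) \<and> (\<forall>k x. 0 \<le> \<psi> k x \<and> \<psi> k x \<le> 1) \<and>
     (\<forall>x. (\<lambda>k. \<psi> k x) \<longlonglongrightarrow> indicator F x) \<and> (\<forall>k x. x \<notin> F \<longrightarrow> \<psi> k x = 0)"

definition smooth_sets :: "'a::real_normed_vector set set" where
  "smooth_sets = {F. \<exists>\<psi>. smooth_inner_approx F \<psi>}"

text \<open>Where \<open>q\<close> is positive, \<open>exp (- 1 / (Suc k * q x))\<close> tends to 1;
  elsewhere the function is identically 0.\<close>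

lemma smooth_sets_positive:
  fixes q :: "'a::real_normed_vector \<Rightarrow> real"
  assumes "smooth_map q" shows "{x. 0 < q x} \<in> smooth_sets"
proof -
  define \<psi> where "\<psi> k x = flat_exp 1 (real (Suc k) * q x)" for k x
  have "smooth_map (\<psi> k)" for k
    unfolding \<psi>_def using Ck_flat_exp_comp[of "\<lambda>x. real (Suc k) * q x"] smooth_map_mult[OF smooth_map_const assms]
    by (auto simp: smooth_map_def)
  moreover have "0 \<le> \<psi> k x \<and> \<psi> k x \<le> 1" for k x
    by (auto simp: \<psi>_def flat_exp_def)
  moreover have "(\<lambda>k. \<psi> k x) \<longlonglongrightarrow> indicator {x. 0 < q x} x" for x
  proof (cases "0 < q x")
    case False
    then have "\<psi> k x = 0" for k by (auto simp: \<psi>_def flat_exp_def mult_le_0_iff not_less)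
    then show ?thesis using False by simp
  next
    case True
    have "(\<lambda>k. exp (- (1 / q x * inverse (real (Suc k))))) \<longlonglongrightarrow> exp (- (1 / q x * 0))"
      by (intro tendsto_intros LIMSEQ_inverse_real_of_nat)
    moreover have "\<psi> k x = exp (- (1 / q x * inverse (real (Suc k))))" for k
      using True mult_pos_pos[of "real (Suc k)" "q x"] by (simp add: \<psi>_def flat_exp_def divide_simps not_le del: of_nat_Suc)
    ultimately show ?thesis using True by simp
  qed
  moreover have "\<psi> k x = 0" if "x \<notin> {x. 0 < q x}" for k x
    using that by (auto simp: \<psi>_def flat_exp_def mult_le_0_iff not_less)
  ultimately show ?thesis unfolding smooth_sets_def smooth_inner_approx_def by blast
qed

lemma smooth_sets_UNIV: "UNIV \<in> smooth_sets"
  unfolding smooth_sets_def smooth_inner_approx_def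
  by (auto intro!: exI[of _ "\<lambda>_ _. 1"] smooth_map_const)

lemma smooth_sets_Int:
  assumes "F \<in> smooth_sets" "G \<in> smooth_sets" shows "F \<inter> G \<in> smooth_sets"
proof -
  obtain \<psi> \<phi> where "smooth_inner_approx F \<psi>" "smooth_inner_approx G \<phi>" using assms by (auto simp: smooth_sets_def)
  then have "smooth_inner_approx (F \<inter> G) (\<lambda>k x. \<psi> k x * \<phi> k x)"
    unfolding smooth_inner_approx_def
    by (auto intro!: smooth_map_mult mult_le_one tendsto_mult simp: indicator_inter_arith)
  then show ?thesis by (auto simp: smooth_sets_def)
qed

lemma Int_stable_smooth_sets: "Int_stable smooth_sets"
  using smooth_sets_Int by (auto simp: Int_stable_def)

lemma smooth_sets_halfspace:
  fixes l :: "'a::real_normed_vector \<Rightarrow> real"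
  shows "bounded_linear l \<Longrightarrow> {x. c < l x} \<in> smooth_sets"
  using smooth_sets_positive[OF smooth_map_add[OF smooth_map_bounded_linear smooth_map_const[of "- c"]], of l] by simp

text \<open>The norm is not smooth at the centre, but \<open>r\<^sup>2 - (dist c x)\<^sup>2\<close>
  is a polynomial in the coordinates. Empty balls are the positivity set of a negative
  constant.\<close>

lemma smooth_sets_ball: "ball c r \<in> (smooth_sets :: 'a::euclidean_space set set)"
proof (cases "0 < r")
  case False
  have "{x::'a. 0 < (-1::real)} \<in> smooth_sets" by (rule smooth_sets_positive[OF smooth_map_const])
  then have "({} :: 'a set) \<in> smooth_sets" by simp
  then show ?thesis using False by (metis ball_eq_empty not_less)
next
  case True
  have co: "smooth_map (\<lambda>x::'a. x \<bullet> b - c \<bullet> b)" for b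
    using smooth_map_add[OF smooth_map_bounded_linear smooth_map_const, of "\<lambda>x. x \<bullet> b" "- (c \<bullet> b)"]
    by (simp add: bounded_linear_inner_left)
  have "smooth_map (\<lambda>x. r\<^sup>2 + (\<Sum>b\<in>Basis. (- 1) * ((x \<bullet> b - c \<bullet> b) * (x \<bullet> b - c \<bullet> b))))"
    by (intro smooth_map_add smooth_map_const smooth_map_sum smooth_map_mult co)
  then have "{x. 0 < r\<^sup>2 + (\<Sum>b\<in>Basis. (- 1) * ((x \<bullet> b - c \<bullet> b) * (x \<bullet> b - c \<bullet> b)))} \<in> smooth_sets"
    by (rule smooth_sets_positive)
  also have "{x. 0 < r\<^sup>2 + (\<Sum>b\<in>Basis. (- 1) * ((x \<bullet> b - c \<bullet> b) * (x \<bullet> b - c \<bullet> b)))} = ball c r"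
  proof -
    have "(0 < r\<^sup>2 + (\<Sum>b\<in>Basis. (- 1) * ((x \<bullet> b - c \<bullet> b) * (x \<bullet> b - c \<bullet> b)))) \<longleftrightarrow> dist c x < r" for x
    proof -
      have "(\<Sum>b\<in>Basis. (- 1) * ((x \<bullet> b - c \<bullet> b) * (x \<bullet> b - c \<bullet> b))) = - ((x - c) \<bullet> (x - c))"
        by (subst euclidean_inner) (simp add: inner_diff_left sum_negf)
      also have "(x - c) \<bullet> (x - c) = (dist c x)\<^sup>2" by (simp add: dist_norm power2_norm_eq_inner inner_diff_left inner_diff_right inner_commute)
      also have "0 < r\<^sup>2 + - (dist c x)\<^sup>2 \<longleftrightarrow> \<not> r\<^sup>2 \<le> (dist c x)\<^sup>2" by auto
      also have "\<dots> \<longleftrightarrow> dist c x < r" using True by (simp add: power_mono_iff not_le)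
      finally show ?thesis .
    qed
    then show ?thesis unfolding ball_def by (rule Collect_cong)
  qed
  finally show ?thesis .
qed

text \<open>Open half-spaces are positivity sets of affine functions and already generate the Borel
  sets.\<close>

lemma sigma_sets_smooth_sets:
  "sets (borel :: 'a::euclidean_space measure) \<subseteq> sigma_sets UNIV smooth_sets"
proof
  fix E :: "'a set" assume E: "E \<in> sets borel"
  let ?M = "sigma UNIV (smooth_sets :: 'a set set)"
  have "(\<lambda>x. x) \<in> borel_measurable ?M"
    unfolding borel_measurable_euclidean_space[of "\<lambda>x::'a. x"] borel_measurable_iff_greater
    by (auto intro!: smooth_sets_halfspace bounded_linear_inner_left sigma_sets.Basic)
  from measurable_sets[OF this E] show "E \<in> sigma_sets UNIV smooth_sets" by simp
qed

section \<open>Borel sets of linear maps and uniqueness for signed set functions\<close>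

lemma blinfun_basis_sum:
  fixes T :: "'a::euclidean_space \<Rightarrow>\<^sub>L 'b::euclidean_space"
  shows "T = (\<Sum>j\<in>Basis. blinfun_scaleR_left (T j) o\<^sub>L blinfun_inner_left j)"
proof (rule blinfun_eqI)
  fix v
  have "T v = T (\<Sum>j\<in>Basis. (v \<bullet> j) *\<^sub>R j)" by (simp add: euclidean_representation)
  also have "\<dots> = (\<Sum>j\<in>Basis. (v \<bullet> j) *\<^sub>R T j)" by (simp add: blinfun.sum_right blinfun.scaleR_right)
  finally show "T v = (\<Sum>j\<in>Basis. blinfun_scaleR_left (T j) o\<^sub>L blinfun_inner_left j) v"
    by (simp add: blinfun.sum_left)
qed

text \<open>A linear map is a finite sum of rank-one maps depending continuously on its values at
  the basis vectors.\<close>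

lemma borel_measurable_blinfunI:
  fixes f :: "'c \<Rightarrow> ('a::euclidean_space \<Rightarrow>\<^sub>L 'b::euclidean_space)"
  assumes "\<And>j. j \<in> Basis \<Longrightarrow> (\<lambda>x. f x j) \<in> borel_measurable M"
  shows "f \<in> borel_measurable M"
proof -
  have "(\<lambda>x. \<Sum>j\<in>Basis. blinfun_scaleR_left (f x j) o\<^sub>L blinfun_inner_left j) \<in> borel_measurable M"
  proof (intro borel_measurable_sum)
    fix j :: 'a assume "j \<in> Basis"
    have "continuous_on UNIV (\<lambda>u::'b. blinfun_scaleR_left u o\<^sub>L blinfun_inner_left j)"
      by (intro bounded_bilinear.continuous_on[OF bounded_bilinear_blinfun_compose] continuous_on_const
          linear_continuous_on bounded_linear_blinfun_scaleR_left)
    then show "(\<lambda>x. blinfun_scaleR_left (f x j) o\<^sub>L blinfun_inner_left j) \<in> borel_measurable M"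
      by (intro borel_measurable_continuous_on[OF _ assms[OF \<open>j \<in> Basis\<close>]])
  qed
  then show ?thesis by (simp flip: blinfun_basis_sum)
qed

lemma sigma_sets_smooth_sets_blinfun:
  "sets (borel :: ('a::euclidean_space \<Rightarrow>\<^sub>L 'a) measure) \<subseteq> sigma_sets UNIV smooth_sets"
proof
  fix E :: "('a \<Rightarrow>\<^sub>L 'a) set" assume E: "E \<in> sets borel"
  let ?M = "sigma UNIV (smooth_sets :: ('a \<Rightarrow>\<^sub>L 'a) set set)"
  have "(\<lambda>T. T) \<in> borel_measurable ?M"
  proof (rule borel_measurable_blinfunI)
    fix j :: 'a assume "j \<in> Basis"
    have bl: "bounded_linear (\<lambda>T :: 'a \<Rightarrow>\<^sub>L 'a. T j \<bullet> i)" for i by (rule bounded_linear_blinfun_matrix)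
    show "(\<lambda>T :: 'a \<Rightarrow>\<^sub>L 'a. T j) \<in> borel_measurable ?M"
      unfolding borel_measurable_euclidean_space[of "\<lambda>T :: 'a \<Rightarrow>\<^sub>L 'a. T j"] borel_measurable_iff_greater
      by (auto intro!: smooth_sets_halfspace bl sigma_sets.Basic)
  qed
  from measurable_sets[OF this E] show "E \<in> sigma_sets UNIV smooth_sets" by simp
qed

text \<open>Signed counterpart of the uniqueness of measures on a generator stable under
  intersection. The sum of integrals is a countably additive signed set function of
  \<open>S\<close>, so its zero sets are closed under complements and disjoint unions. Several maps
  \<open>g i\<close> are allowed because terms based at different points must be balanced against
  each other.\<close>

lemma dynkin_signed:
  fixes g :: "'i \<Rightarrow> 'z \<Rightarrow> 'x" and k :: "'i \<Rightarrow> 'z \<Rightarrow> real"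
  assumes I: "finite I" and k: "\<And>i. i \<in> I \<Longrightarrow> integrable N (k i)" and g: "\<And>i. i \<in> I \<Longrightarrow> g i \<in> N \<rightarrow>\<^sub>M X"
    and X: "space X = UNIV" "sets X \<subseteq> sigma_sets UNIV G" "\<And>F. F \<in> G \<Longrightarrow> F \<in> sets X" "Int_stable G" "UNIV \<in> G"
    and G0: "\<And>F. F \<in> G \<Longrightarrow> (\<Sum>i\<in>I. \<integral>z. indicator F (g i z) * k i z \<partial>N) = 0"
    and S: "S \<in> sets X"
  shows "(\<Sum>i\<in>I. \<integral>z. indicator S (g i z) * k i z \<partial>N) = 0"
proof -
  have sX: "A \<in> sigma_sets UNIV G \<Longrightarrow> A \<in> sets X" for A
  proof -
    have "sigma_sets (space X) G \<subseteq> sets X" by (rule sets.sigma_sets_subset) (use X(3) in blast)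
    then show "A \<in> sigma_sets UNIV G \<Longrightarrow> A \<in> sets X" using X(1) by auto
  qed
  have int: "integrable N (\<lambda>z. indicator A (g i z) * k i z)" if "A \<in> sets X" "i \<in> I" for A i
  proof (rule Bochner_Integration.integrable_bound[OF k[OF that(2)]])
    show "(\<lambda>z. indicator A (g i z) * k i z) \<in> borel_measurable N"
      using g[OF that(2)] that(1) borel_measurable_integrable[OF k[OF that(2)]] by measurable
  qed (auto split: split_indicator)
  have sub: "G \<subseteq> Pow UNIV" by simp
  have S': "S \<in> sigma_sets UNIV G" using S X(2) by blast
  from X(4) sub S' show ?thesis
  proof (induction rule: sigma_sets_induct_disjoint)
    case (basic A) then show ?case by (rule G0)
  next
    case empty then show ?case by simp
  next
    case (compl A)
    have "(\<Sum>i\<in>I. \<integral>z. indicator (UNIV - A) (g i z) * k i z \<partial>N)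
      = (\<Sum>i\<in>I. (\<integral>z. indicator UNIV (g i z) * k i z \<partial>N) - (\<integral>z. indicator A (g i z) * k i z \<partial>N))"
    proof (intro sum.cong refl)
      fix i assume i: "i \<in> I"
      have "(\<integral>z. indicator (UNIV - A) (g i z) * k i z \<partial>N) = (\<integral>z. indicator UNIV (g i z) * k i z - indicator A (g i z) * k i z \<partial>N)"
        by (intro Bochner_Integration.integral_cong) (auto split: split_indicator)
      also have "\<dots> = (\<integral>z. indicator UNIV (g i z) * k i z \<partial>N) - (\<integral>z. indicator A (g i z) * k i z \<partial>N)"
        by (intro Bochner_Integration.integral_diff int X(3,5) sX compl i)
      finally show "(\<integral>z. indicator (UNIV - A) (g i z) * k i z \<partial>N) = \<dots>" .
    qed
    then show ?case using G0[OF X(5)] compl.IH by (simp only: sum_subtractf diff_self)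
  next
    case (union A)
    have AX: "A n \<in> sets X" for n using union(2) by (intro sX) auto
    \<comment> \<open>The weights have no sign, so countable additivity comes from dominated
      convergence with bound \<open>norm (k i z)\<close>.\<close>
    have lim: "(\<lambda>n. \<Sum>i\<in>I. \<integral>z. indicator (\<Union>j<n. A j) (g i z) * k i z \<partial>N)
        \<longlonglongrightarrow> (\<Sum>i\<in>I. \<integral>z. indicator (\<Union>j. A j) (g i z) * k i z \<partial>N)"
    proof (intro tendsto_sum)
      fix i assume i: "i \<in> I"
      show "(\<lambda>n. \<integral>z. indicator (\<Union>j<n. A j) (g i z) * k i z \<partial>N) \<longlonglongrightarrow> (\<integral>z. indicator (\<Union>j. A j) (g i z) * k i z \<partial>N)"
      proof (rule integral_dominated_convergence[where w="\<lambda>z. norm (k i z)"])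
        show "(\<lambda>z. indicator (\<Union>j. A j) (g i z) * k i z) \<in> borel_measurable N"
          by (rule borel_measurable_integrable[OF int]) (use AX i in auto)
        show "(\<lambda>z. indicator (\<Union>j<n. A j) (g i z) * k i z) \<in> borel_measurable N" for n
          by (rule borel_measurable_integrable[OF int]) (use AX i in auto)
        show "AE z in N. (\<lambda>n. indicator (\<Union>j<n. A j) (g i z) * k i z) \<longlonglongrightarrow> indicator (\<Union>j. A j) (g i z) * k i z"
          by (intro AE_I2 tendsto_mult LIMSEQ_indicator_UN tendsto_const)
      qed (use k[OF i] in \<open>auto split: split_indicator\<close>)
    qed
    have "(\<Sum>i\<in>I. \<integral>z. indicator (\<Union>j<n. A j) (g i z) * k i z \<partial>N) = 0" for n
    proof -
      have "(\<integral>z. indicator (\<Union>j<n. A j) (g i z) * k i z \<partial>N) = (\<Sum>j<n. \<integral>z. indicator (A j) (g i z) * k i z \<partial>N)" if i: "i \<in> I" for i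
      proof -
        have "indicator (\<Union>j<n. A j) y = (\<Sum>j<n. indicator (A j) y :: real)" for y
          using union(1) by (intro indicator_UN_disjoint) (auto simp: disjoint_family_on_def)
        then have "(\<integral>z. indicator (\<Union>j<n. A j) (g i z) * k i z \<partial>N) = (\<integral>z. (\<Sum>j<n. indicator (A j) (g i z) * k i z) \<partial>N)"
          by (simp add: sum_distrib_right)
        also have "\<dots> = (\<Sum>j<n. \<integral>z. indicator (A j) (g i z) * k i z \<partial>N)"
          by (intro Bochner_Integration.integral_sum int AX i)
        finally show ?thesis .
      qed
      then have "(\<Sum>i\<in>I. \<integral>z. indicator (\<Union>j<n. A j) (g i z) * k i z \<partial>N) = (\<Sum>i\<in>I. \<Sum>j<n. \<integral>z. indicator (A j) (g i z) * k i z \<partial>N)"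
        by simp
      also have "\<dots> = (\<Sum>j<n. \<Sum>i\<in>I. \<integral>z. indicator (A j) (g i z) * k i z \<partial>N)" by (rule sum.swap)
      also have "\<dots> = 0" using union(3) by simp
      finally show ?thesis .
    qed
    then show ?case using lim by (simp add: LIMSEQ_const_iff)
  qed
qed

section \<open>Orthogonal projections\<close>

text \<open>An orthonormal basis of \<open>P\<close> gives existence, and the difference of two
  candidates lies in \<open>P\<close> and is orthogonal to itself; uniqueness is what makes the
  definite description usable.\<close>

lemma orth_proj_works:
  fixes P :: "'a::euclidean_space set"
  assumes P: "subspace P"
  shows "orth_proj P x \<in> P" "y \<in> P \<Longrightarrow> (x - orth_proj P x) \<bullet> y = 0"
proof -
  let ?Q = "\<lambda>L::'a \<Rightarrow>\<^sub>L 'a. \<forall>x. L x \<in> P \<and> (\<forall>y\<in>P. (x - L x) \<bullet> y = 0)"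
  obtain B where B: "B \<subseteq> P" "pairwise orthogonal B" "\<And>x. x \<in> B \<Longrightarrow> norm x = 1" "independent B" "span B = P"
    using orthonormal_basis_subspace[OF P] by metis
  have fB: "finite B" using B(4) independent_imp_finite by blast
  define f where "f x = (\<Sum>b\<in>B. (x \<bullet> b) *\<^sub>R b)" for x
  have "bounded_linear f" unfolding f_def
    by (intro bounded_linear_sum bounded_linear_scaleR_const bounded_linear_inner_left)
  then have L: "blinfun_apply (Blinfun f) = f" by (rule bounded_linear_Blinfun_apply)
  have fP: "f x \<in> P" for x unfolding f_def using B(1) P by (auto intro!: subspace_sum subspace_scale)
  have "(x - f x) \<bullet> y = 0" if "y \<in> P" for x y
  proof -
    have "(x - f x) \<bullet> b = 0" if b: "b \<in> B" for b
    proof -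
      have "f x \<bullet> b = (\<Sum>c\<in>B. if c = b then x \<bullet> b else 0)"
        unfolding f_def inner_sum_left using B(2,3) b
        by (intro sum.cong) (auto simp: pairwise_def orthogonal_def norm_eq_1)
      then show ?thesis using fB b by (simp add: inner_diff_left)
    qed
    then have "orthogonal (x - f x) y" using that B(5)
      by (intro orthogonal_to_span[of y B "x - f x"]) (auto simp: orthogonal_def)
    then show ?thesis by (simp add: orthogonal_def)
  qed
  then have ex: "?Q (Blinfun f)" using fP by (simp add: L)
  have un: "L' = Blinfun f" if L': "?Q L'" for L'
  proof (rule blinfun_eqI)
    fix x
    have d: "L' x - Blinfun f x \<in> P" using L' ex P subspace_diff by blast
    then have "(x - L' x) \<bullet> (L' x - Blinfun f x) = 0" "(x - Blinfun f x) \<bullet> (L' x - Blinfun f x) = 0"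
      using L' ex by blast+
    then have "(L' x - Blinfun f x) \<bullet> (L' x - Blinfun f x) = 0" by (simp add: inner_diff_left)
    then show "L' x = Blinfun f x" by simp
  qed
  have "?Q (orth_proj P)" unfolding orth_proj_def by (rule theI[of ?Q, OF ex un])
  then show "orth_proj P x \<in> P" "y \<in> P \<Longrightarrow> (x - orth_proj P x) \<bullet> y = 0" by auto
qed

lemma orth_proj_in_id:
  assumes "subspace P" "y \<in> P" shows "orth_proj P y = y"
proof -
  have "y - orth_proj P y \<in> P" using assms orth_proj_works(1) subspace_diff by blast
  then have "(y - orth_proj P y) \<bullet> (y - orth_proj P y) = 0" using orth_proj_works(2)[OF assms(1)] by blast
  then show ?thesis by simp
qed

lemma orth_proj_symmetric:
  assumes "subspace P" shows "orth_proj P x \<bullet> y = x \<bullet> orth_proj P y"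
proof -
  have "(x - orth_proj P x) \<bullet> orth_proj P y = 0" "(y - orth_proj P y) \<bullet> orth_proj P x = 0"
    using orth_proj_works[OF assms] by auto
  then have "x \<bullet> orth_proj P y = orth_proj P x \<bullet> orth_proj P y" "y \<bullet> orth_proj P x = orth_proj P y \<bullet> orth_proj P x"
    by (simp_all add: inner_diff_left)
  then show ?thesis by (metis inner_commute)
qed

lemma norm_orth_proj_le:
  assumes "subspace P" shows "norm (orth_proj P x) \<le> norm x"
proof -
  have "(x - orth_proj P x) \<bullet> orth_proj P x = 0" using orth_proj_works[OF assms] by auto
  then have "orth_proj P x \<bullet> orth_proj P x = x \<bullet> orth_proj P x" by (simp add: inner_diff_left)
  also have "\<dots> \<le> norm x * norm (orth_proj P x)" by (rule norm_cauchy_schwarz)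
  finally have "norm (orth_proj P x) * norm (orth_proj P x) \<le> norm x * norm (orth_proj P x)"
    by (simp add: dot_square_norm power2_eq_square)
  then show ?thesis by (cases "orth_proj P x = 0") auto
qed

lemma range_orth_proj: "subspace P \<Longrightarrow> range (orth_proj P) = P"
  using orth_proj_works(1) orth_proj_in_id by (metis (no_types, lifting) image_subset_iff rangeI subsetI subset_antisym)

section \<open>Translating along the tangent planes\<close>

lemma Ck_shift: "Ck k f \<Longrightarrow> Ck k (\<lambda>x. f (x + c))"
proof (induction k arbitrary: f)
  case 0 then show ?case by (auto intro!: continuous_on_compose2[of UNIV f] continuous_intros)
next
  case (Suc k)
  show ?case
  proof (rule Ck_SucI)
    fix x
    show "((\<lambda>x. f (x + c)) has_derivative frechet_derivative f (at (x + c))) (at x)"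
      by (rule has_derivative_compose[where g=f and f="\<lambda>x. x + c" and f'="\<lambda>v. v", simplified])
         (auto intro!: derivative_eq_intros Ck_SucD(1)[OF Suc.prems])
  next
    fix v show "Ck k (\<lambda>x. frechet_derivative f (at (x + c)) v)"
      using Suc.IH[OF Ck_SucD(2)[OF Suc.prems, of v]] .
  qed
qed

lemma smooth_map_shift: "smooth_map f \<Longrightarrow> smooth_map (\<lambda>x. f (x + c))"
  by (simp add: smooth_map_def Ck_shift)

lemma frechet_derivative_shift:
  assumes "smooth_map f"
  shows "frechet_derivative (\<lambda>x. f (x + c)) (at x) = frechet_derivative f (at (x + c))"
proof -
  have "((\<lambda>x. f (x + c)) has_derivative frechet_derivative f (at (x + c))) (at x)"
    by (rule has_derivative_compose[where g=f and f="\<lambda>x. x + c" and f'="\<lambda>v. v", simplified])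
       (auto intro!: derivative_eq_intros smooth_map_has_derivative assms)
  then show ?thesis using frechet_derivative_at by metis
qed

text \<open>Separates base point from direction: only finitely many continuous partial derivatives
  remain, from which measurability, boundedness and limits follow even when both vary.\<close>

lemma frechet_derivative_basis_sum:
  fixes \<psi> :: "'a::euclidean_space \<Rightarrow> real"
  assumes "smooth_map \<psi>"
  shows "frechet_derivative \<psi> (at x) v = (\<Sum>i\<in>Basis. (v \<bullet> i) * frechet_derivative \<psi> (at x) i)"
proof -
  have lin: "linear (frechet_derivative \<psi> (at x))"
    using smooth_map_has_derivative[OF assms] has_derivative_linear by blast
  have "frechet_derivative \<psi> (at x) v = frechet_derivative \<psi> (at x) (\<Sum>i\<in>Basis. (v \<bullet> i) *\<^sub>R i)"
    by (simp add: euclidean_representation)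
  also have "\<dots> = (\<Sum>i\<in>Basis. (v \<bullet> i) * frechet_derivative \<psi> (at x) i)"
    by (simp add: linear_sum[OF lin] linear_scale[OF lin])
  finally show ?thesis .
qed

lemma frechet_derivative_support:
  fixes \<psi> :: "'a::euclidean_space \<Rightarrow> 'b::real_normed_vector"
  assumes "closed K" "\<And>x. x \<notin> K \<Longrightarrow> \<psi> x = 0" "x \<notin> K"
  shows "frechet_derivative \<psi> (at x) v = 0"
proof -
  have "(\<psi> has_derivative (\<lambda>_. 0)) (at x)"
    by (rule has_derivative_transform_within_open[OF has_derivative_const, of "- K" _ 0]) (use assms in auto)
  then show ?thesis using frechet_derivative_at by metis
qed

lemma continuous_compact_support_bounded:
  fixes f :: "'a::euclidean_space \<Rightarrow> real"
  assumes "continuous_on UNIV f" "compact K" "\<And>x. x \<notin> K \<Longrightarrow> f x = 0"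
  obtains C where "0 \<le> C" "\<And>x. \<bar>f x\<bar> \<le> C"
proof -
  have "bounded (f ` K)"
    using assms(1,2) by (meson compact_continuous_image compact_imp_bounded continuous_on_subset subset_UNIV)
  then obtain C where C: "\<And>x. x \<in> K \<Longrightarrow> \<bar>f x\<bar> \<le> C" by (auto simp: bounded_iff)
  show ?thesis
  proof (rule that[of "max C 0"])
    fix x show "\<bar>f x\<bar> \<le> max C 0" using C[of x] assms(3)[of x] by (cases "x \<in> K") auto
  qed simp
qed

lemma frechet_derivative_bounded:
  fixes \<psi> :: "'a::euclidean_space \<Rightarrow> real"
  assumes \<psi>: "smooth_map \<psi>" and K: "compact K" "\<And>x. x \<notin> K \<Longrightarrow> \<psi> x = 0"
  obtains C where "0 \<le> C" "\<And>x v. \<bar>frechet_derivative \<psi> (at x) v\<bar> \<le> C * norm v"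
proof -
  have "\<forall>i. \<exists>C\<ge>0. \<forall>x. \<bar>frechet_derivative \<psi> (at x) i\<bar> \<le> C"
  proof
    fix i
    have sup: "frechet_derivative \<psi> (at x) i = 0" if "x \<notin> K" for x
      by (rule frechet_derivative_support[OF compact_imp_closed[OF K(1)] _ that]) (rule K(2))
    obtain C where "0 \<le> C" "\<And>x. \<bar>frechet_derivative \<psi> (at x) i\<bar> \<le> C"
      by (rule continuous_compact_support_bounded[OF smooth_map_continuous[OF smooth_map_derivative[OF \<psi>, of i]] K(1)],
          erule sup, rule that)
    then show "\<exists>C\<ge>0. \<forall>x. \<bar>frechet_derivative \<psi> (at x) i\<bar> \<le> C" by blast
  qed
  from choice[OF this] obtain C where C: "\<And>i. 0 \<le> C i" "\<And>i x. \<bar>frechet_derivative \<psi> (at x) i\<bar> \<le> C i" by blast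
  show ?thesis
  proof (rule that[of "\<Sum>i\<in>Basis. C i"])
    fix x v
    have "\<bar>frechet_derivative \<psi> (at x) v\<bar> \<le> (\<Sum>i\<in>Basis. \<bar>(v \<bullet> i) * frechet_derivative \<psi> (at x) i\<bar>)"
      unfolding frechet_derivative_basis_sum[OF \<psi>, of x v] by (rule sum_abs)
    also have "\<dots> \<le> (\<Sum>i\<in>Basis. norm v * C i)"
      unfolding abs_mult by (intro sum_mono mult_mono C Basis_le_norm) auto
    finally show "\<bar>frechet_derivative \<psi> (at x) v\<bar> \<le> (\<Sum>i\<in>Basis. C i) * norm v"
      by (simp only: sum_distrib_right mult.commute[of "norm v"])
  qed (use C in \<open>auto intro: sum_nonneg\<close>)
qed

lemma borel_measurable_frechet_derivative:
  fixes \<psi> :: "'a::euclidean_space \<Rightarrow> real"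
  assumes \<psi>: "smooth_map \<psi>" and p[measurable]: "p \<in> borel_measurable M" and v[measurable]: "v \<in> borel_measurable M"
  shows "(\<lambda>z. frechet_derivative \<psi> (at (p z)) (v z)) \<in> borel_measurable M"
proof -
  have c: "(\<lambda>z. frechet_derivative \<psi> (at (p z)) i) \<in> borel_measurable M" for i
    by (rule borel_measurable_continuous_on[OF smooth_map_continuous[OF smooth_map_derivative[OF \<psi>]] p])
  show ?thesis
    unfolding frechet_derivative_basis_sum[OF \<psi>, of "p _" "v _"] using c by measurable
qed

lemma borel_measurable_blinfun_apply [measurable (raw)]:
  fixes f :: "'c \<Rightarrow> ('a::euclidean_space \<Rightarrow>\<^sub>L 'b::euclidean_space)"
  assumes "f \<in> borel_measurable M" "g \<in> borel_measurable M"
  shows "(\<lambda>x. blinfun_apply (f x) (g x)) \<in> borel_measurable M"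
  using assms by (rule borel_measurable_continuous_Pair) (intro continuous_intros)

lemma open_smooth_sets:
  assumes "F \<in> smooth_sets" shows "open F"
proof -
  obtain \<psi> where \<psi>: "smooth_inner_approx F \<psi>" using assms by (auto simp: smooth_sets_def)
  have "F = (\<Union>k. {x. 0 < \<psi> k x})"
  proof (intro set_eqI iffI)
    fix x assume "x \<in> F"
    then have "(\<lambda>k. \<psi> k x) \<longlonglongrightarrow> 1" using \<psi> unfolding smooth_inner_approx_def by (metis indicator_simps(1))
    then have "\<forall>\<^sub>F k in sequentially. 0 < \<psi> k x" by (rule order_tendstoD) simp
    then show "x \<in> (\<Union>k. {x. 0 < \<psi> k x})" by (auto simp: eventually_sequentially)
  next
    fix x assume "x \<in> (\<Union>k. {x. 0 < \<psi> k x})"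
    then show "x \<in> F" using \<psi> unfolding smooth_inner_approx_def by (metis (mono_tags, lifting) UN_E less_irrefl mem_Collect_eq)
  qed
  moreover have "open {x. 0 < \<psi> k x}" for k
    using \<psi> smooth_map_continuous by (auto simp: smooth_inner_approx_def intro!: open_Collect_less continuous_intros)
  ultimately show ?thesis by (metis open_UN)
qed

text \<open>A ball for the Hilbert-Schmidt norm, whose square is polynomial, whereas the operator
  norm is not smooth. Contractions such as projections have squared norm at most
  \<open>DIM('a)\<close>, hence lie strictly inside. It supplies functions of bounded support that
  do not affect the values of \<open>\<tau>\<close>.\<close>

definition HS_ball :: "('a::euclidean_space \<Rightarrow>\<^sub>L 'a) set" where
  "HS_ball = {T :: 'a \<Rightarrow>\<^sub>L 'a. 0 < (real DIM('a) + 1) + (\<Sum>i\<in>Basis. \<Sum>j\<in>Basis. (- 1) * ((T i \<bullet> j) * (T i \<bullet> j)))}"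

lemma HS_ball_smooth: "HS_ball \<in> smooth_sets"
  unfolding HS_ball_def
  by (intro smooth_sets_positive smooth_map_add smooth_map_const smooth_map_sum smooth_map_mult
      smooth_map_bounded_linear bounded_linear_blinfun_matrix)

lemma HS_ball_alt: "T \<in> HS_ball \<longleftrightarrow> (\<Sum>i\<in>Basis. (norm (T i))\<^sup>2) < real DIM('a) + 1"
  for T :: "'a::euclidean_space \<Rightarrow>\<^sub>L 'a"
proof -
  have "(\<Sum>j\<in>Basis. (T i \<bullet> j) * (T i \<bullet> j)) = (norm (T i))\<^sup>2" for i
    unfolding power2_norm_eq_inner by (rule euclidean_inner[symmetric])
  then have "(\<Sum>i\<in>Basis. \<Sum>j\<in>Basis. (- 1) * ((T i \<bullet> j) * (T i \<bullet> j))) = - (\<Sum>i\<in>Basis. (norm (T i))\<^sup>2)"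
    by (simp add: sum_negf)
  then show ?thesis by (simp only: HS_ball_def mem_Collect_eq) linarith
qed

lemma bounded_HS_ball: "bounded (HS_ball :: ('a::euclidean_space \<Rightarrow>\<^sub>L 'a) set)"
proof -
  have "norm T \<le> real DIM('a) * (real DIM('a) + 1)" if T: "T \<in> HS_ball" for T :: "'a \<Rightarrow>\<^sub>L 'a"
  proof -
    have "norm (T i) \<le> real DIM('a) + 1" if i: "i \<in> Basis" for i
    proof (rule ccontr)
      assume "\<not> ?thesis"
      then have "real DIM('a) + 1 < norm (T i)" by simp
      moreover then have "1 \<le> norm (T i)" by simp
      then have "norm (T i) \<le> (norm (T i))\<^sup>2" by (rule self_le_power) simp
      moreover have "(norm (T i))\<^sup>2 \<le> (\<Sum>i\<in>Basis. (norm (T i))\<^sup>2)" using i by (intro member_le_sum) auto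
      ultimately show False using T unfolding HS_ball_alt by linarith
    qed
    then have "(\<Sum>i\<in>Basis. norm (T i)) \<le> real DIM('a) * (real DIM('a) + 1)"
      using sum_bounded_above[of Basis "\<lambda>i. norm (T i)" "real DIM('a) + 1"] by simp
    then show ?thesis using norm_blinfun_euclidean_le[of T] by linarith
  qed
  then show ?thesis unfolding bounded_iff by blast
qed

text \<open>The parameter of a segment as a probability measure, so that integrals along segments
  become product integrals.\<close>

definition unit_lborel :: "real measure" where
  "unit_lborel = density lborel (indicator {0..1})"

lemma sets_unit_lborel [simp, measurable_cong]: "sets unit_lborel = sets borel"
  by (simp add: unit_lborel_def)

lemma space_unit_lborel [simp]: "space unit_lborel = UNIV"
  by (simp add: unit_lborel_def)

lemma emeasure_unit_lborel: "emeasure unit_lborel UNIV = 1"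
  by (simp add: unit_lborel_def emeasure_density)

lemma finite_measure_unit_lborel: "finite_measure unit_lborel"
  by (rule finite_measureI) (simp add: emeasure_unit_lborel)

lemma AE_unit_lborel: "AE s in unit_lborel. 0 \<le> s \<and> s \<le> 1"
  unfolding unit_lborel_def by (subst AE_density) (auto intro!: AE_I2 simp: indicator_def split: if_splits)

lemma integral_unit_lborel_const: "(\<integral>s. c \<partial>unit_lborel) = (c::real)"
  by (simp add: measure_def emeasure_unit_lborel)

text \<open>What remains of the varifold on a ball once the second fundamental form vanishes, in
  Borel terms. In \<open>weak\<close> the test field is \<open>\<psi>\<close> times the constant
  vector \<open>w\<close>, and the term containing the derivative of \<open>\<gamma>\<close> is
  gone. The value 0 of \<open>\<tau>\<close> stands for a point without a usable tangent
  plane.\<close>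

locale flat_measure =
  fixes m :: nat and \<mu> :: "'a::euclidean_space measure" and \<tau> :: "'a \<Rightarrow> ('a \<Rightarrow>\<^sub>L 'a)"
    and h :: "'a \<Rightarrow> 'a" and a :: 'a and \<rho> :: real
  assumes m: "1 \<le> m"
    and sets_mu [measurable_cong]: "sets \<mu> = sets borel"
    and fin: "emeasure \<mu> UNIV < top"
    and tau_meas [measurable]: "\<tau> \<in> borel_measurable borel"
    and tau_proj: "\<And>x. \<tau> x = 0 \<or> (\<exists>P\<in>Grass m. \<tau> x = orth_proj P)"
    and h_meas [measurable]: "h \<in> borel_measurable borel"
    and h_int: "integrable \<mu> h"
    and weak: "\<And>\<psi> \<gamma> w K. smooth_map \<psi> \<Longrightarrow> compact K \<Longrightarrow> K \<subseteq> ball a \<rho> \<Longrightarrow> (\<And>x. x \<notin> K \<Longrightarrow> \<psi> x = 0) \<Longrightarrow>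
      smooth_map \<gamma> \<Longrightarrow> bounded {T. \<gamma> T \<noteq> 0} \<Longrightarrow>
      (\<integral>x. \<gamma> (\<tau> x) * frechet_derivative \<psi> (at x) (\<tau> x w) \<partial>\<mu>) = (\<integral>x. \<gamma> (\<tau> x) * (\<psi> x * (w \<bullet> h x)) \<partial>\<mu>)"
begin

lemma space_mu: "space \<mu> = UNIV"
  using sets_eq_imp_space_eq[OF sets_mu] by simp

sublocale mu: finite_measure \<mu>
  by (rule finite_measureI) (use fin in \<open>simp add: space_mu\<close>)

lemma norm_tau_le: "norm (\<tau> x w) \<le> norm w"
  using tau_proj[of x] norm_orth_proj_le by (auto simp: Grass_def)

lemma tau_HS: "\<tau> x \<in> HS_ball"
proof -
  have "(\<Sum>i\<in>Basis. (norm (\<tau> x i))\<^sup>2) \<le> (\<Sum>i\<in>(Basis :: 'a set). 1)"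
  proof (intro sum_mono)
    fix i :: 'a assume "i \<in> Basis"
    then have "norm (\<tau> x i) \<le> 1" using norm_tau_le[of x i] by simp
    then show "(norm (\<tau> x i))\<^sup>2 \<le> 1" by (simp add: power_le_one)
  qed
  then show ?thesis unfolding HS_ball_alt by simp
qed

lemma integrable_bounded_mult_h:
  fixes f :: "'a \<Rightarrow> real"
  assumes [measurable]: "f \<in> borel_measurable borel" and C: "\<And>x. \<bar>f x\<bar> \<le> C"
  shows "integrable \<mu> (\<lambda>x. f x * (w \<bullet> h x))"
proof (rule Bochner_Integration.integrable_bound[of _ "\<lambda>x. (C * norm w) * norm (h x)"])
  show "integrable \<mu> (\<lambda>x. (C * norm w) * norm (h x))" using h_int by auto
  show "AE x in \<mu>. norm (f x * (w \<bullet> h x)) \<le> norm (C * norm w * norm (h x))"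
  proof (rule AE_I2)
    fix x
    have C0: "0 \<le> C" using C[of x] by simp
    have "\<bar>w \<bullet> h x\<bar> \<le> norm w * norm (h x)" by (rule Cauchy_Schwarz_ineq2)
    then have "\<bar>f x\<bar> * \<bar>w \<bullet> h x\<bar> \<le> C * (norm w * norm (h x))"
      using C[of x] C0 by (intro mult_mono) auto
    then show "norm (f x * (w \<bullet> h x)) \<le> norm (C * norm w * norm (h x))"
      using C0 by (simp add: abs_mult mult.assoc)
  qed
qed measurable

lemma integrable_bounded:
  fixes f :: "'a \<Rightarrow> real"
  assumes [measurable]: "f \<in> borel_measurable borel" and C: "\<And>x. \<bar>f x\<bar> \<le> C"
  shows "integrable \<mu> f"
  by (rule mu.integrable_const_bound[of _ C]) (use C in auto)

text \<open>For fixed \<open>\<psi>\<close> both sides are integrals against one signed density, so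
  the identity passes from smooth functions of \<open>\<tau> x\<close> to indicators of Borel sets
  of linear maps.\<close>

lemma weak_indicator:
  assumes \<psi>: "smooth_map \<psi>" and K: "compact K" "K \<subseteq> ball a \<rho>" "\<And>x. x \<notin> K \<Longrightarrow> \<psi> x = 0"
    and E: "E \<in> sets borel"
  shows "(\<integral>x. indicator E (\<tau> x) * frechet_derivative \<psi> (at x) (\<tau> x w) \<partial>\<mu>) = (\<integral>x. indicator E (\<tau> x) * (\<psi> x * (w \<bullet> h x)) \<partial>\<mu>)"
proof -
  have [measurable]: "\<psi> \<in> borel_measurable borel"
    using smooth_map_continuous[OF \<psi>] by (rule borel_measurable_continuous_onI)
  have [measurable]: "(\<lambda>x. frechet_derivative \<psi> (at x) (\<tau> x w)) \<in> borel_measurable borel"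
    by (rule borel_measurable_frechet_derivative[OF \<psi>]) measurable
  obtain C where C: "0 \<le> C" "\<And>x v. \<bar>frechet_derivative \<psi> (at x) v\<bar> \<le> C * norm v"
    by (rule frechet_derivative_bounded[OF \<psi> K(1)], erule K(3), rule that)
  have C': "\<bar>frechet_derivative \<psi> (at x) (\<tau> x w)\<bar> \<le> C * norm w" for x
    using C(2)[of x "\<tau> x w"] mult_left_mono[OF norm_tau_le C(1), of x w] by linarith
  obtain C2 where C2: "0 \<le> C2" "\<And>x. \<bar>\<psi> x\<bar> \<le> C2"
    by (rule continuous_compact_support_bounded[OF smooth_map_continuous[OF \<psi>] K(1)], erule K(3), rule that)
  have i1: "integrable \<mu> (\<lambda>x. frechet_derivative \<psi> (at x) (\<tau> x w))" using C' by (intro integrable_bounded) auto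
  have i2: "integrable \<mu> (\<lambda>x. \<psi> x * (w \<bullet> h x))" using C2(2) by (intro integrable_bounded_mult_h) auto
  define k where "k x = frechet_derivative \<psi> (at x) (\<tau> x w) - \<psi> x * (w \<bullet> h x)" for x
  have ik: "integrable \<mu> k" unfolding k_def using i1 i2 by auto
  have [measurable]: "k \<in> borel_measurable borel" unfolding k_def by measurable
  have split: "(\<integral>x. f x * k x \<partial>\<mu>) = (\<integral>x. f x * frechet_derivative \<psi> (at x) (\<tau> x w) \<partial>\<mu>) - (\<integral>x. f x * (\<psi> x * (w \<bullet> h x)) \<partial>\<mu>)"
    if f[measurable]: "f \<in> borel_measurable borel" and b: "\<And>x. \<bar>f x\<bar> \<le> 1" for f :: "'a \<Rightarrow> real"
  proof -
    have "integrable \<mu> (\<lambda>x. f x * frechet_derivative \<psi> (at x) (\<tau> x w))"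
      by (rule Bochner_Integration.integrable_bound[OF i1]) (use b in \<open>auto simp: abs_mult intro!: mult_left_le_one_le\<close>)
    moreover have "integrable \<mu> (\<lambda>x. f x * (\<psi> x * (w \<bullet> h x)))"
      by (rule Bochner_Integration.integrable_bound[OF i2]) (use b in \<open>auto simp: abs_mult intro!: mult_left_le_one_le\<close>)
    ultimately show ?thesis by (simp add: k_def right_diff_distrib)
  qed
  have "(\<Sum>i\<in>{()}. \<integral>x. indicator E (\<tau> x) * k x \<partial>\<mu>) = 0"
  proof (rule dynkin_signed[where X=borel and G=smooth_sets])
    show "\<tau> \<in> \<mu> \<rightarrow>\<^sub>M borel" by measurable
    show "sets borel \<subseteq> sigma_sets UNIV (smooth_sets :: ('a \<Rightarrow>\<^sub>L 'a) set set)" by (rule sigma_sets_smooth_sets_blinfun)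
    show "Int_stable (smooth_sets :: ('a \<Rightarrow>\<^sub>L 'a) set set)" by (rule Int_stable_smooth_sets)
    show "UNIV \<in> (smooth_sets :: ('a \<Rightarrow>\<^sub>L 'a) set set)" by (rule smooth_sets_UNIV)
    fix F :: "('a \<Rightarrow>\<^sub>L 'a) set" assume F: "F \<in> smooth_sets"
    show Fb: "F \<in> sets borel" using open_smooth_sets[OF F] by auto
    \<comment> \<open>Intersecting with \<open>HS_ball\<close> makes the approximating functions
      boundedly supported and changes nothing, because every \<open>\<tau> x\<close> lies in
      \<open>HS_ball\<close>.\<close>
    have "F \<inter> HS_ball \<in> smooth_sets" by (rule smooth_sets_Int[OF F HS_ball_smooth])
    then obtain \<gamma> where \<gamma>: "smooth_inner_approx (F \<inter> HS_ball) \<gamma>" by (auto simp: smooth_sets_def)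
    have \<gamma>m[measurable]: "\<gamma> n \<in> borel_measurable borel" for n
      using \<gamma> smooth_map_continuous by (auto simp: smooth_inner_approx_def intro!: borel_measurable_continuous_onI)
    have \<gamma>b: "\<bar>\<gamma> n T\<bar> \<le> 1" for n T using \<gamma> by (simp add: smooth_inner_approx_def)
    have z: "(\<integral>x. \<gamma> n (\<tau> x) * k x \<partial>\<mu>) = 0" for n
    proof -
      have "{T. \<gamma> n T \<noteq> 0} \<subseteq> HS_ball" using \<gamma> by (auto simp: smooth_inner_approx_def)
      then have "bounded {T. \<gamma> n T \<noteq> 0}" using bounded_HS_ball bounded_subset by blast
      then show ?thesis using weak[OF \<psi> K, of "\<gamma> n" w] \<gamma> \<gamma>b by (subst split) (auto simp: smooth_inner_approx_def)
    qed
    have "(\<lambda>n. \<integral>x. \<gamma> n (\<tau> x) * k x \<partial>\<mu>) \<longlonglongrightarrow> (\<integral>x. indicator (F \<inter> HS_ball) (\<tau> x) * k x \<partial>\<mu>)"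
    proof (rule integral_dominated_convergence[where w="\<lambda>x. norm (k x)"])
      have "F \<inter> HS_ball \<in> sets borel" using open_smooth_sets[OF F] open_smooth_sets[OF HS_ball_smooth] by (intro sets.Int borel_open)
      then show "(\<lambda>x. indicator (F \<inter> HS_ball) (\<tau> x) * k x) \<in> borel_measurable \<mu>" by measurable
      show "AE x in \<mu>. (\<lambda>n. \<gamma> n (\<tau> x) * k x) \<longlonglongrightarrow> indicator (F \<inter> HS_ball) (\<tau> x) * k x"
        using \<gamma> by (intro AE_I2 tendsto_mult tendsto_const) (auto simp: smooth_inner_approx_def)
      show "AE x in \<mu>. norm (\<gamma> n (\<tau> x) * k x) \<le> norm (k x)" for n
        using \<gamma>b by (intro AE_I2) (auto simp: abs_mult intro!: mult_left_le_one_le)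
    qed (use ik in auto)
    then have "(\<integral>x. indicator (F \<inter> HS_ball) (\<tau> x) * k x \<partial>\<mu>) = 0" by (simp add: z LIMSEQ_const_iff)
    moreover have "indicator (F \<inter> HS_ball) (\<tau> x) = (indicator F (\<tau> x) :: real)" for x
      using tau_HS[of x] by (auto split: split_indicator)
    ultimately show "(\<Sum>i\<in>{()}. \<integral>x. indicator F (\<tau> x) * k x \<partial>\<mu>) = 0" by simp
  qed (use ik E in auto)
  then have "(\<integral>x. indicator E (\<tau> x) * k x \<partial>\<mu>) = 0" by simp
  then show ?thesis using E by (subst (asm) split) auto
qed

text \<open>The translation depends on \<open>\<tau> x\<close>, so the test function is frozen at the values of simple functions
  approximating the identity of the space of linear maps.\<close>

lemma weak_shift:
  assumes \<psi>: "smooth_map \<psi>" and K: "compact K" "K \<subseteq> cball a r" "\<And>x. x \<notin> K \<Longrightarrow> \<psi> x = 0"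
    and E: "E \<in> sets borel" and w: "r + norm w < \<rho>" and s: "0 \<le> s" "s \<le> 1"
  shows "(\<integral>x. indicator E (\<tau> x) * frechet_derivative \<psi> (at (x + s *\<^sub>R \<tau> x w)) (\<tau> x w) \<partial>\<mu>)
    = (\<integral>x. indicator E (\<tau> x) * (\<psi> (x + s *\<^sub>R \<tau> x w) * (w \<bullet> h x)) \<partial>\<mu>)"
proof -
  note [measurable] = E
  have [measurable]: "\<psi> \<in> borel_measurable borel"
    using smooth_map_continuous[OF \<psi>] by (rule borel_measurable_continuous_onI)
  obtain C where C: "0 \<le> C" "\<And>x v. \<bar>frechet_derivative \<psi> (at x) v\<bar> \<le> C * norm v"
    by (rule frechet_derivative_bounded[OF \<psi> K(1)], erule K(3), rule that)
  have C': "\<bar>frechet_derivative \<psi> (at y) (\<tau> x w)\<bar> \<le> C * norm w" for x y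
    using C(2)[of y "\<tau> x w"] mult_left_mono[OF norm_tau_le C(1), of x w] by linarith
  obtain C2 where C2: "0 \<le> C2" "\<And>x. \<bar>\<psi> x\<bar> \<le> C2"
    by (rule continuous_compact_support_bounded[OF smooth_map_continuous[OF \<psi>] K(1)], erule K(3), rule that)
  have "(\<lambda>T :: 'a \<Rightarrow>\<^sub>L 'a. T) \<in> borel_measurable borel" by simp
  from borel_measurable_implies_sequence_metric[OF this, of 0]
  obtain \<sigma>0 :: "nat \<Rightarrow> ('a \<Rightarrow>\<^sub>L 'a) \<Rightarrow> ('a \<Rightarrow>\<^sub>L 'a)" where \<sigma>0: "\<And>i. simple_function borel (\<sigma>0 i)" "\<And>T. (\<lambda>i. \<sigma>0 i T) \<longlonglongrightarrow> T"
    by auto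
  \<comment> \<open>Values that would move \<open>w\<close> by \<open>\<rho> - r\<close> or more are
    replaced by 0, so that the translated supports stay in \<open>ball a \<rho>\<close>. At the
    limit this is invisible, since
    \<open>norm (\<tau> x w) \<le> norm w < \<rho> - r\<close>.\<close>
  define \<sigma> where "\<sigma> i T = (if norm (\<sigma>0 i T w) < \<rho> - r then \<sigma>0 i T else 0)" for i T
  have \<sigma>s: "simple_function borel (\<sigma> i)" for i
    unfolding \<sigma>_def using simple_function_compose1[OF \<sigma>0(1)[of i], of "\<lambda>S :: 'a \<Rightarrow>\<^sub>L 'a. if norm (blinfun_apply S w) < \<rho> - r then S else 0"] by simp
  have \<sigma>m[measurable]: "\<sigma> i \<in> borel_measurable borel" for i using \<sigma>s by (rule borel_measurable_simple_function)
  have \<sigma>l: "(\<lambda>i. \<sigma> i (\<tau> x)) \<longlonglongrightarrow> \<tau> x" for x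
  proof -
    have "(\<lambda>i. norm (\<sigma>0 i (\<tau> x) w)) \<longlonglongrightarrow> norm (\<tau> x w)"
      by (intro tendsto_norm bounded_bilinear.tendsto[OF bounded_bilinear_blinfun_apply] \<sigma>0(2) tendsto_const)
    moreover have "norm (\<tau> x w) < \<rho> - r" using norm_tau_le[of x w] w by linarith
    ultimately have "\<forall>\<^sub>F i in sequentially. norm (\<sigma>0 i (\<tau> x) w) < \<rho> - r" by (rule order_tendstoD(2))
    then have "\<forall>\<^sub>F i in sequentially. \<sigma>0 i (\<tau> x) = \<sigma> i (\<tau> x)" by eventually_elim (simp add: \<sigma>_def)
    then show ?thesis by (rule Lim_transform_eventually[OF \<sigma>0(2)])
  qed
  have \<sigma>b: "norm (\<sigma> i T w) < \<rho> - r" for i T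
  proof -
    have "0 < \<rho> - r" using w norm_ge_zero[of w] by linarith
    then show ?thesis by (simp add: \<sigma>_def)
  qed
  have mD: "(\<lambda>x. frechet_derivative \<psi> (at (x + s *\<^sub>R S x w)) (\<tau> x w)) \<in> borel_measurable borel"
    if [measurable]: "S \<in> borel_measurable borel" for S :: "'a \<Rightarrow> ('a \<Rightarrow>\<^sub>L 'a)"
    by (rule borel_measurable_frechet_derivative[OF \<psi>]) measurable
  have frozen: "(\<integral>x. indicator E (\<tau> x) * frechet_derivative \<psi> (at (x + s *\<^sub>R \<sigma> i (\<tau> x) w)) (\<tau> x w) \<partial>\<mu>)
      = (\<integral>x. indicator E (\<tau> x) * (\<psi> (x + s *\<^sub>R \<sigma> i (\<tau> x) w) * (w \<bullet> h x)) \<partial>\<mu>)" for i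
  proof -
    define Q where "Q = range (\<sigma> i)"
    have fQ: "finite Q" using simple_functionD(1)[OF \<sigma>s[of i]] by (simp add: Q_def)
    \<comment> \<open>On a level set of \<open>\<sigma> i\<close> the shift is a constant vector,
      and a test function translated by a constant is again a test function.\<close>
    define ES where "ES S = E \<inter> \<sigma> i -` {S}" for S
    have ESm[measurable]: "ES S \<in> sets borel" for S
      using simple_functionD(2)[OF \<sigma>s[of i], of "{S}"] E by (auto simp: ES_def)
    have decomp: "indicator E (\<tau> x) * f (\<sigma> i (\<tau> x)) = (\<Sum>S\<in>Q. indicator (ES S) (\<tau> x) * f S)" for x and f :: "('a \<Rightarrow>\<^sub>L 'a) \<Rightarrow> real"
    proof -
      have "(\<Sum>S\<in>Q. indicator (ES S) (\<tau> x) * f S) = (\<Sum>S\<in>Q. if S = \<sigma> i (\<tau> x) then indicator E (\<tau> x) * f S else 0)"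
        by (intro sum.cong) (auto simp: ES_def split: split_indicator)
      also have "\<dots> = indicator E (\<tau> x) * f (\<sigma> i (\<tau> x))" using fQ by (simp add: Q_def)
      finally show ?thesis by simp
    qed
    have "(\<integral>x. indicator E (\<tau> x) * frechet_derivative \<psi> (at (x + s *\<^sub>R \<sigma> i (\<tau> x) w)) (\<tau> x w) \<partial>\<mu>)
        = (\<integral>x. (\<Sum>S\<in>Q. indicator (ES S) (\<tau> x) * frechet_derivative \<psi> (at (x + s *\<^sub>R S w)) (\<tau> x w)) \<partial>\<mu>)"
      by (intro Bochner_Integration.integral_cong refl decomp)
    also have "\<dots> = (\<Sum>S\<in>Q. \<integral>x. indicator (ES S) (\<tau> x) * frechet_derivative \<psi> (at (x + s *\<^sub>R S w)) (\<tau> x w) \<partial>\<mu>)"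
    proof (rule Bochner_Integration.integral_sum)
      fix S :: "'a \<Rightarrow>\<^sub>L 'a"
      have "(\<lambda>x. frechet_derivative \<psi> (at (x + s *\<^sub>R S w)) (\<tau> x w)) \<in> borel_measurable borel" using mD[of "\<lambda>_. S"] by simp
      then show "integrable \<mu> (\<lambda>x. indicator (ES S) (\<tau> x) * frechet_derivative \<psi> (at (x + s *\<^sub>R S w)) (\<tau> x w))"
        using C' C(1) by (intro integrable_bounded[of _ "C * norm w"]) (auto split: split_indicator)
    qed
    also have "\<dots> = (\<Sum>S\<in>Q. \<integral>x. indicator (ES S) (\<tau> x) * (\<psi> (x + s *\<^sub>R S w) * (w \<bullet> h x)) \<partial>\<mu>)"
    proof (intro sum.cong refl)
      fix S :: "'a \<Rightarrow>\<^sub>L 'a" assume "S \<in> Q"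
      then have "norm (S w) < \<rho> - r" using \<sigma>b by (auto simp: Q_def)
      moreover have "norm (s *\<^sub>R S w) \<le> norm (S w)" using s by (simp add: mult_left_le_one_le)
      ultimately have nS: "norm (s *\<^sub>R S w) < \<rho> - r" by simp
      let ?K = "(\<lambda>y. y - s *\<^sub>R S w) ` K"
      have "(\<integral>x. indicator (ES S) (\<tau> x) * frechet_derivative (\<lambda>x. \<psi> (x + s *\<^sub>R S w)) (at x) (\<tau> x w) \<partial>\<mu>)
          = (\<integral>x. indicator (ES S) (\<tau> x) * (\<psi> (x + s *\<^sub>R S w) * (w \<bullet> h x)) \<partial>\<mu>)"
      proof (rule weak_indicator[OF smooth_map_shift[OF \<psi>]])
        show "compact ?K" by (intro compact_continuous_image continuous_intros K)
        show "?K \<subseteq> ball a \<rho>"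
        proof
          fix z assume "z \<in> ?K"
          then obtain y where y: "y \<in> K" "z = y - s *\<^sub>R S w" by blast
          have "dist a z \<le> dist a y + dist y z" by (rule dist_triangle)
          also have "dist y z = norm (s *\<^sub>R S w)" by (simp add: y dist_norm)
          also have "dist a y \<le> r" using y K(2) by auto
          finally show "z \<in> ball a \<rho>" using nS by simp
        qed
        show "\<psi> (x + s *\<^sub>R S w) = 0" if "x \<notin> ?K" for x
          using that by (intro K(3)) (auto simp: image_iff)
      qed (rule ESm)
      then show "(\<integral>x. indicator (ES S) (\<tau> x) * frechet_derivative \<psi> (at (x + s *\<^sub>R S w)) (\<tau> x w) \<partial>\<mu>)
          = (\<integral>x. indicator (ES S) (\<tau> x) * (\<psi> (x + s *\<^sub>R S w) * (w \<bullet> h x)) \<partial>\<mu>)"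
        by (simp only: frechet_derivative_shift[OF \<psi>])
    qed
    also have "\<dots> = (\<integral>x. (\<Sum>S\<in>Q. indicator (ES S) (\<tau> x) * (\<psi> (x + s *\<^sub>R S w) * (w \<bullet> h x))) \<partial>\<mu>)"
    proof (rule Bochner_Integration.integral_sum[symmetric])
      fix S :: "'a \<Rightarrow>\<^sub>L 'a"
      have "integrable \<mu> (\<lambda>x. (indicator (ES S) (\<tau> x) * \<psi> (x + s *\<^sub>R S w)) * (w \<bullet> h x))"
        using C2 by (intro integrable_bounded_mult_h[of _ C2]) (auto split: split_indicator)
      then show "integrable \<mu> (\<lambda>x. indicator (ES S) (\<tau> x) * (\<psi> (x + s *\<^sub>R S w) * (w \<bullet> h x)))" by (simp only: mult.assoc)
    qed
    also have "\<dots> = (\<integral>x. indicator E (\<tau> x) * (\<psi> (x + s *\<^sub>R \<sigma> i (\<tau> x) w) * (w \<bullet> h x)) \<partial>\<mu>)"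
      by (intro Bochner_Integration.integral_cong refl decomp[symmetric])
    finally show ?thesis .
  qed
  have pt: "(\<lambda>i. x + s *\<^sub>R \<sigma> i (\<tau> x) w) \<longlonglongrightarrow> x + s *\<^sub>R \<tau> x w" for x
    by (intro tendsto_intros bounded_bilinear.tendsto[OF bounded_bilinear_blinfun_apply] \<sigma>l tendsto_const)
  have l1: "(\<lambda>i. \<integral>x. indicator E (\<tau> x) * frechet_derivative \<psi> (at (x + s *\<^sub>R \<sigma> i (\<tau> x) w)) (\<tau> x w) \<partial>\<mu>)
      \<longlonglongrightarrow> (\<integral>x. indicator E (\<tau> x) * frechet_derivative \<psi> (at (x + s *\<^sub>R \<tau> x w)) (\<tau> x w) \<partial>\<mu>)"
  proof (rule integral_dominated_convergence[where w="\<lambda>x. C * norm w"])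
    have "(\<lambda>x. frechet_derivative \<psi> (at (x + s *\<^sub>R \<tau> x w)) (\<tau> x w)) \<in> borel_measurable borel" by (rule mD) simp
    then show "(\<lambda>x. indicator E (\<tau> x) * frechet_derivative \<psi> (at (x + s *\<^sub>R \<tau> x w)) (\<tau> x w)) \<in> borel_measurable \<mu>" by measurable
    have "(\<lambda>x. frechet_derivative \<psi> (at (x + s *\<^sub>R \<sigma> i (\<tau> x) w)) (\<tau> x w)) \<in> borel_measurable borel" for i by (rule mD) simp
    then show "(\<lambda>x. indicator E (\<tau> x) * frechet_derivative \<psi> (at (x + s *\<^sub>R \<sigma> i (\<tau> x) w)) (\<tau> x w)) \<in> borel_measurable \<mu>" for i by measurable
    show "AE x in \<mu>. (\<lambda>i. indicator E (\<tau> x) * frechet_derivative \<psi> (at (x + s *\<^sub>R \<sigma> i (\<tau> x) w)) (\<tau> x w))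
        \<longlonglongrightarrow> indicator E (\<tau> x) * frechet_derivative \<psi> (at (x + s *\<^sub>R \<tau> x w)) (\<tau> x w)"
    proof (intro AE_I2 tendsto_mult tendsto_const)
      fix x
      have "(\<lambda>i. frechet_derivative \<psi> (at (x + s *\<^sub>R \<sigma> i (\<tau> x) w)) j) \<longlonglongrightarrow> frechet_derivative \<psi> (at (x + s *\<^sub>R \<tau> x w)) j" for j
        using smooth_map_continuous[OF smooth_map_derivative[OF \<psi>, of j]] pt[of x]
        by (auto simp: continuous_on_eq_continuous_at intro: isCont_tendsto_compose)
      then show "(\<lambda>i. frechet_derivative \<psi> (at (x + s *\<^sub>R \<sigma> i (\<tau> x) w)) (\<tau> x w)) \<longlonglongrightarrow> frechet_derivative \<psi> (at (x + s *\<^sub>R \<tau> x w)) (\<tau> x w)"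
        unfolding frechet_derivative_basis_sum[OF \<psi>, of _ "\<tau> x w"] by (intro tendsto_intros)
    qed
    show "AE x in \<mu>. norm (indicator E (\<tau> x) * frechet_derivative \<psi> (at (x + s *\<^sub>R \<sigma> i (\<tau> x) w)) (\<tau> x w)) \<le> C * norm w" for i
      using C' C(1) by (intro AE_I2) (auto split: split_indicator)
  qed simp
  have l2: "(\<lambda>i. \<integral>x. indicator E (\<tau> x) * (\<psi> (x + s *\<^sub>R \<sigma> i (\<tau> x) w) * (w \<bullet> h x)) \<partial>\<mu>)
      \<longlonglongrightarrow> (\<integral>x. indicator E (\<tau> x) * (\<psi> (x + s *\<^sub>R \<tau> x w) * (w \<bullet> h x)) \<partial>\<mu>)"
  proof (rule integral_dominated_convergence[where w="\<lambda>x. C2 * \<bar>w \<bullet> h x\<bar>"])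
    show "AE x in \<mu>. (\<lambda>i. indicator E (\<tau> x) * (\<psi> (x + s *\<^sub>R \<sigma> i (\<tau> x) w) * (w \<bullet> h x))) \<longlonglongrightarrow> indicator E (\<tau> x) * (\<psi> (x + s *\<^sub>R \<tau> x w) * (w \<bullet> h x))"
      using smooth_map_continuous[OF \<psi>] pt
      by (intro AE_I2 tendsto_mult tendsto_const) (auto simp: continuous_on_eq_continuous_at intro: isCont_tendsto_compose)
    show "integrable \<mu> (\<lambda>x. C2 * \<bar>w \<bullet> h x\<bar>)" using integrable_bounded_mult_h[of "\<lambda>_. 1" 1 w] by auto
    show "AE x in \<mu>. norm (indicator E (\<tau> x) * (\<psi> (x + s *\<^sub>R \<sigma> i (\<tau> x) w) * (w \<bullet> h x))) \<le> C2 * \<bar>w \<bullet> h x\<bar>" for i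
      using C2 by (intro AE_I2) (auto simp: abs_mult split: split_indicator intro: mult_right_mono)
  qed measurable
  show ?thesis using LIMSEQ_unique[OF l1] l2 unfolding frozen by blast
qed

abbreviation "line_measure \<equiv> \<mu> \<Otimes>\<^sub>M unit_lborel"

text \<open>The three terms of the fundamental theorem of calculus along the segment from \<open>x\<close> to \<open>x + \<tau> x w\<close>,
  as integrals of the same shape.\<close>

definition seg :: "nat \<Rightarrow> 'a \<times> real \<Rightarrow> real" where
  "seg i z = (if i = 0 then 1 else if i = 1 then 0 else snd z)"

definition wt :: "'a \<Rightarrow> nat \<Rightarrow> 'a \<times> real \<Rightarrow> real" where
  "wt w i z = (if i = 0 then 1 else if i = 1 then - 1 else - (w \<bullet> h (fst z)))"

lemma measurable_seg [measurable]: "seg i \<in> borel_measurable (borel \<Otimes>\<^sub>M borel)"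
  unfolding seg_def by measurable

lemma measurable_wt [measurable]: "wt w i \<in> borel_measurable (borel \<Otimes>\<^sub>M borel)"
  unfolding wt_def by measurable

lemma sets_line_measure: "sets line_measure = sets (borel \<Otimes>\<^sub>M borel)"
  by (intro sets_pair_measure_cong sets_mu sets_unit_lborel)

lemma line_measurableI: "f \<in> borel_measurable (borel \<Otimes>\<^sub>M borel) \<Longrightarrow> f \<in> borel_measurable line_measure"
  using measurable_cong_sets[OF sets_line_measure refl] by blast

lemma pair_sigma_finite_line: "pair_sigma_finite \<mu> unit_lborel"
proof -
  interpret ul: finite_measure unit_lborel by (rule finite_measure_unit_lborel)
  show ?thesis ..
qed

lemma finite_line_measure: "finite_measure line_measure"
proof -
  interpret ul: finite_measure unit_lborel by (rule finite_measure_unit_lborel)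
  interpret pair_sigma_finite \<mu> unit_lborel by (rule pair_sigma_finite_line)
  show ?thesis
  proof (rule finite_measureI)
    have "emeasure line_measure (UNIV \<times> UNIV) = emeasure \<mu> UNIV * emeasure unit_lborel UNIV"
      by (rule ul.emeasure_pair_measure_Times) (auto simp: sets_mu)
    then show "emeasure line_measure (space line_measure) \<noteq> \<infinity>"
      using fin by (simp add: space_pair_measure space_mu emeasure_unit_lborel)
  qed
qed

lemma integrable_line_fst:
  fixes f :: "'a \<Rightarrow> real"
  assumes "integrable \<mu> f" shows "integrable line_measure (\<lambda>z. f (fst z))"
proof -
  interpret ul: finite_measure unit_lborel by (rule finite_measure_unit_lborel)
  interpret pair_sigma_finite \<mu> unit_lborel by (rule pair_sigma_finite_line)
  have [measurable]: "f \<in> borel_measurable \<mu>" using assms by auto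
  show ?thesis
  proof (rule integrableI_bounded)
    have "(\<integral>\<^sup>+z. ennreal (norm (f (fst z))) \<partial>line_measure) = (\<integral>\<^sup>+x. \<integral>\<^sup>+s. ennreal (norm (f x)) \<partial>unit_lborel \<partial>\<mu>)"
      by (subst ul.nn_integral_fst[symmetric]) auto
    also have "\<dots> = (\<integral>\<^sup>+x. ennreal (norm (f x)) \<partial>\<mu>)" by (simp add: emeasure_unit_lborel)
    also have "\<dots> < \<infinity>" using assms by (simp add: integrable_iff_bounded)
    finally show "(\<integral>\<^sup>+z. ennreal (norm (f (fst z))) \<partial>line_measure) < \<infinity>" .
  qed measurable
qed

lemma integrable_wt:
  "integrable line_measure (wt w i)"
proof -
  interpret fl: finite_measure line_measure by (rule finite_line_measure)
  have "integrable line_measure (\<lambda>z. w \<bullet> h (fst z))"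
    using integrable_line_fst[OF integrable_bounded_mult_h[of "\<lambda>_. 1" 1 w]] by simp
  then show ?thesis by (cases "i = 0"; cases "i = 1") (auto simp: wt_def[abs_def])
qed

lemma integral_line_fst:
  fixes f :: "'a \<Rightarrow> real"
  assumes "integrable \<mu> f" shows "(\<integral>z. f (fst z) \<partial>line_measure) = (\<integral>x. f x \<partial>\<mu>)"
proof -
  interpret pair_sigma_finite \<mu> unit_lborel by (rule pair_sigma_finite_line)
  have "(\<integral>z. f (fst z) \<partial>line_measure) = (\<integral>x. (\<integral>s. f x \<partial>unit_lborel) \<partial>\<mu>)"
    using integral_fst'[OF integrable_line_fst[OF assms]] by simp
  then show ?thesis by (simp only: integral_unit_lborel_const)
qed

text \<open>For fixed \<open>x\<close> the fundamental theorem of calculus writes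
  \<open>\<psi> (x + \<tau> x w) - \<psi> x\<close> as an integral over \<open>s\<close>; Fubini
  exchanges the two integrations, and \<open>weak_shift\<close> replaces the derivative by
  \<open>h\<close> for each \<open>s\<close>.\<close>

lemma weak_line:
  assumes \<psi>: "smooth_map \<psi>" and K: "compact K" "K \<subseteq> cball a r" "\<And>x. x \<notin> K \<Longrightarrow> \<psi> x = 0"
    and E: "E \<in> sets borel" and w: "r + norm w < \<rho>"
  shows "(\<Sum>i<3. \<integral>z. indicator E (\<tau> (fst z)) * \<psi> (fst z + seg i z *\<^sub>R \<tau> (fst z) w) * wt w i z \<partial>line_measure) = 0"
proof -
  interpret ul: finite_measure unit_lborel by (rule finite_measure_unit_lborel)
  interpret pair_sigma_finite \<mu> unit_lborel by (rule pair_sigma_finite_line)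
  interpret fl: finite_measure line_measure by (rule finite_line_measure)
  note [measurable] = E
  have [measurable]: "\<psi> \<in> borel_measurable borel"
    using smooth_map_continuous[OF \<psi>] by (rule borel_measurable_continuous_onI)
  obtain C where C: "0 \<le> C" "\<And>x v. \<bar>frechet_derivative \<psi> (at x) v\<bar> \<le> C * norm v"
    by (rule frechet_derivative_bounded[OF \<psi> K(1)], erule K(3), rule that)
  have C': "\<bar>frechet_derivative \<psi> (at y) (\<tau> x w)\<bar> \<le> C * norm w" for x y
    using C(2)[of y "\<tau> x w"] mult_left_mono[OF norm_tau_le C(1), of x w] by linarith
  obtain C2 where C2: "0 \<le> C2" "\<And>x. \<bar>\<psi> x\<bar> \<le> C2"
    by (rule continuous_compact_support_bounded[OF smooth_map_continuous[OF \<psi>] K(1)], erule K(3), rule that)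
  define D where "D x s = indicator E (\<tau> x) * frechet_derivative \<psi> (at (x + s *\<^sub>R \<tau> x w)) (\<tau> x w)" for x s
  define G where "G x s = indicator E (\<tau> x) * (\<psi> (x + s *\<^sub>R \<tau> x w) * (w \<bullet> h x))" for x s
  have "(\<lambda>z. frechet_derivative \<psi> (at (fst z + snd z *\<^sub>R \<tau> (fst z) w)) (\<tau> (fst z) w)) \<in> borel_measurable (borel \<Otimes>\<^sub>M borel)"
    by (rule borel_measurable_frechet_derivative[OF \<psi>]) measurable
  then have "(\<lambda>z. D (fst z) (snd z)) \<in> borel_measurable (borel \<Otimes>\<^sub>M borel)" unfolding D_def by measurable
  then have Dm: "case_prod D \<in> borel_measurable line_measure"
    by (intro line_measurableI) (simp add: case_prod_beta')
  have Di: "integrable line_measure (case_prod D)"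
    by (rule fl.integrable_const_bound[OF _ Dm, of "C * norm w"])
       (use C' C(1) in \<open>auto simp: D_def split: split_indicator\<close>)
  have "(\<lambda>z. G (fst z) (snd z)) \<in> borel_measurable (borel \<Otimes>\<^sub>M borel)" unfolding G_def by measurable
  then have Gm: "case_prod G \<in> borel_measurable line_measure"
    by (intro line_measurableI) (simp add: case_prod_beta')
  have ih: "integrable line_measure (\<lambda>z. C2 * \<bar>w \<bullet> h (fst z)\<bar>)"
    using integrable_line_fst[OF integrable_bounded_mult_h[of "\<lambda>_. 1" 1 w]] by simp
  have Gi: "integrable line_measure (case_prod G)"
    by (rule Bochner_Integration.integrable_bound[OF ih Gm])
       (use C2 in \<open>auto simp: G_def case_prod_beta' abs_mult split: split_indicator intro!: AE_I2 mult_right_mono\<close>)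
  have i0: "integrable \<mu> (\<lambda>x. indicator E (\<tau> x) * \<psi> (x + \<tau> x w))" "integrable \<mu> (\<lambda>x. indicator E (\<tau> x) * \<psi> x)"
    using C2 by (auto intro!: integrable_bounded[of _ C2] split: split_indicator)
  have ftc: "(\<integral>s. D x s \<partial>unit_lborel) = indicator E (\<tau> x) * \<psi> (x + \<tau> x w) - indicator E (\<tau> x) * \<psi> x" for x
  proof -
    have m: "(\<lambda>s. frechet_derivative \<psi> (at (x + s *\<^sub>R \<tau> x w)) (\<tau> x w)) \<in> borel_measurable borel"
      by (rule borel_measurable_frechet_derivative[OF \<psi>]) measurable
    have der: "((\<lambda>s. \<psi> (x + s *\<^sub>R \<tau> x w)) has_real_derivative frechet_derivative \<psi> (at (x + s *\<^sub>R \<tau> x w)) (\<tau> x w)) (at s)" for s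
    proof -
      have "((\<lambda>s. x + s *\<^sub>R \<tau> x w) has_derivative (\<lambda>t. t *\<^sub>R \<tau> x w)) (at s)"
        by (auto intro!: derivative_eq_intros)
      from has_derivative_compose[OF this smooth_map_has_derivative[OF \<psi>]]
      have "((\<lambda>s. \<psi> (x + s *\<^sub>R \<tau> x w)) has_derivative (\<lambda>t. frechet_derivative \<psi> (at (x + s *\<^sub>R \<tau> x w)) (t *\<^sub>R \<tau> x w))) (at s)" .
      moreover have "frechet_derivative \<psi> (at (x + s *\<^sub>R \<tau> x w)) (t *\<^sub>R \<tau> x w) = frechet_derivative \<psi> (at (x + s *\<^sub>R \<tau> x w)) (\<tau> x w) * t" for t
        using linear_scale[OF has_derivative_linear[OF smooth_map_has_derivative[OF \<psi>]]] by (simp add: mult.commute)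
      ultimately show ?thesis by (simp add: has_field_derivative_def)
    qed
    have "(\<integral>s. D x s \<partial>unit_lborel) = (\<integral>s. indicator {0..1} s *\<^sub>R D x s \<partial>lborel)"
    proof -
      have u: "unit_lborel = density lborel (\<lambda>s. ennreal (indicator {0..1} s))"
        by (simp add: unit_lborel_def ennreal_indicator)
      show ?thesis unfolding u using m by (intro integral_density) (auto simp: D_def)
    qed
    also have "\<dots> = indicator E (\<tau> x) * (\<integral>s. frechet_derivative \<psi> (at (x + s *\<^sub>R \<tau> x w)) (\<tau> x w) * indicator {0..1} s \<partial>lborel)"
      by (subst integral_mult_right_zero[symmetric]) (auto simp: D_def ac_simps intro!: Bochner_Integration.integral_cong)
    also have "(\<integral>s. frechet_derivative \<psi> (at (x + s *\<^sub>R \<tau> x w)) (\<tau> x w) * indicator {0..1} s \<partial>lborel) = \<psi> (x + 1 *\<^sub>R \<tau> x w) - \<psi> (x + 0 *\<^sub>R \<tau> x w)"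
    proof (rule integral_FTC_Icc_real)
      show "(0::real) \<le> 1" by simp
      fix s :: real
      show "((\<lambda>s. \<psi> (x + s *\<^sub>R \<tau> x w)) has_real_derivative frechet_derivative \<psi> (at (x + s *\<^sub>R \<tau> x w)) (\<tau> x w)) (at s)" by (rule der)
      have c: "isCont (\<lambda>s. frechet_derivative \<psi> (at (x + s *\<^sub>R \<tau> x w)) j) s" for j
      proof -
        have c1: "isCont (\<lambda>s. x + s *\<^sub>R \<tau> x w) s" by (intro continuous_intros)
        have c2: "isCont (\<lambda>y. frechet_derivative \<psi> (at y) j) (x + s *\<^sub>R \<tau> x w)"
          using smooth_map_continuous[OF smooth_map_derivative[OF \<psi>, of j]]
          by (simp add: continuous_on_eq_continuous_at)
        show ?thesis by (rule isCont_o2[OF c1 c2])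
      qed
      show "isCont (\<lambda>s. frechet_derivative \<psi> (at (x + s *\<^sub>R \<tau> x w)) (\<tau> x w)) s"
        unfolding frechet_derivative_basis_sum[OF \<psi>, of _ "\<tau> x w"]
        by (intro continuous_sum continuous_mult continuous_const c)
    qed
    finally show ?thesis by (simp add: right_diff_distrib)
  qed
  have eq: "(\<integral>x. indicator E (\<tau> x) * \<psi> (x + \<tau> x w) \<partial>\<mu>) - (\<integral>x. indicator E (\<tau> x) * \<psi> x \<partial>\<mu>) = (\<integral>z. case_prod G z \<partial>line_measure)"
  proof -
    have "(\<integral>x. indicator E (\<tau> x) * \<psi> (x + \<tau> x w) \<partial>\<mu>) - (\<integral>x. indicator E (\<tau> x) * \<psi> x \<partial>\<mu>) = (\<integral>x. (\<integral>s. D x s \<partial>unit_lborel) \<partial>\<mu>)"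
      unfolding ftc using i0 by simp
    also have "\<dots> = (\<integral>s. (\<integral>x. D x s \<partial>\<mu>) \<partial>unit_lborel)"
      using Fubini_integral[OF Di] by simp
    \<comment> \<open>\<open>weak_shift\<close> is available for \<open>s\<close> between 0 and 1
      only, that is for almost every \<open>s\<close> under \<open>unit_lborel\<close>.\<close>
    also have "\<dots> = (\<integral>s. (\<integral>x. G x s \<partial>\<mu>) \<partial>unit_lborel)"
    proof (rule integral_cong_AE)
      show "AE s in unit_lborel. (\<integral>x. D x s \<partial>\<mu>) = (\<integral>x. G x s \<partial>\<mu>)"
        using AE_unit_lborel
      proof eventually_elim
        case (elim s)
        then show ?case unfolding D_def G_def by (intro weak_shift[OF \<psi> K E w]) auto
      qed
      show "(\<lambda>s. \<integral>x. D x s \<partial>\<mu>) \<in> borel_measurable unit_lborel"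
        using borel_measurable_integrable[OF integrable_snd[OF Di]] .
      show "(\<lambda>s. \<integral>x. G x s \<partial>\<mu>) \<in> borel_measurable unit_lborel"
        using borel_measurable_integrable[OF integrable_snd[OF Gi]] .
    qed
    also have "\<dots> = (\<integral>z. case_prod G z \<partial>line_measure)"
      using integral_snd[OF Gi] by simp
    finally show ?thesis .
  qed
  have "(\<Sum>i<3. \<integral>z. indicator E (\<tau> (fst z)) * \<psi> (fst z + seg i z *\<^sub>R \<tau> (fst z) w) * wt w i z \<partial>line_measure)
      = (\<integral>z. indicator E (\<tau> (fst z)) * \<psi> (fst z + \<tau> (fst z) w) \<partial>line_measure) - (\<integral>z. indicator E (\<tau> (fst z)) * \<psi> (fst z) \<partial>line_measure)
        - (\<integral>z. case_prod G z \<partial>line_measure)"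
    by (simp add: eval_nat_numeral seg_def wt_def G_def case_prod_beta' mult.assoc)
  also have "\<dots> = 0"
    using eq integral_line_fst[OF i0(1)] integral_line_fst[OF i0(2)] by simp
  finally show ?thesis .
qed

text \<open>Two generator arguments: positions first, from smooth functions to Borel sets, then
  pairs of projection and position, from rectangles to Borel sets of the product. Joint sets are
  needed because the sets used later couple a projection with the affine plane through the
  position.\<close>

lemma weak_line_borel:
  assumes S: "S \<in> sets (borel \<Otimes>\<^sub>M borel)" and w: "r + norm w < \<rho>"
  shows "(\<Sum>i<3. \<integral>z. indicator S (\<tau> (fst z), fst z + seg i z *\<^sub>R \<tau> (fst z) w)
      * (indicator (ball a r) (fst z + seg i z *\<^sub>R \<tau> (fst z) w) * wt w i z) \<partial>line_measure) = 0"
proof -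
  let ?y = "\<lambda>i z. fst z + seg i z *\<^sub>R \<tau> (fst z) w"
  have [measurable]: "ball a r \<in> sets borel" by simp
  have ym: "?y i \<in> borel_measurable line_measure" for i
    by (rule line_measurableI) measurable
  have \<tau>m: "(\<lambda>z. \<tau> (fst z)) \<in> borel_measurable line_measure"
    by (rule line_measurableI) measurable
  have wm: "wt w i \<in> borel_measurable line_measure" for i by (rule line_measurableI) measurable
  have ik: "integrable line_measure (\<lambda>z. indicator E (\<tau> (fst z)) * (indicator (ball a r) (?y i z) * wt w i z))"
    if [measurable]: "E \<in> sets borel" for i E
    by (rule Bochner_Integration.integrable_bound[OF integrable_wt[of w i]])
       (use ym[of i] \<tau>m wm[of i] in \<open>auto split: split_indicator\<close>)
  \<comment> \<open>Restricting to \<open>ball a r\<close> makes the smooth approximations vanish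
    outside \<open>cball a r\<close>, as \<open>weak_line\<close> demands.\<close>
  have rect: "(\<Sum>i<3. \<integral>z. indicator F (?y i z) * (indicator E (\<tau> (fst z)) * (indicator (ball a r) (?y i z) * wt w i z)) \<partial>line_measure) = 0"
    if E[measurable]: "E \<in> sets borel" and F: "F \<in> sets borel" for E F
  proof (rule dynkin_signed[where X=borel and G=smooth_sets])
    show "sets borel \<subseteq> sigma_sets UNIV (smooth_sets :: 'a set set)" by (rule sigma_sets_smooth_sets)
    show "Int_stable (smooth_sets :: 'a set set)" by (rule Int_stable_smooth_sets)
    show "UNIV \<in> (smooth_sets :: 'a set set)" by (rule smooth_sets_UNIV)
    fix F :: "'a set" assume F: "F \<in> smooth_sets"
    show Fb[measurable]: "F \<in> sets borel" using open_smooth_sets[OF F] by auto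
    obtain \<psi> where \<psi>: "smooth_inner_approx (F \<inter> ball a r) \<psi>"
      using smooth_sets_Int[OF F smooth_sets_ball] by (auto simp: smooth_sets_def)
    have \<psi>m: "\<psi> n \<in> borel_measurable borel" for n
      using \<psi> smooth_map_continuous by (auto simp: smooth_inner_approx_def intro!: borel_measurable_continuous_onI)
    have z: "(\<Sum>i<3. \<integral>z. indicator E (\<tau> (fst z)) * \<psi> n (?y i z) * wt w i z \<partial>line_measure) = 0" for n
    proof (rule weak_line[of "\<psi> n" "cball a r"])
      show "\<psi> n x = 0" if "x \<notin> cball a r" for x
        using \<psi> that ball_subset_cball by (auto simp: smooth_inner_approx_def)
    qed (use \<psi> E w in \<open>auto simp: smooth_inner_approx_def\<close>)
    have "(\<lambda>n. \<Sum>i<3. \<integral>z. indicator E (\<tau> (fst z)) * \<psi> n (?y i z) * wt w i z \<partial>line_measure)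
        \<longlonglongrightarrow> (\<Sum>i<3. \<integral>z. indicator E (\<tau> (fst z)) * indicator (F \<inter> ball a r) (?y i z) * wt w i z \<partial>line_measure)"
    proof (intro tendsto_sum)
      fix i
      show "(\<lambda>n. \<integral>z. indicator E (\<tau> (fst z)) * \<psi> n (?y i z) * wt w i z \<partial>line_measure)
        \<longlonglongrightarrow> (\<integral>z. indicator E (\<tau> (fst z)) * indicator (F \<inter> ball a r) (?y i z) * wt w i z \<partial>line_measure)"
      proof (rule integral_dominated_convergence[where w="\<lambda>z. norm (wt w i z)"])
        show "(\<lambda>z. indicator E (\<tau> (fst z)) * indicator (F \<inter> ball a r) (?y i z) * wt w i z) \<in> borel_measurable line_measure"
          using ym[of i] \<tau>m wm[of i] by measurable
        show "(\<lambda>z. indicator E (\<tau> (fst z)) * \<psi> n (?y i z) * wt w i z) \<in> borel_measurable line_measure" for n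
          using ym[of i] \<tau>m wm[of i] \<psi>m[of n] by measurable
        show "AE z in line_measure. (\<lambda>n. indicator E (\<tau> (fst z)) * \<psi> n (?y i z) * wt w i z)
            \<longlonglongrightarrow> indicator E (\<tau> (fst z)) * indicator (F \<inter> ball a r) (?y i z) * wt w i z"
          using \<psi> by (intro AE_I2 tendsto_mult tendsto_const) (auto simp: smooth_inner_approx_def)
        show "AE z in line_measure. norm (indicator E (\<tau> (fst z)) * \<psi> n (?y i z) * wt w i z) \<le> norm (wt w i z)" for n
          using \<psi> by (intro AE_I2) (auto simp: smooth_inner_approx_def abs_mult split: split_indicator intro!: mult_left_le_one_le)
      qed (use integrable_wt in auto)
    qed
    then have "(\<Sum>i<3. \<integral>z. indicator E (\<tau> (fst z)) * indicator (F \<inter> ball a r) (?y i z) * wt w i z \<partial>line_measure) = 0"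
      by (simp only: z LIMSEQ_const_iff)
    then show "(\<Sum>i<3. \<integral>z. indicator F (?y i z) * (indicator E (\<tau> (fst z)) * (indicator (ball a r) (?y i z) * wt w i z)) \<partial>line_measure) = 0"
      by (simp only: indicator_inter_arith ac_simps)
  qed (use ik[OF E] ym F in auto)
  show ?thesis
  proof (rule dynkin_signed[where X="borel \<Otimes>\<^sub>M borel" and G="{E \<times> F | E F. E \<in> sets borel \<and> F \<in> sets borel}"])
    show "(\<lambda>z. (\<tau> (fst z), ?y i z)) \<in> line_measure \<rightarrow>\<^sub>M borel \<Otimes>\<^sub>M borel" for i
      using \<tau>m ym by measurable
    show "integrable line_measure (\<lambda>z. indicator (ball a r) (?y i z) * wt w i z)" for i
      using ik[of UNIV i] by simp
    show "sets (borel \<Otimes>\<^sub>M borel) \<subseteq> sigma_sets UNIV {E \<times> F | E F. E \<in> sets (borel :: ('a \<Rightarrow>\<^sub>L 'a) measure) \<and> F \<in> sets (borel :: 'a measure)}"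
      by (simp add: sets_pair_measure)
    show "Int_stable {E \<times> F | E F. E \<in> sets (borel :: ('a \<Rightarrow>\<^sub>L 'a) measure) \<and> F \<in> sets (borel :: 'a measure)}"
      by (rule Int_stable_pair_measure_generator)
    show "UNIV \<in> {E \<times> F | E F. E \<in> sets (borel :: ('a \<Rightarrow>\<^sub>L 'a) measure) \<and> F \<in> sets (borel :: 'a measure)}"
      by (auto intro!: exI[of _ UNIV])
    fix Q assume "Q \<in> {E \<times> F | E F. E \<in> sets (borel :: ('a \<Rightarrow>\<^sub>L 'a) measure) \<and> F \<in> sets (borel :: 'a measure)}"
    then obtain E F where Q: "Q = E \<times> F" "E \<in> sets borel" "F \<in> sets borel" by blast
    show "Q \<in> sets (borel \<Otimes>\<^sub>M borel)" using Q by auto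
    show "(\<Sum>i<3. \<integral>z. indicator Q (\<tau> (fst z), ?y i z) * (indicator (ball a r) (?y i z) * wt w i z) \<partial>line_measure) = 0"
      using rect[OF Q(2,3)] by (simp only: Q(1) indicator_times fst_conv snd_conv ac_simps)
  qed (use S in \<open>auto simp: space_pair_measure\<close>)
qed

text \<open>The difference of the two masses is the average over the segment of integrals of
  \<open>w \<bullet> h\<close> over shifted sets. The bound \<open>\<epsilon>\<close> is a parameter
  because it is used both with the full integral of \<open>norm h\<close> and with a small value
  from absolute continuity.\<close>

lemma shift_bound:
  assumes S: "S \<in> sets (borel \<Otimes>\<^sub>M borel)" "S \<subseteq> UNIV \<times> ball a r" and w: "r + norm w < \<rho>"
    and e: "\<And>s. 0 \<le> s \<Longrightarrow> s \<le> 1 \<Longrightarrow> (\<integral>x. indicator S (\<tau> x, x + s *\<^sub>R \<tau> x w) * norm (h x) \<partial>\<mu>) \<le> \<epsilon>"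
  shows "\<bar>measure \<mu> {x. (\<tau> x, x + \<tau> x w) \<in> S} - measure \<mu> {x. (\<tau> x, x) \<in> S}\<bar> \<le> norm w * \<epsilon>"
proof -
  interpret ul: finite_measure unit_lborel by (rule finite_measure_unit_lborel)
  interpret pair_sigma_finite \<mu> unit_lborel by (rule pair_sigma_finite_line)
  note [measurable] = S(1)
  have b: "indicator S (\<tau> x, y) * (indicator (ball a r) y * c) = indicator S (\<tau> x, y) * (c :: real)" for x y c
    using S(2) by (auto split: split_indicator)
  define G where "G x s = indicator S (\<tau> x, x + s *\<^sub>R \<tau> x w) * (w \<bullet> h x)" for x s
  have Gm: "(\<lambda>z. G (fst z) (snd z)) \<in> borel_measurable (borel \<Otimes>\<^sub>M borel)" unfolding G_def by measurable
  have ih: "integrable line_measure (\<lambda>z. \<bar>w \<bullet> h (fst z)\<bar>)"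
    using integrable_line_fst[OF integrable_bounded_mult_h[of "\<lambda>_. 1" 1 w]] by simp
  have Gi: "integrable line_measure (case_prod G)"
    by (rule Bochner_Integration.integrable_bound[OF ih])
       (use line_measurableI[OF Gm] in \<open>auto simp: G_def case_prod_beta' split: split_indicator\<close>)
  have i0: "integrable \<mu> (\<lambda>x. indicator S (\<tau> x, x + \<tau> x w) :: real)" "integrable \<mu> (\<lambda>x. indicator S (\<tau> x, x) :: real)"
    by (auto intro!: integrable_bounded[of _ 1] split: split_indicator)
  have "0 = (\<integral>z. indicator S (\<tau> (fst z), fst z + \<tau> (fst z) w) \<partial>line_measure) - (\<integral>z. indicator S (\<tau> (fst z), fst z) \<partial>line_measure)
      - (\<integral>z. case_prod G z \<partial>line_measure)"
    using weak_line_borel[OF S(1) w] unfolding b by (simp add: eval_nat_numeral seg_def wt_def G_def case_prod_beta')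
  then have "(\<integral>x. indicator S (\<tau> x, x + \<tau> x w) \<partial>\<mu>) - (\<integral>x. indicator S (\<tau> x, x) \<partial>\<mu>) = (\<integral>z. case_prod G z \<partial>line_measure)"
    using integral_line_fst[OF i0(1)] integral_line_fst[OF i0(2)] by simp
  moreover have "(\<integral>x. indicator S (\<tau> x, x + \<tau> x w) \<partial>\<mu>) = measure \<mu> {x. (\<tau> x, x + \<tau> x w) \<in> S}"
  proof -
    have [measurable]: "{x. (\<tau> x, x + \<tau> x w) \<in> S} \<in> sets \<mu>" unfolding sets_mu by measurable
    have "(\<integral>x. indicator S (\<tau> x, x + \<tau> x w) \<partial>\<mu>) = (\<integral>x. indicator {x. (\<tau> x, x + \<tau> x w) \<in> S} x \<partial>\<mu> :: real)"
      by (intro Bochner_Integration.integral_cong) (auto split: split_indicator)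
    then show ?thesis by (simp add: space_mu)
  qed
  moreover have "(\<integral>x. indicator S (\<tau> x, x) \<partial>\<mu>) = measure \<mu> {x. (\<tau> x, x) \<in> S}"
  proof -
    have [measurable]: "{x. (\<tau> x, x) \<in> S} \<in> sets \<mu>" unfolding sets_mu by measurable
    have "(\<integral>x. indicator S (\<tau> x, x) \<partial>\<mu>) = (\<integral>x. indicator {x. (\<tau> x, x) \<in> S} x \<partial>\<mu> :: real)"
      by (intro Bochner_Integration.integral_cong) (auto split: split_indicator)
    then show ?thesis by (simp add: space_mu)
  qed
  moreover have "\<bar>\<integral>z. case_prod G z \<partial>line_measure\<bar> \<le> norm w * \<epsilon>"
  proof -
    have "(\<integral>z. case_prod G z \<partial>line_measure) = (\<integral>s. (\<integral>x. G x s \<partial>\<mu>) \<partial>unit_lborel)"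
      using integral_snd[OF Gi] by simp
    then have "\<bar>\<integral>z. case_prod G z \<partial>line_measure\<bar> \<le> (\<integral>s. \<bar>\<integral>x. G x s \<partial>\<mu>\<bar> \<partial>unit_lborel)"
      using integral_abs_bound by metis
    also have "\<dots> \<le> (\<integral>s. norm w * \<epsilon> \<partial>unit_lborel)"
    proof (rule integral_mono_AE)
      show "integrable unit_lborel (\<lambda>s. \<bar>\<integral>x. G x s \<partial>\<mu>\<bar>)" using integrable_snd[OF Gi] by auto
      show "AE s in unit_lborel. \<bar>\<integral>x. G x s \<partial>\<mu>\<bar> \<le> norm w * \<epsilon>"
        using AE_unit_lborel
      proof eventually_elim
        case (elim s)
        have ii: "integrable \<mu> (\<lambda>x. norm w * (indicator S (\<tau> x, x + s *\<^sub>R \<tau> x w) * norm (h x)))"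
        proof -
          have "integrable \<mu> (\<lambda>x. indicator S (\<tau> x, x + s *\<^sub>R \<tau> x w) * norm (h x))"
            by (rule Bochner_Integration.integrable_bound[OF integrable_norm[OF h_int]]) (auto split: split_indicator)
          then show ?thesis by auto
        qed
        have "\<bar>\<integral>x. G x s \<partial>\<mu>\<bar> \<le> (\<integral>x. \<bar>G x s\<bar> \<partial>\<mu>)" by (rule integral_abs_bound)
        also have "\<dots> \<le> (\<integral>x. norm w * (indicator S (\<tau> x, x + s *\<^sub>R \<tau> x w) * norm (h x)) \<partial>\<mu>)"
        proof (rule integral_mono_AE'[OF ii])
          show "AE x in \<mu>. \<bar>G x s\<bar> \<le> norm w * (indicator S (\<tau> x, x + s *\<^sub>R \<tau> x w) * norm (h x))"
            by (intro AE_I2) (auto simp: G_def Cauchy_Schwarz_ineq2 split: split_indicator)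
        qed (auto split: split_indicator)
        also have "\<dots> = norm w * (\<integral>x. indicator S (\<tau> x, x + s *\<^sub>R \<tau> x w) * norm (h x) \<partial>\<mu>)" by simp
        also have "\<dots> \<le> norm w * \<epsilon>" using e[of s] elim by (intro mult_left_mono) auto
        finally show ?case .
      qed
    qed (use ul.integrable_const in auto)
    also have "\<dots> = norm w * \<epsilon>" by (rule integral_unit_lborel_const)
    finally show ?thesis .
  qed
  ultimately show ?thesis by simp
qed

end

section \<open>Hausdorff measure on planes as Haar measure\<close>

lemma distr_HB_translate:
  assumes m: "1 \<le> m"
  shows "distr (HB m) borel ((+) c) = (HB m :: 'a::euclidean_space measure)"
proof (rule measure_eqI)
  fix X :: "'a set" assume "X \<in> sets (distr (HB m) borel ((+) c))"
  then have X: "X \<in> sets borel" by simp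
  have pre: "(+) c -` X = (+) (- c) ` X"
  proof (intro set_eqI iffI)
    fix x assume "x \<in> (+) c -` X"
    then have "c + x \<in> X" by simp
    then have "- c + (c + x) \<in> (+) (- c) ` X" by (rule imageI)
    then show "x \<in> (+) (- c) ` X" by simp
  qed auto
  have pb: "(+) c -` X \<in> sets borel" using measurable_sets[of "(+) c" borel borel X] X by simp
  have "emeasure (distr (HB m) borel ((+) c)) X = emeasure (HB m) ((+) c -` X)"
    using X by (subst emeasure_distr) auto
  also have "\<dots> = Hm m ((+) c -` X)" using pb by (rule emeasure_HB[OF m])
  also have "\<dots> = Hm m X" unfolding pre by (rule Hm_translate)
  finally show "emeasure (distr (HB m) borel ((+) c)) X = emeasure (HB m) X" using X by (simp add: emeasure_HB[OF m])
qed simp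

lemma nn_integral_HB_translate:
  assumes m: "1 \<le> m" and f: "f \<in> borel_measurable borel"
  shows "(\<integral>\<^sup>+x. f (c + x) \<partial>HB m) = (\<integral>\<^sup>+x. f x \<partial>(HB m :: 'a::euclidean_space measure))"
  by (subst (2) distr_HB_translate[OF m, symmetric, of c]) (use f in \<open>simp add: nn_integral_distr\<close>)

lemma emeasure_HB_translate:
  assumes m: "1 \<le> m" and X: "X \<in> sets borel"
  shows "emeasure (HB m) {x. c + x \<in> X} = emeasure (HB m) (X :: 'a::euclidean_space set)"
proof -
  have [measurable]: "X \<in> sets borel" by fact
  have b: "{x. c + x \<in> X} \<in> sets borel" by measurable
  have "emeasure (HB m) {x. c + x \<in> X} = (\<integral>\<^sup>+x. indicator {x. c + x \<in> X} x \<partial>HB m)"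
    using b by simp
  also have "\<dots> = (\<integral>\<^sup>+x. indicator X (c + x) \<partial>HB m)"
    by (intro nn_integral_cong) (auto split: split_indicator)
  also have "\<dots> = emeasure (HB m) X" using X by (simp add: nn_integral_HB_translate[OF m])
  finally show ?thesis .
qed

definition plane_measure :: "nat \<Rightarrow> 'a::euclidean_space set \<Rightarrow> 'a measure" where
  "plane_measure m A = density (HB m) (indicator A)"

lemma sets_plane_measure [simp, measurable_cong]: "sets (plane_measure m A) = sets borel"
  by (simp add: plane_measure_def)

lemma space_plane_measure [simp]: "space (plane_measure m A) = UNIV"
  by (simp add: plane_measure_def)

lemma emeasure_plane_measure:
  assumes "A \<in> sets borel" "X \<in> sets borel"
  shows "emeasure (plane_measure m A) X = emeasure (HB m) (X \<inter> A)"
proof -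
  have "emeasure (plane_measure m A) X = (\<integral>\<^sup>+x. indicator A x * indicator X x \<partial>HB m)"
    unfolding plane_measure_def using assms by (intro emeasure_density) auto
  also have "\<dots> = (\<integral>\<^sup>+x. indicator (X \<inter> A) x \<partial>HB m)"
    by (intro nn_integral_cong) (auto split: split_indicator)
  finally show ?thesis using assms by simp
qed

lemma nn_integral_plane_measure:
  assumes [measurable]: "A \<in> sets borel" "f \<in> borel_measurable borel"
  shows "(\<integral>\<^sup>+x. f x \<partial>plane_measure m A) = (\<integral>\<^sup>+x. indicator A x * f x \<partial>HB m)"
  unfolding plane_measure_def by (rule nn_integral_density) measurable

lemma borel_plane: "P \<in> Grass m \<Longrightarrow> (+) p ` P \<in> sets borel"
  by (intro borel_closed closed_plane)

text \<open>For \<open>m < DIM('a)\<close> the measure \<open>HB m\<close> is not sigma-finite on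
  the whole space; restricted to a plane it is, which opens the way to Fubini.\<close>

lemma sigma_finite_plane_measure:
  fixes P :: "'a::euclidean_space set"
  assumes P: "P \<in> Grass m" and m: "1 \<le> m"
  shows "sigma_finite_measure (plane_measure m ((+) p ` P))"
proof
  let ?M = "plane_measure m ((+) p ` P)"
  have "emeasure ?M (ball 0 (real k)) \<noteq> \<infinity>" for k
  proof -
    have "emeasure ?M (ball 0 (real k)) = Hm m (ball 0 (real k) \<inter> (+) p ` P)"
      using borel_plane[OF P, of p] by (simp add: emeasure_plane_measure emeasure_HB[OF m])
    also have "\<dots> < top" using Hm_plane_ball_finite[OF P m, of p 0 "real k"] by (simp add: Int_commute)
    finally show ?thesis by simp
  qed
  moreover have "(\<Union>k. ball 0 (real k)) = (UNIV :: 'a set)" using reals_Archimedean2 by auto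
  ultimately show "\<exists>A. countable A \<and> A \<subseteq> sets ?M \<and> \<Union> A = space ?M \<and> (\<forall>a\<in>A. emeasure ?M a \<noteq> \<infinity>)"
    by (intro exI[of _ "range (\<lambda>k. ball 0 (real k))"]) auto
qed

lemma subspace_translate_eq:
  assumes "subspace P" "p \<in> P" shows "(+) p ` P = P"
proof (intro set_eqI iffI)
  fix x assume "x \<in> P"
  then have "p + (x - p) \<in> (+) p ` P" using assms subspace_diff by (intro imageI) blast
  then show "x \<in> (+) p ` P" by simp
qed (use assms subspace_add in blast)

text \<open>Comparing \<open>\<integral>\<integral> 1\<^sub>N (p + orth_proj P w)\<close> over \<open>P\<close> and the whole space in both orders gives
  \<open>\<infinity> * H (N \<inter> P) = H P * L {w. orth_proj P w \<in> N}\<close>.\<close>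

lemma plane_null_iff_cylinder_null:
  fixes P N :: "'a::euclidean_space set"
  assumes P: "P \<in> Grass m" and m: "1 \<le> m" and N: "N \<in> sets borel"
  shows "emeasure (HB m) (N \<inter> (+) x ` P) = 0 \<longleftrightarrow> emeasure lborel {w. x + orth_proj P w \<in> N} = 0"
proof -
  let ?M = "plane_measure m P"
  have sP: "subspace P" using P by (simp add: Grass_def)
  have Pb[measurable]: "P \<in> sets borel" using closed_subspace[OF sP] by auto
  note [measurable] = N
  have P0: "(+) 0 ` P = P" by simp
  interpret pm: sigma_finite_measure ?M using sigma_finite_plane_measure[OF P m, of 0] unfolding P0 .
  interpret pair_sigma_finite lborel ?M ..
  \<comment> \<open>Moves the base point \<open>x\<close> to the origin.\<close>
  define N' where "N' = {q. x + q \<in> N}"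
  have N'b[measurable]: "N' \<in> sets borel" unfolding N'_def by measurable
  have s1: "emeasure ?M {p. v + p \<in> N'} = emeasure ?M N'" if "v \<in> P" for v
  proof -
    have b: "{p. v + p \<in> N'} \<in> sets borel" by measurable
    have "{p. v + p \<in> N'} \<inter> P = {p. v + p \<in> N' \<inter> P}"
      using that sP subspace_add[of P v] subspace_diff[of P _ v] by (auto simp: add_diff_cancel_left') (metis add_diff_cancel_left')
    then have "emeasure ?M {p. v + p \<in> N'} = emeasure (HB m) {p. v + p \<in> N' \<inter> P}"
      using b by (simp add: emeasure_plane_measure)
    also have "\<dots> = emeasure (HB m) (N' \<inter> P)" by (rule emeasure_HB_translate[OF m]) auto
    finally show ?thesis by (simp add: emeasure_plane_measure)
  qed
  have "(\<integral>\<^sup>+w. (\<integral>\<^sup>+p. indicator N' (orth_proj P w + p) \<partial>?M) \<partial>lborel) = (\<integral>\<^sup>+p. (\<integral>\<^sup>+w. indicator N' (orth_proj P w + p) \<partial>lborel) \<partial>?M)"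
    by (rule Fubini'[symmetric]) measurable
  also have "(\<integral>\<^sup>+w. (\<integral>\<^sup>+p. indicator N' (orth_proj P w + p) \<partial>?M) \<partial>lborel) = (\<integral>\<^sup>+w. emeasure ?M N' \<partial>(lborel :: 'a measure))"
  proof (intro nn_integral_cong)
    fix w :: 'a
    have b: "{p. orth_proj P w + p \<in> N'} \<in> sets borel" by measurable
    have "(\<integral>\<^sup>+p. indicator N' (orth_proj P w + p) \<partial>?M) = (\<integral>\<^sup>+p. indicator {p. orth_proj P w + p \<in> N'} p \<partial>?M)"
      by (intro nn_integral_cong) (auto split: split_indicator)
    also have "\<dots> = emeasure ?M {p. orth_proj P w + p \<in> N'}" using b by (intro nn_integral_indicator) simp
    finally show "(\<integral>\<^sup>+p. indicator N' (orth_proj P w + p) \<partial>?M) = emeasure ?M N'" using s1[OF orth_proj_works(1)[OF sP]] by simp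
  qed
  also have "\<dots> = emeasure ?M N' * top" by (simp add: emeasure_lborel_UNIV)
  also have "(\<integral>\<^sup>+p. (\<integral>\<^sup>+w. indicator N' (orth_proj P w + p) \<partial>lborel) \<partial>?M) = (\<integral>\<^sup>+p. emeasure lborel {w. orth_proj P w \<in> N'} \<partial>?M)"
  proof (rule nn_integral_cong_AE)
    \<comment> \<open>For \<open>p\<close> in \<open>P\<close> the summand \<open>p\<close> equals
      \<open>orth_proj P p\<close> and is absorbed by translating \<open>w\<close>, so invariance of
      Lebesgue measure makes the inner integral independent of \<open>p\<close>.\<close>
    have "AE p in ?M. p \<in> P" unfolding plane_measure_def by (subst AE_density) (auto simp: indicator_def)
    then show "AE p in ?M. (\<integral>\<^sup>+w. indicator N' (orth_proj P w + p) \<partial>lborel) = emeasure lborel {w. orth_proj P w \<in> N'}"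
    proof eventually_elim
      case (elim p)
      have b: "{w. orth_proj P w \<in> N'} \<in> sets borel" by measurable
      have "(\<integral>\<^sup>+w. indicator N' (orth_proj P w + p) \<partial>lborel) = (\<integral>\<^sup>+w. indicator {w. orth_proj P w \<in> N'} (p + w) \<partial>lborel)"
        using orth_proj_in_id[OF sP elim] by (intro nn_integral_cong) (auto simp: blinfun.add_right add.commute split: split_indicator)
      also have "\<dots> = (\<integral>\<^sup>+w. indicator {w. orth_proj P w \<in> N'} w \<partial>distr lborel borel ((+) p))"
        using b by (subst nn_integral_distr) auto
      also have "\<dots> = emeasure lborel {w. orth_proj P w \<in> N'}" using b by (simp add: lborel_distr_plus)
      finally show ?case .
    qed
  qed
  also have "\<dots> = emeasure lborel {w. orth_proj P w \<in> N'} * emeasure ?M UNIV" by simp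
  finally have eq: "emeasure ?M N' * top = emeasure lborel {w. orth_proj P w \<in> N'} * emeasure ?M UNIV" .
  \<comment> \<open>A zero right-hand factor would make the identity vacuous in one direction; the
    mass of a plane is positive by the ball estimate.\<close>
  have pos: "emeasure ?M UNIV \<noteq> 0"
  proof -
    have "ennreal (plane_const m * 1 ^ m) \<le> Hm m ((+) 0 ` P \<inter> ball 0 1)" by (rule Hm_plane_ball_ge[OF P m]) simp
    also have "\<dots> \<le> Hm m P" unfolding P0 by (rule Hm_mono) auto
    also have "\<dots> = emeasure ?M UNIV" by (simp add: emeasure_plane_measure emeasure_HB[OF m])
    finally show ?thesis using plane_const_pos[of m] by (auto simp: ennreal_eq_0_iff)
  qed
  have "emeasure (HB m) (N \<inter> (+) x ` P) = emeasure ?M N'"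
  proof -
    have "N' \<inter> P = {q. x + q \<in> N \<inter> (+) x ` P}" by (auto simp: N'_def)
    then show ?thesis using emeasure_HB_translate[OF m, of "N \<inter> (+) x ` P" x] borel_plane[OF P, of x]
      by (simp add: emeasure_plane_measure)
  qed
  moreover have "{w. orth_proj P w \<in> N'} = {w. x + orth_proj P w \<in> N}" by (simp add: N'_def)
  ultimately show ?thesis using eq pos by (auto simp: ennreal_mult_eq_top_iff)
qed

text \<open>Null intersections make the masses of finitely many of the sets add up, so
  \<open>card F * \<epsilon>\<close> never exceeds the total mass.\<close>

lemma finite_almost_disjoint:
  assumes M: "finite_measure M" and Q: "\<And>i. i \<in> J \<Longrightarrow> Q i \<in> sets M" "\<And>i. i \<in> J \<Longrightarrow> \<epsilon> \<le> measure M (Q i)"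
    and d: "\<And>i j. i \<in> J \<Longrightarrow> j \<in> J \<Longrightarrow> i \<noteq> j \<Longrightarrow> measure M (Q i \<inter> Q j) = 0" and e: "0 < \<epsilon>"
  shows "finite J"
proof (rule ccontr)
  interpret finite_measure M by fact
  assume inf: "infinite J"
  have sumle: "real (card F) * \<epsilon> \<le> measure M (\<Union>i\<in>F. Q i)" if "finite F" "F \<subseteq> J" for F
    using that
  proof (induction F)
    case empty then show ?case by simp
  next
    case (insert i F)
    have U: "(\<Union>i\<in>F. Q i) \<in> sets M" using insert Q(1) by (intro sets.finite_UN) auto
    have Qi: "Q i \<in> sets M" using insert Q(1) by auto
    have "measure M (Q i \<inter> (\<Union>j\<in>F. Q j)) \<le> (\<Sum>j\<in>F. measure M (Q i \<inter> Q j))"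
      unfolding Int_UN_distrib using insert Q(1) by (intro measure_UNION_le) auto
    also have "\<dots> = 0" using insert d by (intro sum.neutral) auto
    finally have "measure M (Q i \<inter> (\<Union>j\<in>F. Q j)) = 0" using measure_nonneg[of M] by (simp add: antisym)
    then have "measure M (Q i \<union> (\<Union>j\<in>F. Q j)) = measure M (Q i) + measure M (\<Union>j\<in>F. Q j)"
    proof -
      have dj: "(Q i - (\<Union>j\<in>F. Q j)) \<inter> (\<Union>j\<in>F. Q j) = {}" by blast
      show ?thesis
        using finite_measure_Diff'[OF Qi U] finite_measure_Union[OF sets.Diff[OF Qi U] U dj]
          \<open>measure M (Q i \<inter> (\<Union>j\<in>F. Q j)) = 0\<close> by (simp add: Un_Diff_cancel2)
    qed
    moreover have "\<epsilon> \<le> measure M (Q i)" using insert Q(2) by auto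
    moreover have "real (card F) * \<epsilon> \<le> measure M (\<Union>j\<in>F. Q j)" using insert by auto
    moreover have "real (card (insert i F)) * \<epsilon> = real (card F) * \<epsilon> + \<epsilon>" using insert by (simp add: algebra_simps)
    ultimately show ?case by simp
  qed
  obtain n :: nat where n: "measure M (space M) / \<epsilon> < real n" using reals_Archimedean2 by blast
  obtain F where F: "finite F" "card F = n" "F \<subseteq> J" using infinite_arbitrarily_large[OF inf] by blast
  have "real n * \<epsilon> \<le> measure M (\<Union>i\<in>F. Q i)" using sumle[OF F(1,3)] F(2) by simp
  also have "\<dots> \<le> measure M (space M)" by (rule bounded_measure)
  finally show False using n e by (simp add: field_simps)
qed

lemma integrable_absolutely_continuous:
  fixes g :: "'x \<Rightarrow> real"
  assumes g: "integrable M g" "\<And>x. 0 \<le> g x" and e: "0 < e"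
  obtains \<delta> where "0 < \<delta>" "\<And>X. X \<in> sets M \<Longrightarrow> emeasure M X \<le> ennreal \<delta> \<Longrightarrow> (\<integral>x. indicator X x * g x \<partial>M) \<le> e"
proof -
  have [measurable]: "g \<in> borel_measurable M" using g by auto
  have "(\<lambda>n. \<integral>x. indicator {x. real n < g x} x * g x \<partial>M) \<longlonglongrightarrow> (\<integral>x. 0 \<partial>M)"
  proof (rule integral_dominated_convergence[where w=g])
    show "AE x in M. (\<lambda>n. indicator {x. real n < g x} x * g x) \<longlonglongrightarrow> 0"
    proof (rule AE_I2)
      fix x
      obtain n0 where n0: "g x < real n0" using reals_Archimedean2 by blast
      have "\<forall>\<^sub>F n in sequentially. indicator {x. real n < g x} x * g x = 0"
        unfolding eventually_sequentially using n0 by (intro exI[of _ n0]) (auto simp: indicator_def)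
      then show "(\<lambda>n. indicator {x. real n < g x} x * g x) \<longlonglongrightarrow> 0" by (rule tendsto_eventually)
    qed
    show "AE x in M. norm (indicator {x. real n < g x} x * g x) \<le> g x" for n
      using g(2) by (intro AE_I2) (auto split: split_indicator)
    show "(\<lambda>x. indicator {x. real n < g x} x * g x) \<in> borel_measurable M" for n
    proof -
      have "(\<lambda>x. indicator {x. real n < g x} x * g x) = (\<lambda>x. if real n < g x then g x else 0)"
        by (auto simp: fun_eq_iff)
      then show ?thesis by simp
    qed
  qed (use g in auto)
  then have "\<forall>\<^sub>F n in sequentially. (\<integral>x. indicator {x. real n < g x} x * g x \<partial>M) < e / 2"
    using e by (intro order_tendstoD(2)[of _ "\<integral>x. 0 \<partial>M"]) auto
  then obtain n where n: "(\<integral>x. indicator {x. real n < g x} x * g x \<partial>M) < e / 2" by (auto simp: eventually_sequentially)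
  have i1: "integrable M (\<lambda>x. indicator {x. real n < g x} x * g x)"
  proof (rule Bochner_Integration.integrable_bound[OF g(1)])
    have "(\<lambda>x. indicator {x. real n < g x} x * g x) = (\<lambda>x. if real n < g x then g x else 0)"
      by (auto simp: fun_eq_iff)
    then show "(\<lambda>x. indicator {x. real n < g x} x * g x) \<in> borel_measurable M" by simp
  qed (auto split: split_indicator)
  show ?thesis
  \<comment> \<open>The part of \<open>g\<close> above height \<open>n\<close> integrates to less
    than \<open>e / 2\<close>, and below it the integral is at most \<open>n\<close> times the
    measure; \<open>n + 1\<close> avoids division by zero.\<close>
  proof (rule that[of "e / (2 * (real n + 1))"])
    show "0 < e / (2 * (real n + 1))" using e by simp
    fix X assume X[measurable]: "X \<in> sets M" and eX: "emeasure M X \<le> ennreal (e / (2 * (real n + 1)))"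
    have fX: "emeasure M X < \<infinity>" using eX by (auto simp: le_less_trans)
    have mX: "measure M X \<le> e / (2 * (real n + 1))" using eX e by (simp add: measure_def enn2real_leI)
    have i2: "integrable M (\<lambda>x. real n * indicator X x)" using fX by auto
    have "(\<integral>x. indicator X x * g x \<partial>M) \<le> (\<integral>x. indicator {x. real n < g x} x * g x + real n * indicator X x \<partial>M)"
    proof (rule integral_mono)
      show "integrable M (\<lambda>x. indicator X x * g x)"
        by (rule Bochner_Integration.integrable_bound[OF g(1)]) (auto split: split_indicator)
      show "integrable M (\<lambda>x. indicator {x. real n < g x} x * g x + real n * indicator X x)" using i1 i2 by auto
    qed (use g(2) in \<open>auto split: split_indicator\<close>)
    also have "\<dots> = (\<integral>x. indicator {x. real n < g x} x * g x \<partial>M) + real n * measure M X"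
      using i1 i2 X by simp
    also have "real n * measure M X \<le> e / 2"
    proof -
      have "real n * measure M X \<le> (real n + 1) * (e / (2 * (real n + 1)))" using mX e by (intro mult_mono) auto
      also have "\<dots> = e / 2" by (simp add: field_simps)
      finally show ?thesis .
    qed
    finally show "(\<integral>x. indicator X x * g x \<partial>M) \<le> e" using n by simp
  qed
qed

section \<open>Planes carrying mass: countability, constant multiplicity, finiteness\<close>

lemma nn_integral_lborel_translate:
  assumes "f \<in> borel_measurable borel"
  shows "(\<integral>\<^sup>+x. f (c + x) \<partial>lborel) = (\<integral>\<^sup>+x. f x \<partial>(lborel :: 'a::euclidean_space measure))"
  by (subst (2) lborel_distr_plus[symmetric, of c]) (use assms in \<open>simp add: nn_integral_distr\<close>)

text \<open>Adds what the translation estimates alone do not know: the mass has an integer density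
  of at least 1 over Hausdorff measure on a single set.\<close>

locale flat_varifold = flat_measure +
  fixes R :: "'a set" and \<theta> :: "'a \<Rightarrow> nat"
  assumes R_meas [measurable]: "R \<in> sets borel"
    and theta_meas [measurable]: "\<theta> \<in> borel \<rightarrow>\<^sub>M count_space UNIV"
    and theta_pos: "\<And>x. x \<in> R \<Longrightarrow> 1 \<le> \<theta> x"
    and mu_eq: "\<mu> = density (HB m) (\<lambda>x. indicator R x * ennreal (real (\<theta> x)))"
begin

lemma density_meas: "(\<lambda>x. indicator R x * ennreal (real (\<theta> x))) \<in> borel_measurable (HB m)"
  by measurable

lemma emeasure_mu:
  "X \<in> sets borel \<Longrightarrow> emeasure \<mu> X = (\<integral>\<^sup>+x. indicator R x * ennreal (real (\<theta> x)) * indicator X x \<partial>HB m)"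
  unfolding mu_eq by (rule emeasure_density[OF density_meas]) simp

lemma AE_mu_iff: "(AE x in \<mu>. Q x) \<longleftrightarrow> (AE x in HB m. x \<in> R \<longrightarrow> Q x)"
proof -
  have "0 < indicator R x * ennreal (real (\<theta> x)) \<longleftrightarrow> x \<in> R" for x
    using theta_pos[of x] by (auto split: split_indicator)
  then show ?thesis unfolding mu_eq AE_density[OF density_meas] by simp
qed

lemma HB_R_finite: "emeasure (HB m) R < top"
proof -
  have "emeasure (HB m) R = (\<integral>\<^sup>+x. indicator R x \<partial>HB m)" by simp
  also have "\<dots> \<le> (\<integral>\<^sup>+x. indicator R x * ennreal (real (\<theta> x)) * indicator UNIV x \<partial>HB m)"
    using theta_pos by (intro nn_integral_mono) (auto split: split_indicator)
  also have "\<dots> = emeasure \<mu> UNIV" by (rule emeasure_mu[symmetric]) simp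
  finally show ?thesis using fin by simp
qed

text \<open>Translating by a random small vector along \<open>\<tau>\<close> changes \<open>\<mu>\<close> little in total variation, but would push
  \<open>\<mu>\<close> off \<open>R\<close> on the set where the tangent plane meets \<open>R\<close> in a null set.\<close>

lemma AE_cylinder_pos:
  assumes r: "r < \<rho>"
  shows "AE x in \<mu>. x \<in> ball a r \<longrightarrow> emeasure lborel {w. x + \<tau> x w \<in> R} \<noteq> 0"
proof -
  have bm[measurable]: "ball a r \<in> sets borel" by simp
  \<comment> \<open>Counting directions \<open>w\<close> by Lebesgue measure of the ambient space,
    instead of Hausdorff measure on the plane itself, makes this jointly measurable as a parameter
    integral.\<close>
  define cyl where "cyl q = (\<integral>\<^sup>+w. indicator R (snd q + blinfun_apply (fst q) w) \<partial>lborel)" for q :: "('a \<Rightarrow>\<^sub>L 'a) \<times> 'a"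
  have [measurable]: "cyl \<in> borel_measurable (borel \<Otimes>\<^sub>M borel)" unfolding cyl_def by measurable
  define S where "S = {q \<in> space (borel \<Otimes>\<^sub>M borel). cyl q = 0 \<and> snd q \<in> ball a r \<and> snd q \<in> R}"
  have S[measurable]: "S \<in> sets (borel \<Otimes>\<^sub>M borel)" unfolding S_def by measurable
  have S_iff: "(T, x) \<in> S \<longleftrightarrow> cyl (T, x) = 0 \<and> x \<in> ball a r \<and> x \<in> R" for T x
    by (simp add: S_def space_pair_measure)
  define H where "H = (\<integral>x. norm (h x) \<partial>\<mu>)"
  have H: "0 \<le> H" by (simp add: H_def)
  define \<eta> where "\<eta> = measure \<mu> {x. (\<tau> x, x) \<in> S}"
  have "\<eta> = 0"
  proof (rule ccontr)
    assume "\<eta> \<noteq> 0"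
    then have \<eta>: "0 < \<eta>" using measure_nonneg[of \<mu>] by (simp add: \<eta>_def less_le)
    \<comment> \<open>The first bound keeps the translations inside the ball of radius
      \<open>\<rho>\<close>; the second makes the loss \<open>norm w * H\<close> at most half of
      \<open>\<eta>\<close>, with \<open>H + 1\<close> to allow \<open>H = 0\<close>.\<close>
    define \<delta> where "\<delta> = min ((\<rho> - r) / 2) (\<eta> / (2 * (H + 1)))"
    have \<delta>: "0 < \<delta>" using r \<eta> H by (simp add: \<delta>_def)
    have [measurable]: "ball (0::'a) \<delta> \<in> sets borel" by simp
    interpret pair_sigma_finite lborel \<mu> ..
    have low: "ennreal (\<eta> / 2) \<le> emeasure \<mu> {x. (\<tau> x, x + \<tau> x w) \<in> S}" if w: "w \<in> ball 0 \<delta>" for w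
    proof -
      have nw: "norm w < \<delta>" using w by simp
      then have rw: "r + norm w < \<rho>" using r by (simp add: \<delta>_def)
      have "\<bar>measure \<mu> {x. (\<tau> x, x + \<tau> x w) \<in> S} - measure \<mu> {x. (\<tau> x, x) \<in> S}\<bar> \<le> norm w * H"
      proof (rule shift_bound[OF S _ rw])
        show "S \<subseteq> UNIV \<times> ball a r" by (auto simp: S_def)
        show "(\<integral>x. indicator S (\<tau> x, x + s *\<^sub>R \<tau> x w) * norm (h x) \<partial>\<mu>) \<le> H" for s
          unfolding H_def by (rule integral_mono_AE'[OF integrable_norm[OF h_int]]) (auto split: split_indicator)
      qed
      moreover have "norm w * H \<le> \<eta> / 2"
      proof -
        have "norm w * H \<le> (\<eta> / (2 * (H + 1))) * (H + 1)" using nw H \<eta> by (intro mult_mono) (auto simp: \<delta>_def)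
        also have "\<dots> = \<eta> / 2" using H by (simp add: field_simps)
        finally show ?thesis .
      qed
      ultimately have "\<eta> / 2 \<le> measure \<mu> {x. (\<tau> x, x + \<tau> x w) \<in> S}" unfolding \<eta>_def[symmetric] by linarith
      then show ?thesis by (simp add: mu.emeasure_eq_measure ennreal_leI)
    qed
    have "ennreal (\<eta> / 2) * emeasure lborel (ball (0::'a) \<delta>) = (\<integral>\<^sup>+w. ennreal (\<eta> / 2) * indicator (ball 0 \<delta>) w \<partial>(lborel :: 'a measure))"
      by (simp add: nn_integral_cmult_indicator)
    also have "\<dots> \<le> (\<integral>\<^sup>+w. (\<integral>\<^sup>+x. indicator S (\<tau> x, x + \<tau> x w) \<partial>\<mu>) \<partial>lborel)"
    proof (intro nn_integral_mono)
      fix w :: 'a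
      have b: "{x. (\<tau> x, x + \<tau> x w) \<in> S} \<in> sets \<mu>" unfolding sets_mu by measurable
      have "(\<integral>\<^sup>+x. indicator S (\<tau> x, x + \<tau> x w) \<partial>\<mu>) = (\<integral>\<^sup>+x. indicator {x. (\<tau> x, x + \<tau> x w) \<in> S} x \<partial>\<mu>)"
        by (intro nn_integral_cong) (auto split: split_indicator)
      also have "\<dots> = emeasure \<mu> {x. (\<tau> x, x + \<tau> x w) \<in> S}" using b by simp
      finally show "ennreal (\<eta> / 2) * indicator (ball 0 \<delta>) w \<le> (\<integral>\<^sup>+x. indicator S (\<tau> x, x + \<tau> x w) \<partial>\<mu>)"
        using low[of w] by (auto split: split_indicator)
    qed
    also have "\<dots> = (\<integral>\<^sup>+x. (\<integral>\<^sup>+w. indicator S (\<tau> x, x + \<tau> x w) \<partial>lborel) \<partial>\<mu>)"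
      by (rule Fubini'[symmetric]) measurable
    also have "\<dots> = (\<integral>\<^sup>+x. 0 \<partial>\<mu>)"
    proof (intro nn_integral_cong)
      fix x
      show "(\<integral>\<^sup>+w. indicator S (\<tau> x, x + \<tau> x w) \<partial>lborel) = 0"
      proof (cases "\<exists>w0. (\<tau> x, x + \<tau> x w0) \<in> S")
        case False then show ?thesis by (simp add: indicator_def)
      next
        \<comment> \<open>If some translate of \<open>x\<close> lands in \<open>S\<close>, the
          cylinder based there is null. Translating \<open>w\<close> by \<open>w0\<close> shows that
          the cylinder based at \<open>x\<close> is null as well, so almost no \<open>w\<close>
          leads into \<open>R\<close>, let alone into \<open>S\<close>.\<close>
        case True
        then obtain w0 where w0: "(\<tau> x, x + \<tau> x w0) \<in> S" by blast
        have "(\<integral>\<^sup>+w. indicator S (\<tau> x, x + \<tau> x w) \<partial>lborel) \<le> (\<integral>\<^sup>+w. indicator R (x + \<tau> x w) \<partial>lborel)"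
          by (intro nn_integral_mono) (auto simp: S_iff split: split_indicator)
        also have "\<dots> = (\<integral>\<^sup>+w. indicator R (x + \<tau> x (w0 + w)) \<partial>lborel)"
          by (rule nn_integral_lborel_translate[symmetric]) measurable
        also have "\<dots> = cyl (\<tau> x, x + \<tau> x w0)" by (simp add: cyl_def blinfun.add_right add.assoc)
        also have "\<dots> = 0" using w0 by (simp add: S_iff)
        finally show ?thesis by simp
      qed
    qed
    finally have "ennreal (\<eta> / 2) * emeasure lborel (ball (0::'a) \<delta>) = 0" by simp
    moreover have "emeasure lborel (ball (0::'a) \<delta>) \<noteq> 0"
      using \<delta> unit_ball_vol_nat_neq_0[of "DIM('a)"] by (simp add: emeasure_ball ennreal_eq_0_iff mult_le_0_iff not_le)
    ultimately show False using \<eta> by simp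
  qed
  moreover have b: "{x. (\<tau> x, x) \<in> S} \<in> sets \<mu>" unfolding sets_mu by measurable
  ultimately have "{x. (\<tau> x, x) \<in> S} \<in> null_sets \<mu>" by (simp add: \<eta>_def null_sets_def mu.emeasure_eq_measure)
  then have "AE x in \<mu>. (\<tau> x, x) \<notin> S" by (auto dest: AE_not_in)
  moreover have "AE x in \<mu>. x \<in> R" unfolding AE_mu_iff by simp
  ultimately show ?thesis
  proof eventually_elim
    case (elim x)
    have b: "{w. x + \<tau> x w \<in> R} \<in> sets lborel" by measurable
    have "cyl (\<tau> x, x) = (\<integral>\<^sup>+w. indicator {w. x + \<tau> x w \<in> R} w \<partial>lborel)"
      unfolding cyl_def by (intro nn_integral_cong) (auto split: split_indicator)
    also have "\<dots> = emeasure lborel {w. x + \<tau> x w \<in> R}" using b by (rule nn_integral_indicator)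
    finally show ?case using elim by (auto simp: S_iff)
  qed
qed

definition rich_planes :: "'a set set" where
  "rich_planes = {A. (\<exists>P\<in>Grass m. \<exists>p. A = (+) p ` P) \<and> emeasure (HB m) (R \<inter> A) \<noteq> 0}"

text \<open>\<open>R\<close> has finite Hausdorff measure and different planes overlap in null sets,
  so only finitely many planes reach any given threshold.\<close>

lemma countable_rich_planes: "countable rich_planes"
proof -
  let ?M = "plane_measure m R"
  have M: "finite_measure ?M"
    by (rule finite_measureI) (use HB_R_finite in \<open>simp add: emeasure_plane_measure\<close>)
  interpret fm: finite_measure ?M by (rule M)
  define F where "F n = {A \<in> rich_planes. 1 / real (Suc n) \<le> measure ?M A}" for n
  have Ab: "A \<in> sets borel" if "A \<in> rich_planes" for A using that borel_plane by (auto simp: rich_planes_def)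
  have "finite (F n)" for n
  proof (rule finite_almost_disjoint[OF M, where Q="\<lambda>A. A" and \<epsilon>="1 / real (Suc n)"])
    fix A B assume AB: "A \<in> F n" "B \<in> F n" "A \<noteq> B"
    then have b: "A \<in> sets borel" "B \<in> sets borel" using Ab by (auto simp: F_def)
    obtain P p where P1: "P \<in> Grass m" "A = (+) p ` P" using AB(1) unfolding F_def rich_planes_def by blast
    obtain P' p' where P2: "P' \<in> Grass m" "B = (+) p' ` P'" using AB(2) unfolding F_def rich_planes_def by blast
    have "emeasure ?M (A \<inter> B) \<le> Hm m (A \<inter> B)"
      using b by (simp add: emeasure_plane_measure emeasure_HB[OF m]) (rule Hm_mono, blast)
    also have "\<dots> = 0" using Hm_plane_Int_null[OF P1(1) P2(1) _ m] P1(2) P2(2) AB(3) by simp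
    finally show "measure ?M (A \<inter> B) = 0" by (simp add: measure_def)
  qed (auto simp: F_def intro: Ab)
  then have "countable (\<Union>n. F n)" by (auto intro: countable_finite)
  moreover have "rich_planes \<subseteq> (\<Union>n. F n)"
  proof
    fix A assume A: "A \<in> rich_planes"
    then have "emeasure ?M A \<noteq> 0" using Ab[OF A] by (simp add: emeasure_plane_measure Int_commute rich_planes_def)
    then have "0 < measure ?M A" using measure_nonneg[of ?M A] by (auto simp: fm.emeasure_eq_measure less_le)
    then obtain n where "1 / real (Suc n) < measure ?M A" using nat_approx_posE by blast
    then have "A \<in> F n" using A by (simp add: F_def)
    then show "A \<in> (\<Union>n. F n)" by blast
  qed
  ultimately show ?thesis by (rule countable_subset[rotated])
qed

text \<open>The density of the mass with tangent direction \<open>P\<close>, extended by 0 so that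
  its translates can be compared everywhere, also at points off \<open>R\<close>.\<close>

definition mult :: "'a set \<Rightarrow> 'a \<Rightarrow> nat" where
  "mult P x = (if x \<in> R \<and> \<tau> x = orth_proj P then \<theta> x else 0)"

lemma mult_meas [measurable]: "mult P \<in> borel \<rightarrow>\<^sub>M count_space UNIV"
  unfolding mult_def by measurable

lemma real_mult_meas: "(\<lambda>x. real (mult P x)) \<in> borel_measurable borel"
  by measurable

lemma emeasure_mult:
  assumes [measurable]: "X \<in> sets borel"
  shows "emeasure \<mu> {x \<in> X. \<tau> x = orth_proj P} = (\<integral>\<^sup>+x. indicator X x * ennreal (real (mult P x)) \<partial>HB m)"
proof -
  have b: "{x \<in> X. \<tau> x = orth_proj P} \<in> sets borel" by measurable
  show ?thesis unfolding emeasure_mu[OF b]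
    by (intro nn_integral_cong) (auto simp: mult_def split: split_indicator)
qed

text \<open>For \<open>w\<close> in \<open>P\<close> and points with projection
  \<open>orth_proj P\<close> the shift is the plain translation by \<open>w\<close>.\<close>

lemma shift_bound_plane:
  assumes P: "P \<in> Grass m" and X[measurable]: "X \<in> sets borel" and Xb: "X \<subseteq> ball a r" and w: "w \<in> P" "r + norm w < \<rho>"
    and e: "\<And>s. 0 \<le> s \<Longrightarrow> s \<le> 1 \<Longrightarrow> (\<integral>x. indicator X (x + s *\<^sub>R w) * norm (h x) \<partial>\<mu>) \<le> \<epsilon>"
  shows "\<bar>measure \<mu> {x \<in> {x. x + w \<in> X}. \<tau> x = orth_proj P} - measure \<mu> {x \<in> X. \<tau> x = orth_proj P}\<bar> \<le> norm w * \<epsilon>"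
proof -
  have sP: "subspace P" using P by (simp add: Grass_def)
  have Tw: "orth_proj P w = w" using orth_proj_in_id[OF sP w(1)] .
  have eq: "{x \<in> {x. x + w \<in> X}. \<tau> x = orth_proj P} = {x. (\<tau> x, x + \<tau> x w) \<in> {orth_proj P} \<times> X}"
    "{x \<in> X. \<tau> x = orth_proj P} = {x. (\<tau> x, x) \<in> {orth_proj P} \<times> X}" using Tw by auto
  show ?thesis unfolding eq
  proof (rule shift_bound[OF _ _ w(2)])
    show "{orth_proj P} \<times> X \<in> sets (borel \<Otimes>\<^sub>M borel)" by (intro pair_measureI) auto
    fix s :: real assume s: "0 \<le> s" "s \<le> 1"
    have "(\<integral>x. indicator ({orth_proj P} \<times> X) (\<tau> x, x + s *\<^sub>R \<tau> x w) * norm (h x) \<partial>\<mu>) \<le> (\<integral>x. indicator X (x + s *\<^sub>R w) * norm (h x) \<partial>\<mu>)"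
    proof (rule integral_mono_AE')
      show "integrable \<mu> (\<lambda>x. indicator X (x + s *\<^sub>R w) * norm (h x))"
        by (rule Bochner_Integration.integrable_bound[OF integrable_norm[OF h_int]]) (auto split: split_indicator)
    qed (use Tw in \<open>auto split: split_indicator\<close>)
    then show "(\<integral>x. indicator ({orth_proj P} \<times> X) (\<tau> x, x + s *\<^sub>R \<tau> x w) * norm (h x) \<partial>\<mu>) \<le> \<epsilon>"
      using e[OF s] by linarith
  qed (use Xb in auto)
qed

text \<open>On a set where the jump has one sign its total equals the difference of two masses, and
  \<open>shift_bound_plane\<close> controls that difference.\<close>

lemma jump_bound:
  assumes P: "P \<in> Grass m" and D[measurable]: "D \<in> sets borel" and Db: "D \<subseteq> ball a r" and w: "w \<in> P" "r + norm w < \<rho>"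
    and e: "\<And>s. 0 \<le> s \<Longrightarrow> s \<le> 1 \<Longrightarrow> (\<integral>x. indicator D (x + s *\<^sub>R w) * norm (h x) \<partial>\<mu>) \<le> \<epsilon>"
    and mono: "(\<forall>x\<in>D. mult P x \<le> mult P (x - w)) \<or> (\<forall>x\<in>D. mult P (x - w) \<le> mult P x)"
  shows "(\<integral>\<^sup>+x. indicator D x * ennreal \<bar>real (mult P (x - w)) - real (mult P x)\<bar> \<partial>HB m) \<le> ennreal (norm w * \<epsilon>)"
proof -
  let ?j = "\<lambda>x. \<bar>real (mult P (x - w)) - real (mult P x)\<bar>"
  define I where "I = (\<integral>\<^sup>+x. indicator D x * ennreal (?j x) \<partial>HB m)"
  define \<alpha> where "\<alpha> = measure \<mu> {x \<in> {x. x + w \<in> D}. \<tau> x = orth_proj P}"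
  define \<beta> where "\<beta> = measure \<mu> {x \<in> D. \<tau> x = orth_proj P}"
  have ab: "\<bar>\<alpha> - \<beta>\<bar> \<le> norm w * \<epsilon>" unfolding \<alpha>_def \<beta>_def by (rule shift_bound_plane[OF P D Db w e])
  have [measurable]: "{x. x + w \<in> D} \<in> sets borel" by measurable
  have a1: "ennreal \<alpha> = (\<integral>\<^sup>+x. indicator D x * ennreal (real (mult P (x - w))) \<partial>HB m)"
  proof -
    have "ennreal \<alpha> = (\<integral>\<^sup>+x. indicator {x. x + w \<in> D} x * ennreal (real (mult P x)) \<partial>HB m)"
      unfolding \<alpha>_def by (subst emeasure_mult[symmetric]) (auto simp: mu.emeasure_eq_measure)
    also have "\<dots> = (\<integral>\<^sup>+x. indicator {x. x + w \<in> D} (- w + x) * ennreal (real (mult P (- w + x))) \<partial>HB m)"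
      by (rule nn_integral_HB_translate[OF m, symmetric, where f="\<lambda>x. indicator {x. x + w \<in> D} x * ennreal (real (mult P x))"]) measurable
    also have "\<dots> = (\<integral>\<^sup>+x. indicator D x * ennreal (real (mult P (x - w))) \<partial>HB m)"
      by (intro nn_integral_cong) (auto split: split_indicator)
    finally show ?thesis .
  qed
  have b1: "ennreal \<beta> = (\<integral>\<^sup>+x. indicator D x * ennreal (real (mult P x)) \<partial>HB m)"
    unfolding \<beta>_def by (subst emeasure_mult[symmetric]) (auto simp: mu.emeasure_eq_measure)
  have nn: "0 \<le> \<alpha>" "0 \<le> \<beta>" by (simp_all add: \<alpha>_def \<beta>_def)
  have mm: "(\<lambda>x. indicator D x * ennreal (?j x)) \<in> borel_measurable (HB m)"
    "(\<lambda>x. indicator D x * ennreal (real (mult P x))) \<in> borel_measurable (HB m)"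
    "(\<lambda>x. indicator D x * ennreal (real (mult P (x - w)))) \<in> borel_measurable (HB m)"
    by measurable
  from mono have "I \<le> ennreal \<bar>\<alpha> - \<beta>\<bar>"
  proof
    assume le: "\<forall>x\<in>D. mult P x \<le> mult P (x - w)"
    have "ennreal \<alpha> = (\<integral>\<^sup>+x. indicator D x * ennreal (?j x) + indicator D x * ennreal (real (mult P x)) \<partial>HB m)"
      unfolding a1 using le by (intro nn_integral_cong) (auto simp: ennreal_plus[symmetric] simp del: ennreal_plus split: split_indicator)
    also have "\<dots> = I + ennreal \<beta>" unfolding I_def b1 by (rule nn_integral_add[OF mm(1,2)])
    finally have "I = ennreal \<alpha> - ennreal \<beta>" by simp
    then show ?thesis using nn by (simp add: ennreal_minus ennreal_leI)
  next
    assume le: "\<forall>x\<in>D. mult P (x - w) \<le> mult P x"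
    have "ennreal \<beta> = (\<integral>\<^sup>+x. indicator D x * ennreal (?j x) + indicator D x * ennreal (real (mult P (x - w))) \<partial>HB m)"
      unfolding b1 using le by (intro nn_integral_cong) (auto simp: ennreal_plus[symmetric] simp del: ennreal_plus split: split_indicator)
    also have "\<dots> = I + ennreal \<alpha>" unfolding I_def a1 by (rule nn_integral_add[OF mm(1,3)])
    finally have "I = ennreal \<beta> - ennreal \<alpha>" by simp
    then show ?thesis using nn by (simp add: ennreal_minus ennreal_leI)
  qed
  also have "\<dots> \<le> ennreal (norm w * \<epsilon>)" using ab by (rule ennreal_leI)
  finally show ?thesis by (simp add: I_def)
qed

text \<open>Since the multiplicity is integer valued, the set where it jumps has measure \<open>O(\<bar>w\<bar>)\<close>; absolute
  continuity of the first variation then improves the total jump to \<open>o(\<bar>w\<bar>)\<close>.\<close>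

lemma jump_small:
  assumes P: "P \<in> Grass m" and r: "r < \<rho>" and e: "0 < e"
  obtains \<delta> where "0 < \<delta>" "\<And>w. w \<in> P \<Longrightarrow> norm w < \<delta> \<Longrightarrow>
    (\<integral>\<^sup>+x. indicator (ball a r) x * ennreal \<bar>real (mult P (x - w)) - real (mult P x)\<bar> \<partial>HB m) \<le> ennreal (e * norm w)"
proof -
  have bm[measurable]: "ball a r \<in> sets borel" by simp
  define H where "H = (\<integral>x. norm (h x) \<partial>\<mu>)"
  have H: "0 \<le> H" by (simp add: H_def)
  \<comment> \<open>The integral of \<open>norm (h x)\<close> is rewritten over \<open>HB m\<close>.
    That measure is translation invariant, so all translates of a set of small measure are equally
    small.\<close>
  define g where "g x = indicator R x * real (\<theta> x) * norm (h x)" for x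
  have mu_eq': "\<mu> = density (HB m) (\<lambda>x. ennreal (indicator R x * real (\<theta> x)))"
    unfolding mu_eq by (intro density_cong) (auto split: split_indicator)
  have gint: "integrable (HB m) g"
  proof -
    have "integrable \<mu> (\<lambda>x. norm (h x))" using h_int by auto
    then have "integrable (HB m) (\<lambda>x. (indicator R x * real (\<theta> x)) *\<^sub>R norm (h x))"
      unfolding mu_eq' by (subst (asm) integrable_density) auto
    then show ?thesis by (simp add: g_def[abs_def])
  qed
  have gmu: "(\<integral>x. indicator X x * norm (h x) \<partial>\<mu>) = (\<integral>x. indicator X x * g x \<partial>HB m)" if [measurable]: "X \<in> sets borel" for X
    unfolding mu_eq' by (subst integral_density) (auto simp: g_def ac_simps)
  obtain \<delta>1 where \<delta>1: "0 < \<delta>1" "\<And>X. X \<in> sets (HB m) \<Longrightarrow> emeasure (HB m) X \<le> ennreal \<delta>1 \<Longrightarrow> (\<integral>x. indicator X x * g x \<partial>HB m) \<le> e / 2"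
    by (rule integrable_absolutely_continuous[OF gint, of "e / 2"]) (use e in \<open>auto simp: g_def\<close>)
  \<comment> \<open>Ensures that \<open>norm w * H \<le> \<delta>1\<close>, the smallness required
    for absolute continuity, besides \<open>r + norm w < \<rho>\<close>.\<close>
  define \<delta> where "\<delta> = min (\<rho> - r) (\<delta>1 / (H + 1))"
  show ?thesis
  proof (rule that[of \<delta>])
    show "0 < \<delta>" using r \<delta>1 H by (simp add: \<delta>_def)
    fix w assume w: "w \<in> P" and nw: "norm w < \<delta>"
    have rw: "r + norm w < \<rho>" using nw by (simp add: \<delta>_def)
    let ?j = "\<lambda>x. \<bar>real (mult P (x - w)) - real (mult P x)\<bar>"
    \<comment> \<open>\<open>jump_bound\<close> is applied twice. With the crude bound
      \<open>H\<close> it makes the measure of \<open>D\<close> at most \<open>\<delta>1\<close>, as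
      each jump on \<open>D\<close> is at least 1; with that knowledge the integral of
      \<open>norm h\<close> over translates of \<open>D\<close> is at most
      \<open>e / 2\<close>.\<close>
    have key: "(\<integral>\<^sup>+x. indicator D x * ennreal (?j x) \<partial>HB m) \<le> ennreal (norm w * (e / 2))"
      if D[measurable]: "D \<in> sets borel" and Db: "D \<subseteq> ball a r" and ne: "\<And>x. x \<in> D \<Longrightarrow> mult P (x - w) \<noteq> mult P x"
        and mono: "(\<forall>x\<in>D. mult P x \<le> mult P (x - w)) \<or> (\<forall>x\<in>D. mult P (x - w) \<le> mult P x)" for D
    proof -
      have "(\<integral>\<^sup>+x. indicator D x * ennreal (?j x) \<partial>HB m) \<le> ennreal (norm w * H)"
      proof (rule jump_bound[OF P D Db w rw _ mono])
        show "(\<integral>x. indicator D (x + s *\<^sub>R w) * norm (h x) \<partial>\<mu>) \<le> H" for s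
          unfolding H_def by (rule integral_mono_AE'[OF integrable_norm[OF h_int]]) (auto split: split_indicator)
      qed
      moreover have "emeasure (HB m) D \<le> (\<integral>\<^sup>+x. indicator D x * ennreal (?j x) \<partial>HB m)"
      proof -
        have "emeasure (HB m) D = (\<integral>\<^sup>+x. indicator D x \<partial>HB m)" by simp
        also have "\<dots> \<le> (\<integral>\<^sup>+x. indicator D x * ennreal (?j x) \<partial>HB m)"
        proof (intro nn_integral_mono)
          fix x
          have "1 \<le> ?j x" if "x \<in> D" using ne[OF that] by linarith
          then show "indicator D x \<le> (indicator D x * ennreal (?j x) :: ennreal)" by (auto split: split_indicator)
        qed
        finally show ?thesis .
      qed
      moreover have "norm w * H \<le> \<delta>1"
      proof -
        have "norm w * H \<le> (\<delta>1 / (H + 1)) * (H + 1)" using nw H \<delta>1 by (intro mult_mono) (auto simp: \<delta>_def)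
        also have "\<dots> = \<delta>1" using H by simp
        finally show ?thesis .
      qed
      ultimately have small: "emeasure (HB m) D \<le> ennreal \<delta>1" by (meson ennreal_leI order_trans)
      show ?thesis
      proof (rule jump_bound[OF P D Db w rw _ mono])
        fix s :: real
        have [measurable]: "{x. s *\<^sub>R w + x \<in> D} \<in> sets borel" by measurable
        have "emeasure (HB m) {x. s *\<^sub>R w + x \<in> D} \<le> ennreal \<delta>1" using small emeasure_HB_translate[OF m D] by simp
        then have "(\<integral>x. indicator {x. s *\<^sub>R w + x \<in> D} x * norm (h x) \<partial>\<mu>) \<le> e / 2"
          unfolding gmu[OF \<open>{x. s *\<^sub>R w + x \<in> D} \<in> sets borel\<close>] by (intro \<delta>1(2)) simp_all
        also have "(\<integral>x. indicator {x. s *\<^sub>R w + x \<in> D} x * norm (h x) \<partial>\<mu>) = (\<integral>x. indicator D (x + s *\<^sub>R w) * norm (h x) \<partial>\<mu>)"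
          by (intro Bochner_Integration.integral_cong) (auto simp: add.commute split: split_indicator)
        finally show "(\<integral>x. indicator D (x + s *\<^sub>R w) * norm (h x) \<partial>\<mu>) \<le> e / 2" .
      qed
    qed
    \<comment> \<open>Splitting by the sign of the jump provides the monotonicity that
      \<open>jump_bound\<close> requires.\<close>
    define Dp where "Dp = {x \<in> ball a r. mult P x < mult P (x - w)}"
    define Dm where "Dm = {x \<in> ball a r. mult P (x - w) < mult P x}"
    have DB[measurable]: "Dp \<in> sets borel" "Dm \<in> sets borel"
    proof -
      define f where "f x = real (mult P x)" for x
      have [measurable]: "f \<in> borel_measurable borel" unfolding f_def by (rule real_mult_meas)
      have "{x \<in> ball a r. f x < f (x - w)} \<in> sets borel" "{x \<in> ball a r. f (x - w) < f x} \<in> sets borel" by measurable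
      then show "Dp \<in> sets borel" "Dm \<in> sets borel" by (simp_all add: Dp_def Dm_def f_def)
    qed
    have "(\<integral>\<^sup>+x. indicator (ball a r) x * ennreal (?j x) \<partial>HB m)
        = (\<integral>\<^sup>+x. indicator Dp x * ennreal (?j x) + indicator Dm x * ennreal (?j x) \<partial>HB m)"
      by (intro nn_integral_cong) (auto simp: Dp_def Dm_def split: split_indicator)
    also have "\<dots> = (\<integral>\<^sup>+x. indicator Dp x * ennreal (?j x) \<partial>HB m) + (\<integral>\<^sup>+x. indicator Dm x * ennreal (?j x) \<partial>HB m)"
      by (rule nn_integral_add) measurable
    also have "\<dots> \<le> ennreal (norm w * (e / 2)) + ennreal (norm w * (e / 2))"
      by (intro add_mono key DB) (auto simp: Dp_def Dm_def)
    also have "\<dots> = ennreal (e * norm w)" using e by (simp add: ennreal_plus[symmetric] field_simps del: ennreal_plus)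
    finally show "(\<integral>\<^sup>+x. indicator (ball a r) x * ennreal (?j x) \<partial>HB m) \<le> ennreal (e * norm w)" .
  qed
qed

text \<open>Cutting \<open>w\<close> into \<open>N\<close> equal steps, each of total jump at most
  \<open>e' * norm w / N\<close>, gives \<open>e' * norm w\<close> after telescoping, with
  \<open>e'\<close> arbitrary: the \<open>o(norm w)\<close> estimate excludes any change.\<close>

lemma mult_translation_invariant:
  assumes P: "P \<in> Grass m" and r: "r < \<rho>" and w: "w \<in> P"
  shows "AE x in HB m. x \<in> ball a r \<and> x - w \<in> ball a r \<longrightarrow> mult P (x - w) = mult P x"
proof -
  have sP: "subspace P" using P by (simp add: Grass_def)
  have bm[measurable]: "ball a r \<in> sets borel" by simp
  define Gw where "Gw = {x. x \<in> ball a r \<and> x - w \<in> ball a r}"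
  have [measurable]: "Gw \<in> sets borel" unfolding Gw_def by measurable
  define I where "I = (\<integral>\<^sup>+x. indicator Gw x * ennreal \<bar>real (mult P (x - w)) - real (mult P x)\<bar> \<partial>HB m)"
  have "I \<le> ennreal e" if e: "0 < e" for e
  proof -
    define e' where "e' = e / (norm w + 1)"
    have np: "0 < norm w + 1" using norm_ge_zero[of w] by linarith
    have e': "0 < e'" using e np by (simp add: e'_def)
    obtain \<delta> where \<delta>: "0 < \<delta>" "\<And>w. w \<in> P \<Longrightarrow> norm w < \<delta> \<Longrightarrow>
      (\<integral>\<^sup>+x. indicator (ball a r) x * ennreal \<bar>real (mult P (x - w)) - real (mult P x)\<bar> \<partial>HB m) \<le> ennreal (e' * norm w)"
      by (rule jump_small[OF P r e'], rule that)
    obtain N0 :: nat where N0: "norm w / \<delta> < real N0" using reals_Archimedean2 by blast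
    define N where "N = Suc N0"
    have N: "0 < real N" "norm w / real N < \<delta>" using N0 \<delta> by (auto simp: N_def field_simps)
    define v where "v = (1 / real N) *\<^sub>R w"
    have vP: "v \<in> P" using w sP by (simp add: v_def subspace_scale)
    have nv: "norm v = norm w / real N" by (simp add: v_def)
    let ?d = "\<lambda>y. \<bar>real (mult P (y - v)) - real (mult P y)\<bar>"
    have tel: "\<bar>real (mult P (x - w)) - real (mult P x)\<bar> \<le> (\<Sum>i<N. ?d (x - real i *\<^sub>R v))" for x
    proof -
      have "real (mult P (x - real N *\<^sub>R v)) - real (mult P (x - real 0 *\<^sub>R v))
          = (\<Sum>i<N. real (mult P (x - real (Suc i) *\<^sub>R v)) - real (mult P (x - real i *\<^sub>R v)))"
        by (rule sum_lessThan_telescope[symmetric, of "\<lambda>i. real (mult P (x - real i *\<^sub>R v))"])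
      also have "real N *\<^sub>R v = w" using N by (simp add: v_def)
      finally have "\<bar>real (mult P (x - w)) - real (mult P x)\<bar> \<le> (\<Sum>i<N. \<bar>real (mult P (x - real (Suc i) *\<^sub>R v)) - real (mult P (x - real i *\<^sub>R v))\<bar>)"
        using sum_abs by simp
      also have "\<dots> = (\<Sum>i<N. ?d (x - real i *\<^sub>R v))"
      proof (intro sum.cong refl)
        fix i
        have "x - real (Suc i) *\<^sub>R v = x - real i *\<^sub>R v - v" by (simp add: algebra_simps)
        then show "\<bar>real (mult P (x - real (Suc i) *\<^sub>R v)) - real (mult P (x - real i *\<^sub>R v))\<bar> = ?d (x - real i *\<^sub>R v)"
          by (simp only:)
      qed
      finally show ?thesis .
    qed
    have "I \<le> (\<integral>\<^sup>+x. (\<Sum>i<N. indicator Gw x * ennreal (?d (x - real i *\<^sub>R v))) \<partial>HB m)"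
      unfolding I_def
    proof (intro nn_integral_mono)
      fix x
      have "ennreal \<bar>real (mult P (x - w)) - real (mult P x)\<bar> \<le> ennreal (\<Sum>i<N. ?d (x - real i *\<^sub>R v))" using tel by (rule ennreal_leI)
      also have "\<dots> = (\<Sum>i<N. ennreal (?d (x - real i *\<^sub>R v)))" by (intro sum_ennreal[symmetric]) auto
      finally show "indicator Gw x * ennreal \<bar>real (mult P (x - w)) - real (mult P x)\<bar> \<le> (\<Sum>i<N. indicator Gw x * ennreal (?d (x - real i *\<^sub>R v)))"
        unfolding sum_distrib_left[symmetric] by (rule mult_left_mono) simp
    qed
    also have "\<dots> = (\<Sum>i<N. \<integral>\<^sup>+x. indicator Gw x * ennreal (?d (x - real i *\<^sub>R v)) \<partial>HB m)"
      by (rule nn_integral_sum) measurable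
    also have "\<dots> \<le> (\<Sum>i<N. ennreal (e' * norm v))"
    proof (intro sum_mono)
      fix i assume "i \<in> {..<N}"
      then have i: "i < N" by simp
      have "(\<integral>\<^sup>+x. indicator Gw x * ennreal (?d (x - real i *\<^sub>R v)) \<partial>HB m)
          \<le> (\<integral>\<^sup>+x. indicator (ball a r) (- (real i *\<^sub>R v) + x) * ennreal (?d (- (real i *\<^sub>R v) + x)) \<partial>HB m)"
      proof (intro nn_integral_mono)
        fix x
        \<comment> \<open>Intermediate points are convex combinations of \<open>x\<close> and
          \<open>x - w\<close>, so they stay in the ball where \<open>jump_small\<close>
          applies.\<close>
        have "- (real i *\<^sub>R v) + x \<in> ball a r" if "x \<in> Gw"
        proof -
          define t where "t = real i / real N"
          have t: "0 \<le> t" "t \<le> 1" using i N by (auto simp: t_def)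
          have "- (real i *\<^sub>R v) + x = (1 - t) *\<^sub>R x + t *\<^sub>R (x - w)"
            using N by (simp add: t_def v_def algebra_simps)
          also have "\<dots> \<in> ball a r"
            using convexD[OF convex_ball, of x a r "x - w" "1 - t" t] that t by (simp add: Gw_def)
          finally show ?thesis .
        qed
        then show "indicator Gw x * ennreal (?d (x - real i *\<^sub>R v))
            \<le> indicator (ball a r) (- (real i *\<^sub>R v) + x) * ennreal (?d (- (real i *\<^sub>R v) + x))"
          by (auto simp: algebra_simps split: split_indicator)
      qed
      also have "\<dots> = (\<integral>\<^sup>+x. indicator (ball a r) x * ennreal (?d x) \<partial>HB m)"
        by (rule nn_integral_HB_translate[OF m, where f="\<lambda>x. indicator (ball a r) x * ennreal (?d x)"]) measurable
      also have "\<dots> \<le> ennreal (e' * norm v)" using \<delta>(2)[OF vP] N nv by simp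
      finally show "(\<integral>\<^sup>+x. indicator Gw x * ennreal (?d (x - real i *\<^sub>R v)) \<partial>HB m) \<le> ennreal (e' * norm v)" .
    qed
    also have "\<dots> = ennreal (real N * (e' * norm v))" using e' by (simp add: ennreal_mult' ennreal_of_nat_eq_real_of_nat)
    also have "real N * (e' * norm v) = e' * norm w" using N nv by simp
    also have "ennreal (e' * norm w) \<le> ennreal e"
    proof (rule ennreal_leI)
      have "e' * norm w \<le> e' * (norm w + 1)" using e' by simp
      also have "\<dots> = e" using np by (simp add: e'_def)
      finally show "e' * norm w \<le> e" .
    qed
    finally show ?thesis .
  qed
  then have "I = 0" by (rule ennreal_le_zeroI)
  then have "AE x in HB m. indicator Gw x * ennreal \<bar>real (mult P (x - w)) - real (mult P x)\<bar> = 0"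
    unfolding I_def by (subst (asm) nn_integral_0_iff_AE) auto
  then show ?thesis
  proof eventually_elim
    case (elim x)
    then show ?case by (auto simp: Gw_def ennreal_eq_0_iff)
  qed
qed

text \<open>Translation invariance comes with a null set depending on \<open>w\<close>. Fubini over
  pairs \<open>(x, w)\<close> turns this into one point \<open>x\<close> of the plane whose value is
  shared by almost every other point \<open>x + w\<close> in the ball.\<close>

lemma mult_const:
  assumes P: "P \<in> Grass m" and r: "r < \<rho>"
  obtains k where "AE x in HB m. x \<in> (+) p ` P \<inter> ball a r \<longrightarrow> mult P x = k"
proof -
  have sP: "subspace P" using P by (simp add: Grass_def)
  let ?A = "(+) p ` P"
  let ?sA = "plane_measure m ?A" and ?sP = "plane_measure m P"
  have [measurable]: "ball a r \<in> sets borel" by simp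
  have Ab[measurable]: "?A \<in> sets borel" using borel_plane[OF P] .
  have Pb[measurable]: "P \<in> sets borel" using borel_plane[OF P, of 0] by simp
  interpret sA: sigma_finite_measure ?sA by (rule sigma_finite_plane_measure[OF P m])
  interpret sP: sigma_finite_measure ?sP using sigma_finite_plane_measure[OF P m, of 0] by simp
  interpret pair_sigma_finite ?sA ?sP ..
  define f where "f x = real (mult P x)" for x
  have [measurable]: "f \<in> borel_measurable borel" unfolding f_def by (rule real_mult_meas)
  define F where "F x y = (indicator (ball a r) x * indicator (ball a r) y * (if f y \<noteq> f x then 1 else 0) :: ennreal)" for x y
  have m1[measurable]: "(\<lambda>x. F x (x + w)) \<in> borel_measurable borel" for w unfolding F_def by measurable
  have m2: "(\<lambda>(x, w). F x (x + w)) \<in> borel_measurable (?sA \<Otimes>\<^sub>M ?sP)" unfolding F_def by measurable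
  have m3[measurable]: "F x \<in> borel_measurable borel" for x unfolding F_def by measurable
  have AEA: "AE x in ?sA. x \<in> ?A" unfolding plane_measure_def by (subst AE_density) (auto simp: indicator_def)
  have z: "(\<integral>\<^sup>+x. F x (x + w) \<partial>?sA) = 0" if w: "w \<in> P" for w
  proof -
    have "AE x in HB m. x \<in> ball a r \<and> x - (- w) \<in> ball a r \<longrightarrow> mult P (x - (- w)) = mult P x"
      by (rule mult_translation_invariant[OF P r subspace_neg[OF sP w]])
    then have "AE x in HB m. indicator ?A x * F x (x + w) = 0"
      by eventually_elim (auto simp: F_def f_def split: split_indicator)
    then have "(\<integral>\<^sup>+x. indicator ?A x * F x (x + w) \<partial>HB m) = 0"
      by (subst nn_integral_0_iff_AE) auto
    then show ?thesis by (subst nn_integral_plane_measure) auto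
  qed
  have "(\<integral>\<^sup>+w. (\<integral>\<^sup>+x. F x (x + w) \<partial>?sA) \<partial>?sP) = (\<integral>\<^sup>+w. 0 \<partial>?sP)"
  proof (rule nn_integral_cong_AE)
    have "AE w in ?sP. w \<in> P" unfolding plane_measure_def by (subst AE_density) (auto simp: indicator_def)
    then show "AE w in ?sP. (\<integral>\<^sup>+x. F x (x + w) \<partial>?sA) = 0" by eventually_elim (rule z)
  qed
  moreover have "(\<integral>\<^sup>+w. (\<integral>\<^sup>+x. F x (x + w) \<partial>?sA) \<partial>?sP) = (\<integral>\<^sup>+x. (\<integral>\<^sup>+w. F x (x + w) \<partial>?sP) \<partial>?sA)"
    by (rule Fubini'[OF m2])
  ultimately have "(\<integral>\<^sup>+x. (\<integral>\<^sup>+w. F x (x + w) \<partial>?sP) \<partial>?sA) = 0" by simp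
  moreover have "(\<lambda>x. \<integral>\<^sup>+w. F x (x + w) \<partial>?sP) \<in> borel_measurable ?sA"
    using sP.borel_measurable_nn_integral[OF m2] .
  ultimately have "AE x in ?sA. (\<integral>\<^sup>+w. F x (x + w) \<partial>?sP) = 0"
    by (subst (asm) nn_integral_0_iff_AE) auto
  with AEA have ae: "AE x in ?sA. (\<integral>\<^sup>+y. indicator ?A y * F x y \<partial>HB m) = 0"
  proof eventually_elim
    case (elim x)
    have "(\<integral>\<^sup>+w. F x (x + w) \<partial>?sP) = (\<integral>\<^sup>+w. indicator P w * F x (x + w) \<partial>HB m)"
      by (subst nn_integral_plane_measure) auto
    also have "\<dots> = (\<integral>\<^sup>+w. indicator ?A (x + w) * F x (x + w) \<partial>HB m)"
    proof (intro nn_integral_cong)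
      fix w
      obtain q where q: "q \<in> P" "x = p + q" using elim(1) by blast
      have "x + w \<in> ?A \<longleftrightarrow> q + w \<in> P" unfolding q(2) by (auto simp: add.assoc image_iff)
      also have "\<dots> \<longleftrightarrow> w \<in> P" using subspace_add[OF sP q(1), of w] subspace_diff[OF sP _ q(1), of "q + w"] by auto
      finally show "indicator P w * F x (x + w) = indicator ?A (x + w) * F x (x + w)" by (simp add: indicator_def)
    qed
    also have "\<dots> = (\<integral>\<^sup>+y. indicator ?A y * F x y \<partial>HB m)"
      by (rule nn_integral_HB_translate[OF m, where f="\<lambda>y. indicator ?A y * F x y"]) measurable
    finally show ?case using elim(2) by simp
  qed
  show ?thesis
  \<comment> \<open>If the plane meets the ball in a null set, no reference point exists and any
    constant serves.\<close>
  proof (cases "AE x in ?sA. x \<notin> ball a r")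
    case True
    then have "AE x in HB m. x \<in> ?A \<longrightarrow> x \<notin> ball a r"
      unfolding plane_measure_def by (subst (asm) AE_density) (auto simp: indicator_def)
    then have "AE x in HB m. x \<in> ?A \<inter> ball a r \<longrightarrow> mult P x = 0" by eventually_elim auto
    then show ?thesis by (rule that)
  next
    case False
    obtain x where x: "x \<in> ball a r" "(\<integral>\<^sup>+y. indicator ?A y * F x y \<partial>HB m) = 0"
    proof -
      have "\<exists>x. x \<in> ball a r \<and> (\<integral>\<^sup>+y. indicator ?A y * F x y \<partial>HB m) = 0"
      proof (rule ccontr)
        assume no: "\<not> ?thesis"
        from ae have "AE x in ?sA. x \<notin> ball a r" by eventually_elim (use no in blast)
        with False show False ..
      qed
      then show ?thesis using that by blast
    qed
    have "AE y in HB m. indicator ?A y * F x y = 0" using x(2) by (subst (asm) nn_integral_0_iff_AE) auto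
    then have "AE y in HB m. y \<in> ?A \<inter> ball a r \<longrightarrow> mult P y = mult P x"
      by eventually_elim (use x(1) in \<open>auto simp: F_def f_def split: if_splits\<close>)
    then show ?thesis by (rule that)
  qed
qed

text \<open>Recovers the linear direction from an affine plane given only as a set, so that families
  of planes can be handled as sets of sets.\<close>

definition dirn :: "'a set \<Rightarrow> 'a set" where
  "dirn A = {x - y | x y. x \<in> A \<and> y \<in> A}"

lemma dirn_plane: assumes "subspace P" shows "dirn ((+) p ` P) = P"
proof (intro set_eqI iffI)
  fix x assume "x \<in> dirn ((+) p ` P)"
  then obtain u v where "u \<in> P" "v \<in> P" "x = (p + u) - (p + v)" by (auto simp: dirn_def)
  then show "x \<in> P" using subspace_diff[OF assms, of u v] by simp
next
  fix x assume "x \<in> P"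
  then have "(p + x) - (p + 0) \<in> dirn ((+) p ` P)"
    unfolding dirn_def using subspace_0[OF assms] by blast
  then show "x \<in> dirn ((+) p ` P)" by simp
qed

text \<open>Unlike in \<open>rich_planes\<close>, the tangent planes must agree with the plane; a
  plane may meet \<open>R\<close> in positive measure without being tangent to it by definition
  alone.\<close>

definition charged_planes :: "real \<Rightarrow> 'a set set" where
  "charged_planes r = {A. (\<exists>P\<in>Grass m. \<exists>p. A = (+) p ` P) \<and> emeasure \<mu> {x \<in> A \<inter> ball a r. \<tau> x = orth_proj (dirn A)} \<noteq> 0}"

text \<open>Mass inside the smaller ball excludes the constant 0 on the larger one, and a nonzero
  value of \<open>mult\<close> forces both membership in \<open>R\<close> and the tangent
  direction.\<close>

lemma charged_plane_mult:
  assumes A: "A \<in> charged_planes r" and r: "r < r'" "r' < \<rho>"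
  obtains k where "0 < k" "AE x in HB m. x \<in> A \<inter> ball a r' \<longrightarrow> x \<in> R \<and> \<tau> x = orth_proj (dirn A) \<and> \<theta> x = k"
proof -
  obtain P p where P: "P \<in> Grass m" "A = (+) p ` P" using A unfolding charged_planes_def by blast
  have d: "dirn A = P" using P dirn_plane by (simp add: Grass_def)
  have Ab[measurable]: "A \<in> sets borel" using borel_plane[OF P(1)] P(2) by simp
  have [measurable]: "ball a r \<in> sets borel" by simp
  obtain k where k: "AE x in HB m. x \<in> A \<inter> ball a r' \<longrightarrow> mult P x = k"
    using mult_const[OF P(1) r(2), of p] unfolding P(2) by blast
  have "k \<noteq> 0"
  proof
    assume k0: "k = 0"
    have "emeasure \<mu> {x \<in> A \<inter> ball a r. \<tau> x = orth_proj P} = (\<integral>\<^sup>+x. indicator (A \<inter> ball a r) x * ennreal (real (mult P x)) \<partial>HB m)"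
      by (rule emeasure_mult) measurable
    also have "\<dots> = 0"
    proof (subst nn_integral_0_iff_AE)
      show "(\<lambda>x. indicator (A \<inter> ball a r) x * ennreal (real (mult P x))) \<in> borel_measurable (HB m)" by measurable
      from k show "AE x in HB m. indicator (A \<inter> ball a r) x * ennreal (real (mult P x)) = 0"
        by eventually_elim (use r k0 in \<open>auto split: split_indicator\<close>)
    qed
    finally show False using A by (simp add: charged_planes_def d)
  qed
  moreover from k have "AE x in HB m. x \<in> A \<inter> ball a r' \<longrightarrow> x \<in> R \<and> \<tau> x = orth_proj (dirn A) \<and> \<theta> x = k"
    by eventually_elim (use \<open>k \<noteq> 0\<close> in \<open>auto simp: mult_def d split: if_splits\<close>)
  ultimately show ?thesis using that by blast
qed

lemma finite_charged_planes:
  assumes r: "r < r'" "r' < \<rho>"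
  shows "finite (charged_planes r)"
proof -
  define Q where "Q A = {x \<in> A \<inter> ball a r'. \<tau> x = orth_proj (dirn A)}" for A
  \<comment> \<open>A charged plane passes through some point \<open>q\<close> of
    \<open>ball a r\<close>. The ball of radius \<open>r' - r\<close> about \<open>q\<close> stays
    in \<open>ball a r'\<close>, where almost the whole plane belongs to \<open>R\<close> with
    multiplicity at least 1.\<close>
  define c where "c = plane_const m * (r' - r) ^ m"
  have c: "0 < c" using plane_const_pos[of m] r by (simp add: c_def)
  have [measurable]: "ball a r' \<in> sets borel" by simp
  have Ab: "A \<in> sets borel" if "A \<in> charged_planes r" for A using that borel_plane by (auto simp: charged_planes_def)
  have Qb: "Q A \<in> sets borel" if "A \<in> charged_planes r" for A
  proof -
    have [measurable]: "A \<in> sets borel" using Ab[OF that] .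
    show ?thesis unfolding Q_def by measurable
  qed
  show ?thesis
  proof (rule finite_almost_disjoint[where M=\<mu> and Q=Q, OF _ _ _ _ c])
    show "finite_measure \<mu>" by (rule mu.finite_measure_axioms)
    show "Q A \<in> sets \<mu>" if "A \<in> charged_planes r" for A using Qb[OF that] by (simp add: sets_mu)
  next
    fix A assume A: "A \<in> charged_planes r"
    obtain k where k: "0 < k" "AE x in HB m. x \<in> A \<inter> ball a r' \<longrightarrow> x \<in> R \<and> \<tau> x = orth_proj (dirn A) \<and> \<theta> x = k"
      by (rule charged_plane_mult[OF A r], rule that)
    obtain P p where P: "P \<in> Grass m" "A = (+) p ` P" using A unfolding charged_planes_def by blast
    have sP: "subspace P" using P by (simp add: Grass_def)
    have "{x \<in> A \<inter> ball a r. \<tau> x = orth_proj (dirn A)} \<noteq> {}" using A unfolding charged_planes_def by (auto simp del: Collect_empty_eq)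
    then obtain q where q: "q \<in> A" "q \<in> ball a r" by auto
    have Aq: "A = (+) q ` P"
    proof -
      obtain u where u: "u \<in> P" "q = p + u" using q P by auto
      have "(+) q ` P = (+) p ` ((+) u ` P)" unfolding u(2) by (auto simp: image_image add.assoc)
      then show ?thesis using subspace_translate_eq[OF sP u(1)] P(2) by simp
    qed
    have sub: "ball q (r' - r) \<subseteq> ball a r'"
    proof
      fix x assume "x \<in> ball q (r' - r)"
      then show "x \<in> ball a r'" using q(2) dist_triangle[of a x q] by simp
    qed
    have "ennreal c \<le> Hm m (A \<inter> ball q (r' - r))"
      unfolding c_def Aq by (rule Hm_plane_ball_ge[OF P(1) m]) (use r in simp)
    also have "\<dots> = emeasure (HB m) (A \<inter> ball q (r' - r))" using Ab[OF A] by (intro emeasure_HB[OF m, symmetric]) auto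
    also have "\<dots> = (\<integral>\<^sup>+x. indicator (A \<inter> ball q (r' - r)) x \<partial>HB m)" using Ab[OF A] by simp
    also have "\<dots> \<le> (\<integral>\<^sup>+x. indicator R x * ennreal (real (\<theta> x)) * indicator (Q A) x \<partial>HB m)"
    proof (rule nn_integral_mono_AE)
      from k(2) show "AE x in HB m. indicator (A \<inter> ball q (r' - r)) x \<le> indicator R x * ennreal (real (\<theta> x)) * indicator (Q A) x"
      proof eventually_elim
        case (elim x)
        then show ?case using sub k(1) by (auto simp: Q_def split: split_indicator)
      qed
    qed
    also have "\<dots> = emeasure \<mu> (Q A)" by (rule emeasure_mu[symmetric, OF Qb[OF A]])
    finally show "c \<le> measure \<mu> (Q A)" using c by (simp add: mu.emeasure_eq_measure)
  next
    fix A B assume AB: "A \<in> charged_planes r" "B \<in> charged_planes r" "A \<noteq> B"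
    obtain P p where P1: "P \<in> Grass m" "A = (+) p ` P" using AB(1) unfolding charged_planes_def by blast
    obtain P' p' where P2: "P' \<in> Grass m" "B = (+) p' ` P'" using AB(2) unfolding charged_planes_def by blast
    have "emeasure (HB m) (A \<inter> B) = Hm m (A \<inter> B)" using Ab AB by (intro emeasure_HB[OF m]) auto
    also have "\<dots> = 0" using Hm_plane_Int_null[OF P1(1) P2(1) _ m] P1(2) P2(2) AB(3) by simp
    finally have "A \<inter> B \<in> null_sets (HB m)" using Ab AB by (auto simp: null_sets_def)
    then have ae: "AE x in HB m. x \<notin> A \<inter> B" by (rule AE_not_in)
    have "emeasure \<mu> (Q A \<inter> Q B) = (\<integral>\<^sup>+x. indicator R x * ennreal (real (\<theta> x)) * indicator (Q A \<inter> Q B) x \<partial>HB m)"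
      using Qb AB by (intro emeasure_mu) auto
    also have "\<dots> = (\<integral>\<^sup>+x. 0 \<partial>(HB m :: 'a measure))"
    proof (rule nn_integral_cong_AE)
      from ae show "AE x in HB m. indicator R x * ennreal (real (\<theta> x)) * indicator (Q A \<inter> Q B) x = 0"
        by eventually_elim (auto simp: Q_def split: split_indicator)
    qed
    finally show "measure \<mu> (Q A \<inter> Q B) = 0" by (simp add: measure_def)
  qed
qed

text \<open>At almost every point with a tangent plane, the affine tangent plane is rich, because
  its cylinder is not null. The rich but uncharged planes are countably many and each contributes
  only a null set of points tangent to it.\<close>

lemma AE_in_charged_plane:
  assumes r: "r < \<rho>"
  shows "AE x in HB m. x \<in> R \<inter> ball a r \<and> \<tau> x \<noteq> 0 \<longrightarrow> (\<exists>A\<in>charged_planes r. x \<in> A)"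
proof -
  have [measurable]: "ball a r \<in> sets borel" by simp
  have "AE x in \<mu>. \<forall>A\<in>rich_planes - charged_planes r. x \<notin> {x \<in> A \<inter> ball a r. \<tau> x = orth_proj (dirn A)}"
  proof (rule AE_ball_countable')
    show "countable (rich_planes - charged_planes r)" using countable_rich_planes by (rule countable_Diff)
    fix A assume A: "A \<in> rich_planes - charged_planes r"
    then have Ab[measurable]: "A \<in> sets borel" using borel_plane by (auto simp: rich_planes_def)
    have "{x \<in> A \<inter> ball a r. \<tau> x = orth_proj (dirn A)} \<in> sets \<mu>" unfolding sets_mu by measurable
    moreover have "emeasure \<mu> {x \<in> A \<inter> ball a r. \<tau> x = orth_proj (dirn A)} = 0"
      using A unfolding rich_planes_def charged_planes_def by blast
    ultimately have "{x \<in> A \<inter> ball a r. \<tau> x = orth_proj (dirn A)} \<in> null_sets \<mu>" by (simp add: null_sets_def)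
    then show "AE x in \<mu>. x \<notin> {x \<in> A \<inter> ball a r. \<tau> x = orth_proj (dirn A)}" by (rule AE_not_in)
  qed
  with AE_cylinder_pos[OF r] have "AE x in \<mu>. x \<in> ball a r \<and> \<tau> x \<noteq> 0 \<longrightarrow> (\<exists>A\<in>charged_planes r. x \<in> A)"
  proof eventually_elim
    case (elim x)
    show ?case
    proof
      assume x: "x \<in> ball a r \<and> \<tau> x \<noteq> 0"
      then obtain P where P: "P \<in> Grass m" "\<tau> x = orth_proj P" using tau_proj[of x] by blast
      have sP: "subspace P" using P by (simp add: Grass_def)
      let ?A = "(+) x ` P"
      have xA: "x \<in> ?A" using subspace_0[OF sP] by force
      have "emeasure lborel {w. x + orth_proj P w \<in> R} \<noteq> 0" using elim(1) x P by simp
      then have "emeasure (HB m) (R \<inter> ?A) \<noteq> 0" using plane_null_iff_cylinder_null[OF P(1) m R_meas] by blast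
      then have "?A \<in> rich_planes" using P(1) by (auto simp: rich_planes_def)
      moreover have "x \<in> {x \<in> ?A \<inter> ball a r. \<tau> x = orth_proj (dirn ?A)}"
        using x xA P(2) by (simp add: dirn_plane[OF sP])
      ultimately have "?A \<in> charged_planes r" using elim(2) by blast
      then show "\<exists>A\<in>charged_planes r. x \<in> A" using xA by blast
    qed
  qed
  then show ?thesis unfolding AE_mu_iff by eventually_elim auto
qed

end

section \<open>From the curvature varifold to Borel data on a ball\<close>

lemma AE_HM_iff: "(AE x in HM m. Q x) \<longleftrightarrow> (AE x in HB m. Q x)"
  unfolding HM_eq by (rule AE_completion_iff)

text \<open>Needed for the integrand of \<open>vint\<close>, whose measurability is not given and is
  inherited from a Borel function equal to it almost everywhere.\<close>

lemma measurable_completion_AE: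
  assumes f: "f \<in> completion M \<rightarrow>\<^sub>M N" and ae: "AE x in M. f x = g x" and g: "\<And>x. x \<in> space M \<Longrightarrow> g x \<in> space N"
  shows "g \<in> completion M \<rightarrow>\<^sub>M N"
proof (rule measurableI)
  fix A assume A: "A \<in> sets N"
  obtain Z where Z: "Z \<in> null_sets M" "{x \<in> space M. f x \<noteq> g x} \<subseteq> Z" using ae unfolding eventually_ae_filter by blast
  let ?C = "completion M"
  have "g -` A \<inter> space ?C = ((f -` A \<inter> space ?C) - Z) \<union> (g -` A \<inter> space ?C \<inter> Z)"
    using Z(2) by auto
  moreover have "f -` A \<inter> space ?C \<in> sets ?C" using measurable_sets[OF f A] .
  moreover have "Z \<in> sets ?C" using Z(1) by auto
  moreover have "g -` A \<inter> space ?C \<inter> Z \<in> sets ?C" using Z(1) by (intro null_sets_completion[of Z]) auto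
  ultimately show "g -` A \<inter> space ?C \<in> sets ?C" by (metis sets.Diff sets.Un)
qed (use g in auto)

lemma borel_version_euclidean:
  fixes f :: "'a::euclidean_space \<Rightarrow> 'b::euclidean_space"
  assumes f: "f \<in> borel_measurable (HM m)"
  obtains f' where "f' \<in> borel_measurable borel" "AE x in HB m. f x = f' x"
proof -
  have "\<forall>b. \<exists>g\<in>borel_measurable (HB m). AE x in HB m. f x \<bullet> b = g x"
    using f unfolding HM_eq
    by (intro allI completion_ex_borel_measurable_real borel_measurable_inner borel_measurable_const)
  then obtain g where g: "\<And>b. g b \<in> borel_measurable (HB m)" "\<And>b. AE x in HB m. f x \<bullet> b = g b x" by metis
  show ?thesis
  proof (rule that[of "\<lambda>x. \<Sum>b\<in>Basis. g b x *\<^sub>R b"])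
    have [measurable]: "g b \<in> borel_measurable borel" for b using g(1)[of b] by (simp cong: measurable_cong_sets)
    show "(\<lambda>x. \<Sum>b\<in>Basis. g b x *\<^sub>R b) \<in> borel_measurable borel" by measurable
    have "AE x in HB m. \<forall>b\<in>Basis. f x \<bullet> b = g b x" by (intro AE_finite_allI finite_Basis g(2))
    then show "AE x in HB m. f x = (\<Sum>b\<in>Basis. g b x *\<^sub>R b)"
    proof eventually_elim
      case (elim x)
      then have "(\<Sum>b\<in>Basis. g b x *\<^sub>R b) = (\<Sum>b\<in>Basis. (f x \<bullet> b) *\<^sub>R b)" by (intro sum.cong) auto
      then show ?case by (simp add: euclidean_representation)
    qed
  qed
qed

lemma borel_version_blinfun:
  fixes f :: "'a::euclidean_space \<Rightarrow> ('a \<Rightarrow>\<^sub>L 'a)"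
  assumes f: "f \<in> borel_measurable (HM m)"
  obtains f' where "f' \<in> borel_measurable borel" "AE x in HB m. f x = f' x"
proof -
  have "\<forall>j. \<exists>g. g \<in> borel_measurable borel \<and> (AE x in HB m. f x j = g x)"
  proof
    fix j
    have "(\<lambda>x. f x j) \<in> borel_measurable (HM m)" using f by measurable
    from borel_version_euclidean[OF this] show "\<exists>g. g \<in> borel_measurable borel \<and> (AE x in HB m. f x j = g x)" by metis
  qed
  then obtain g where g: "\<And>j. g j \<in> borel_measurable borel" "\<And>j. AE x in HB m. f x j = g j x" by metis
  define f' where "f' x = (\<Sum>j\<in>Basis. blinfun_scaleR_left (g j x) o\<^sub>L blinfun_inner_left j)" for x
  have f'j: "f' x j = g j x" if "j \<in> Basis" for x j
    using that by (simp add: f'_def blinfun.sum_left inner_Basis if_distrib[of "\<lambda>c. c *\<^sub>R _"] cong: if_cong)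
  show ?thesis
  proof (rule that[of f'])
    show "f' \<in> borel_measurable borel"
      by (rule borel_measurable_blinfunI) (simp add: f'j g(1))
    have "AE x in HB m. \<forall>j\<in>Basis. f x j = g j x" by (intro AE_finite_allI finite_Basis g(2))
    then show "AE x in HB m. f x = f' x"
      by eventually_elim (rule blinfun_euclidean_eqI, simp add: f'j)
  qed
qed

text \<open>Keeps 0 free as the marker for points without a tangent plane.\<close>

lemma orth_proj_neq_0:
  assumes "P \<in> Grass m" "1 \<le> m" shows "orth_proj P \<noteq> 0"
proof
  assume "orth_proj P = 0"
  then have "P = {0}" using range_orth_proj[of P] assms(1) by (auto simp: Grass_def)
  then show False using assms by (simp add: Grass_def)
qed

text \<open>The derivative of \<open>\<psi>\<close> times a constant vector has rank one, and
  symmetry of the projection moves it onto \<open>w\<close>.\<close>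

lemma lin_dot_derivative:
  fixes \<psi> :: "'a::euclidean_space \<Rightarrow> real"
  assumes \<psi>: "smooth_map \<psi>" and P: "subspace P"
  shows "lin_dot (orth_proj P) (frechet_derivative (\<lambda>x. \<psi> x *\<^sub>R w) (at x)) = frechet_derivative \<psi> (at x) (orth_proj P w)"
proof -
  have "((\<lambda>x. \<psi> x *\<^sub>R w) has_derivative (\<lambda>v. frechet_derivative \<psi> (at x) v *\<^sub>R w)) (at x)"
    by (rule has_derivative_scaleR_left[OF smooth_map_has_derivative[OF \<psi>]])
  then have D: "frechet_derivative (\<lambda>x. \<psi> x *\<^sub>R w) (at x) = (\<lambda>v. frechet_derivative \<psi> (at x) v *\<^sub>R w)"
    using frechet_derivative_at by metis
  have "lin_dot (orth_proj P) (frechet_derivative (\<lambda>x. \<psi> x *\<^sub>R w) (at x))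
      = (\<Sum>i\<in>Basis. (orth_proj P w \<bullet> i) * frechet_derivative \<psi> (at x) i)"
    unfolding lin_dot_def D
  proof (intro sum.cong refl)
    fix i
    have "orth_proj P i \<bullet> w = orth_proj P w \<bullet> i"
      using orth_proj_symmetric[OF P, of i w] inner_commute[of i] by simp
    then show "orth_proj P i \<bullet> frechet_derivative \<psi> (at x) i *\<^sub>R w = (orth_proj P w \<bullet> i) * frechet_derivative \<psi> (at x) i"
      by simp
  qed
  then show ?thesis using frechet_derivative_basis_sum[OF \<psi>, of x "orth_proj P w"] by simp
qed

text \<open>The derivative vanishes off the closed support of \<open>\<gamma>\<close>, and bounded
  closed sets of linear maps are compact in finite dimension.\<close>

lemma admissible_gammaI:
  fixes \<gamma> :: "('a::euclidean_space \<Rightarrow>\<^sub>L 'a) \<Rightarrow> real"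
  assumes \<gamma>: "smooth_map \<gamma>" and b: "bounded {T. \<gamma> T \<noteq> 0}"
  shows "admissible_gamma \<gamma>"
proof -
  have "frechet_derivative \<gamma> (at y) v = 0" if y: "y \<notin> closure {T. \<gamma> T \<noteq> 0}" for y v
  proof -
    have "(\<gamma> has_derivative (\<lambda>_. 0)) (at y)"
      by (rule has_derivative_transform_within_open[OF has_derivative_const, of "- closure {T. \<gamma> T \<noteq> 0}" _ 0])
         (use y closure_subset[of "{T. \<gamma> T \<noteq> 0}"] in auto)
    then show ?thesis using frechet_derivative_at by metis
  qed
  then have "{y\<in>Ysym. \<exists>v\<in>Ysym. frechet_derivative \<gamma> (at y) v \<noteq> 0} \<subseteq> closure {T. \<gamma> T \<noteq> 0}" by blast
  then have "bounded {y\<in>Ysym. \<exists>v\<in>Ysym. frechet_derivative \<gamma> (at y) v \<noteq> 0}"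
    using bounded_closure[OF b] bounded_subset by blast
  then have "bounded (closure {y\<in>Ysym. \<exists>v\<in>Ysym. frechet_derivative \<gamma> (at y) v \<noteq> 0})" by (rule bounded_closure)
  then show ?thesis using \<gamma> by (simp add: admissible_gamma_def compact_eq_bounded_closed)
qed

text \<open>Testing the weak derivative with fields \<open>\<psi> x *\<^sub>R w\<close> and with
  \<open>b = 0\<close> gives the identity \<open>weak\<close>. Since the closed ball lies in
  \<open>U\<close>, mass and \<open>h\<close> are integrable there; Borel versions replace the data
  measurable for the completion.\<close>

lemma flat_varifold_of_second_fund_form:
  fixes U R :: "'a::euclidean_space set"
  assumes m: "1 \<le> m" and V: "integral_varifold m U R \<theta>" and sff: "second_fund_form m U R \<theta> b"
    and b0: "AE x in vweight m R \<theta>. b x = 0" and U: "cball a \<rho> \<subseteq> U"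
  obtains \<mu> \<tau> h where "flat_varifold m \<mu> \<tau> h a \<rho> (R \<inter> ball a \<rho>) \<theta>"
    "AE x in HB m. x \<in> R \<inter> ball a \<rho> \<longrightarrow> \<tau> x = (if rtan m R x \<in> Grass m then orth_proj (rtan m R x) else 0)"
proof -
  note V' = integral_varifoldD[OF V]
  note [measurable] = V'(2,3)
  let ?W = "vweight m R \<theta>" and ?B = "ball a \<rho>"
  have [measurable]: "?B \<in> sets borel" by simp
  obtain h0 where fv: "first_var_rep m U R \<theta> h0" and gw: "gen_weak_deriv m U R \<theta> h0 (tauV m R \<theta>) b"
    using sff by (auto simp: second_fund_form_def)
  have h0m: "h0 \<in> borel_measurable (HM m)"
  proof -
    have "h0 \<in> borel_measurable ?W" using fv by (simp add: first_var_rep_def)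
    then show ?thesis by (subst measurable_cong_sets[OF sets_vweight[symmetric] refl])
  qed
  have t0m: "tauV m R \<theta> \<in> borel_measurable (HM m)"
  proof -
    have "tauV m R \<theta> \<in> borel_measurable ?W" using gw by (simp add: gen_weak_deriv_def)
    then show ?thesis by (subst measurable_cong_sets[OF sets_vweight[symmetric] refl])
  qed
  define S where "S x = (if rtan m R x \<in> Grass m then orth_proj (rtan m R x) else 0)" for x
  \<comment> \<open>The weak derivative refers to tangent planes of the weight, the integrals of the
    varifold to those of \<open>R\<close>; off a null set they coincide.\<close>
  have tS: "AE x in HB m. x \<in> R \<inter> ?B \<longrightarrow> tauV m R \<theta> x = S x"
  proof -
    have "{x\<in>R \<inter> ?B. approx_tan m ?W x \<noteq> rtan m R x} \<in> null_sets (HM m)"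
      by (rule Hm_null_sets_HM[OF m approx_tan_vweight_eq_rtan[OF m V U]])
    then have "AE x in HM m. x \<notin> {x\<in>R \<inter> ?B. approx_tan m ?W x \<noteq> rtan m R x}" by (rule AE_not_in)
    then have "AE x in HB m. x \<notin> {x\<in>R \<inter> ?B. approx_tan m ?W x \<noteq> rtan m R x}" unfolding AE_HM_iff .
    then show ?thesis by eventually_elim (auto simp: tauV_def S_def)
  qed
  obtain t1 where t1: "t1 \<in> borel_measurable borel" "AE x in HB m. tauV m R \<theta> x = t1 x"
    by (rule borel_version_blinfun[OF t0m])
  obtain h where h[measurable]: "h \<in> borel_measurable borel" and h_ae: "AE x in HB m. h0 x = h x"
    by (rule borel_version_euclidean[OF h0m])
  \<comment> \<open>A Borel version of \<open>tauV\<close> need not take projections as values.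
    Setting it to 0 on a Borel null set containing all discrepancies restores the alternative "0 or
    a projection" at every point.\<close>
  obtain Z where Z: "Z \<in> null_sets (HB m)" "{x \<in> space (HB m). tauV m R \<theta> x \<noteq> t1 x} \<subseteq> Z" using t1(2) unfolding eventually_ae_filter by blast
  have Zb[measurable]: "Z \<in> sets borel" using Z(1) by auto
  define \<tau> where "\<tau> x = (if x \<in> Z then 0 else t1 x)" for x
  have \<tau>_eq: "\<tau> x = (if x \<in> Z then 0 else tauV m R \<theta> x)" for x 
  proof (cases "x \<in> Z")
    case False
    then have "\<not> tauV m R \<theta> x \<noteq> t1 x" using Z(2) by auto
    then show ?thesis using False by (simp add: \<tau>_def)
  qed (simp add: \<tau>_def)
  have \<tau>m[measurable]: "\<tau> \<in> borel_measurable borel" unfolding \<tau>_def using t1(1) by measurable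
  have \<tau>_ae: "AE x in HB m. tauV m R \<theta> x = \<tau> x" using AE_not_in[OF Z(1)] by eventually_elim (simp add: \<tau>_eq)
  have \<tau>S: "AE x in HB m. x \<in> R \<inter> ?B \<longrightarrow> \<tau> x = S x" using tS \<tau>_ae by eventually_elim auto
  define c where "c x = indicator R x * real (\<theta> x)" for x
  have c0: "0 \<le> c x" for x by (simp add: c_def)
  have cm[measurable]: "c \<in> borel_measurable borel" unfolding c_def by measurable
  have cB: "indicator (R \<inter> ?B) x * real (\<theta> x) = indicator ?B x * c x" for x by (simp add: c_def indicator_inter_arith)
  have W_eq: "?W = density (HM m) (\<lambda>x. ennreal (c x))"
    unfolding vweight_def by (intro arg_cong[where f="density _"]) (auto simp: c_def fun_eq_iff split: split_indicator)
  define \<mu> where "\<mu> = density (HB m) (\<lambda>x. indicator (R \<inter> ?B) x * ennreal (real (\<theta> x)))"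
  have \<mu>_eq: "\<mu> = density (HB m) (\<lambda>x. ennreal (indicator ?B x * c x))"
    unfolding \<mu>_def by (intro arg_cong[where f="density _"]) (auto simp: c_def fun_eq_iff split: split_indicator)
  have HMm: "f \<in> borel_measurable (HM m)" if "f \<in> borel_measurable borel" for f :: "'a \<Rightarrow> real" using that by (rule measurable_HM_borel)
  have int_mu: "(\<integral>x. f x \<partial>\<mu>) = (\<integral>x. indicator ?B x * c x * f x \<partial>HM m)" if [measurable]: "f \<in> borel_measurable borel" for f :: "'a \<Rightarrow> real"
  proof -
    have "(\<integral>x. f x \<partial>\<mu>) = (\<integral>x. (indicator ?B x * c x) *\<^sub>R f x \<partial>HB m)"
      unfolding \<mu>_eq by (rule integral_density) (auto simp: c0)
    also have "\<dots> = (\<integral>x. indicator ?B x * c x * f x \<partial>HM m)"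
      unfolding HM_eq by (subst integral_completion) auto
    finally show ?thesis .
  qed
  have int_W: "(\<integral>x. f x \<partial>?W) = (\<integral>x. c x * f x \<partial>HM m)" if f: "f \<in> borel_measurable (HM m)" for f :: "'a \<Rightarrow> real"
    unfolding W_eq using integral_density[OF f measurable_HM_borel[OF cm]] c0 by simp
  have "flat_varifold m \<mu> \<tau> h a \<rho> (R \<inter> ?B) \<theta>"
  proof
    show "1 \<le> m" by fact
    show "sets \<mu> = sets borel" by (simp add: \<mu>_def)
    show "\<mu> = density (HB m) (\<lambda>x. indicator (R \<inter> ?B) x * ennreal (real (\<theta> x)))" by (rule \<mu>_def)
    show "R \<inter> ?B \<in> sets borel" by measurable
    show "\<theta> \<in> borel \<rightarrow>\<^sub>M count_space UNIV" by measurable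
    show "1 \<le> \<theta> x" if "x \<in> R \<inter> ?B" for x using V'(4) that by blast
    have "emeasure \<mu> UNIV = (\<integral>\<^sup>+x. indicator (R \<inter> ?B) x * ennreal (real (\<theta> x)) * indicator UNIV x \<partial>HB m)"
      unfolding \<mu>_def by (rule emeasure_density) auto
    also have "\<dots> \<le> (\<integral>\<^sup>+x. indicator R x * ennreal (real (\<theta> x)) * indicator (cball a \<rho>) x \<partial>HB m)"
      by (intro nn_integral_mono) (auto split: split_indicator)
    also have "\<dots> = emeasure ?W (cball a \<rho>)"
      unfolding emeasure_vweight[OF V'(2,3) sets_HM_borel[OF borel_closed[OF closed_cball]]] HM_eq nn_integral_completion ..
    also have "\<dots> < top" using V'(5)[OF compact_cball U] by simp
    finally show "emeasure \<mu> UNIV < top" .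
    show "\<tau> \<in> borel_measurable borel" by (rule \<tau>m)
    show "h \<in> borel_measurable borel" by (rule h)
    show "\<tau> x = 0 \<or> (\<exists>P\<in>Grass m. \<tau> x = orth_proj P)" for x
      by (auto simp: \<tau>_eq tauV_def)
    show "integrable \<mu> h"
    proof (rule integrableI_bounded)
      show "h \<in> borel_measurable \<mu>" using h by (simp add: \<mu>_def)
      have "(\<integral>\<^sup>+x. ennreal (norm (h x)) \<partial>\<mu>) = (\<integral>\<^sup>+x. ennreal (indicator ?B x * c x) * ennreal (norm (h x)) \<partial>HB m)"
        unfolding \<mu>_eq by (rule nn_integral_density) auto
      also have "\<dots> \<le> (\<integral>\<^sup>+x. ennreal (c x) * (ennreal (norm (h0 x)) * indicator (cball a \<rho>) x) \<partial>HB m)"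
      proof (rule nn_integral_mono_AE)
        from h_ae show "AE x in HB m. ennreal (indicator ?B x * c x) * ennreal (norm (h x)) \<le> ennreal (c x) * (ennreal (norm (h0 x)) * indicator (cball a \<rho>) x)"
          by eventually_elim (auto split: split_indicator)
      qed
      also have "\<dots> = (\<integral>\<^sup>+x. ennreal (c x) * (ennreal (norm (h0 x)) * indicator (cball a \<rho>) x) \<partial>HM m)"
        unfolding HM_eq nn_integral_completion ..
      also have "\<dots> = (\<integral>\<^sup>+x\<in>cball a \<rho>. ennreal (norm (h0 x)) \<partial>?W)"
      proof -
        have cs: "cball a \<rho> \<in> sets (HM m)" by (rule sets_HM_borel) simp
        have "(\<lambda>x. ennreal (norm (h0 x)) * indicator (cball a \<rho>) x) \<in> borel_measurable (HM m)" using h0m cs by measurable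
        moreover have "(\<lambda>x. ennreal (c x)) \<in> borel_measurable (HM m)" using measurable_HM_borel[OF cm, of m] by measurable
        ultimately show ?thesis unfolding W_eq by (intro nn_integral_density[symmetric])
      qed
      also have "\<dots> < \<infinity>" using fv U compact_cball unfolding first_var_rep_def by blast
      finally show "(\<integral>\<^sup>+x. ennreal (norm (h x)) \<partial>\<mu>) < \<infinity>" .
    qed
    fix \<psi> :: "'a \<Rightarrow> real" and \<gamma> :: "('a \<Rightarrow>\<^sub>L 'a) \<Rightarrow> real" and w :: 'a and K
    assume \<psi>: "smooth_map \<psi>" and K: "compact K" "K \<subseteq> ?B" "\<And>x. x \<notin> K \<Longrightarrow> \<psi> x = 0"
      and \<gamma>: "smooth_map \<gamma>" and b\<gamma>: "bounded {T. \<gamma> T \<noteq> 0}"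
    have [measurable]: "\<psi> \<in> borel_measurable borel" "\<gamma> \<in> borel_measurable borel"
      using smooth_map_continuous[OF \<psi>] smooth_map_continuous[OF \<gamma>] by (auto intro: borel_measurable_continuous_onI)
    define \<phi> where "\<phi> x = \<psi> x *\<^sub>R w" for x
    have "K \<subseteq> U" using K(2) U ball_subset_cball by blast
    then have "test_field U \<phi>"
      unfolding test_field_def \<phi>_def using K
      by (auto intro!: smooth_map_scaleR_const \<psi> exI[of _ K])
    then have main: "(\<integral>x. \<gamma> (tauV m R \<theta> x) * (\<phi> x \<bullet> h0 x) \<partial>?W)
        = vint m R \<theta> (\<lambda>x S. \<gamma> (tauV m R \<theta> x) * lin_dot S (frechet_derivative \<phi> (at x)))
          + (\<integral>x. frechet_derivative \<gamma> (at (tauV m R \<theta> x)) (b x (\<phi> x)) \<partial>?W)"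
      using gw admissible_gammaI[OF \<gamma> b\<gamma>] unfolding gen_weak_deriv_def by blast
    have "(\<integral>x. frechet_derivative \<gamma> (at (tauV m R \<theta> x)) (b x (\<phi> x)) \<partial>?W) = 0"
    proof (rule integral_eq_zero_AE)
      have lz: "frechet_derivative \<gamma> (at T) 0 = 0" for T
        using linear_0[OF has_derivative_linear[OF smooth_map_has_derivative[OF \<gamma>]]] .
      from b0 show "AE x in ?W. frechet_derivative \<gamma> (at (tauV m R \<theta> x)) (b x (\<phi> x)) = 0"
        by eventually_elim (simp add: lz)
    qed
    with main have main': "(\<integral>x. \<gamma> (tauV m R \<theta> x) * (\<phi> x \<bullet> h0 x) \<partial>?W)
        = vint m R \<theta> (\<lambda>x S. \<gamma> (tauV m R \<theta> x) * lin_dot S (frechet_derivative \<phi> (at x)))" by simp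
    have L: "(\<integral>x. \<gamma> (tauV m R \<theta> x) * (\<phi> x \<bullet> h0 x) \<partial>?W) = (\<integral>x. \<gamma> (\<tau> x) * (\<psi> x * (w \<bullet> h x)) \<partial>\<mu>)"
    proof -
      have \<psi>H: "\<psi> \<in> borel_measurable (HM m)" by (rule measurable_HM_borel) measurable
      have \<gamma>t: "(\<lambda>x. \<gamma> (tauV m R \<theta> x)) \<in> borel_measurable (HM m)"
        by (rule measurable_compose[OF t0m]) measurable
      have mW: "(\<lambda>x. \<gamma> (tauV m R \<theta> x) * (\<phi> x \<bullet> h0 x)) \<in> borel_measurable (HM m)"
        unfolding \<phi>_def using \<psi>H \<gamma>t h0m by measurable
      have "(\<integral>x. \<gamma> (tauV m R \<theta> x) * (\<phi> x \<bullet> h0 x) \<partial>?W) = (\<integral>x. c x * (\<gamma> (tauV m R \<theta> x) * (\<phi> x \<bullet> h0 x)) \<partial>HM m)"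
        by (rule int_W[OF mW])
      also have "\<dots> = (\<integral>x. indicator ?B x * c x * (\<gamma> (\<tau> x) * (\<psi> x * (w \<bullet> h x))) \<partial>HM m)"
      proof (rule integral_cong_AE)
        show "(\<lambda>x. c x * (\<gamma> (tauV m R \<theta> x) * (\<phi> x \<bullet> h0 x))) \<in> borel_measurable (HM m)"
          using mW measurable_HM_borel[OF cm, of m] by measurable
        show "(\<lambda>x. indicator ?B x * c x * (\<gamma> (\<tau> x) * (\<psi> x * (w \<bullet> h x)))) \<in> borel_measurable (HM m)"
          by (rule measurable_HM_borel) measurable
        from \<tau>_ae h_ae show "AE x in HM m. c x * (\<gamma> (tauV m R \<theta> x) * (\<phi> x \<bullet> h0 x)) = indicator ?B x * c x * (\<gamma> (\<tau> x) * (\<psi> x * (w \<bullet> h x)))"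
          unfolding AE_HM_iff
        proof eventually_elim
          case (elim x)
          have "\<psi> x = 0" if "x \<notin> ?B" using K that by blast
          then show ?case using elim by (cases "x \<in> ?B") (auto simp: \<phi>_def)
        qed
      qed
      also have "\<dots> = (\<integral>x. \<gamma> (\<tau> x) * (\<psi> x * (w \<bullet> h x)) \<partial>\<mu>)" by (rule int_mu[symmetric]) measurable
      finally show ?thesis .
    qed
    have R: "vint m R \<theta> (\<lambda>x S. \<gamma> (tauV m R \<theta> x) * lin_dot S (frechet_derivative \<phi> (at x)))
        = (\<integral>x. \<gamma> (\<tau> x) * frechet_derivative \<psi> (at x) (\<tau> x w) \<partial>\<mu>)"
    proof -
      have Dm[measurable]: "(\<lambda>x. frechet_derivative \<psi> (at x) (\<tau> x w)) \<in> borel_measurable borel"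
        by (rule borel_measurable_frechet_derivative[OF \<psi>]) measurable
      define I where "I x = (if x \<in> R \<and> rtan m R x \<in> Grass m then real (\<theta> x) *
        (\<gamma> (tauV m R \<theta> x) * lin_dot (orth_proj (rtan m R x)) (frechet_derivative \<phi> (at x))) else 0)" for x
      define I' where "I' x = indicator ?B x * c x * (\<gamma> (\<tau> x) * frechet_derivative \<psi> (at x) (\<tau> x w))" for x
      have I'm: "I' \<in> borel_measurable (HM m)" unfolding I'_def by (rule measurable_HM_borel) measurable
      have ae: "AE x in HB m. I' x = I x"
        using \<tau>S tS
      proof eventually_elim
        case (elim x)
        have D0: "frechet_derivative \<psi> (at x) 0 = 0"
          using linear_0[OF has_derivative_linear[OF smooth_map_has_derivative[OF \<psi>]]] .
        have ld: "lin_dot (orth_proj (rtan m R x)) (frechet_derivative \<phi> (at x)) = frechet_derivative \<psi> (at x) (orth_proj (rtan m R x) w)"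
          if "rtan m R x \<in> Grass m"
          unfolding \<phi>_def using that by (intro lin_dot_derivative[OF \<psi>]) (simp add: Grass_def)
        show ?case
        proof (cases "x \<in> ?B")
          case True
          show ?thesis
          proof (cases "x \<in> R")
            case False then show ?thesis by (simp add: I_def I'_def c_def)
          next
            case xR: True
            then have "\<tau> x = S x" "tauV m R \<theta> x = S x" using elim True by auto
            then show ?thesis using True xR D0 ld by (auto simp: I_def I'_def c_def S_def)
          qed
        next
          \<comment> \<open>Off the ball both integrands vanish, since the derivative of a function
            supported in \<open>K\<close> is zero outside \<open>K\<close>.\<close>
          case False
          then have "x \<notin> K" using K by blast
          then have "frechet_derivative \<psi> (at x) v = 0" for v
            by (intro frechet_derivative_support[OF compact_imp_closed[OF K(1)]]) (auto intro: K(3))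
          then show ?thesis using False ld by (simp add: I_def I'_def)
        qed
      qed
      \<comment> \<open>\<open>I\<close> is built from tangent cones and is measurable only because
        it agrees almost everywhere with \<open>I'\<close>.\<close>
      have Im: "I \<in> borel_measurable (HM m)"
        using measurable_completion_AE[OF I'm[unfolded HM_eq] ae] by (simp add: HM_eq)
      have "vint m R \<theta> (\<lambda>x S. \<gamma> (tauV m R \<theta> x) * lin_dot S (frechet_derivative \<phi> (at x))) = (\<integral>x. I x \<partial>HM m)"
        unfolding vint_def I_def ..
      also have "\<dots> = (\<integral>x. I' x \<partial>HM m)"
        by (rule integral_cong_AE[OF Im I'm]) (use ae in \<open>simp add: AE_HM_iff eq_commute\<close>)
      also have "\<dots> = (\<integral>x. \<gamma> (\<tau> x) * frechet_derivative \<psi> (at x) (\<tau> x w) \<partial>\<mu>)"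
        unfolding I'_def by (rule int_mu[symmetric]) measurable
      finally show ?thesis .
    qed
    show "(\<integral>x. \<gamma> (\<tau> x) * frechet_derivative \<psi> (at x) (\<tau> x w) \<partial>\<mu>) = (\<integral>x. \<gamma> (\<tau> x) * (\<psi> x * (w \<bullet> h x)) \<partial>\<mu>)"
      using main' L R by simp
  qed
  then show ?thesis using \<tau>S that unfolding S_def by blast
qed

theorem mainTheorem8:
  fixes m :: nat and U R :: "'a::euclidean_space set" and \<theta> :: "'a \<Rightarrow> nat"
    and b :: "'a \<Rightarrow> ('a \<Rightarrow>\<^sub>L ('a \<Rightarrow>\<^sub>L 'a))" and a :: 'a
  assumes "1 \<le> m" and "m \<le> DIM('a)" and "open U"
    and "integral_varifold m U R \<theta>"
    and "curvature_varifold m U R \<theta>"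
    and "second_fund_form m U R \<theta> b"
    and "AE x in vweight m R \<theta>. b x = 0"
    and "a \<in> U"
  shows "\<exists>r>0. ball a r \<subseteq> U \<and> (\<exists>(N::nat) (k :: nat \<Rightarrow> nat) (A :: nat \<Rightarrow> 'a set).
           (\<forall>j<N. 0 < k j \<and> affine_plane m (A j)) \<and>
           (\<forall>E\<in>sets (borel :: ('a \<times> ('a \<Rightarrow>\<^sub>L 'a)) measure). E \<subseteq> ball a r \<times> UNIV \<longrightarrow>
              vmeas m R \<theta> E = (\<Sum>j<N. vmeas m (A j) (\<lambda>_. k j) E)))"
proof -
  note m = \<open>1 \<le> m\<close>
  obtain \<rho> where \<rho>: "0 < \<rho>" "cball a \<rho> \<subseteq> U" using assms(3,8) open_contains_cball by blast
  obtain \<mu> \<tau> h where fvf: "flat_varifold m \<mu> \<tau> h a \<rho> (R \<inter> ball a \<rho>) \<theta>"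
    and \<tau>S: "AE x in HB m. x \<in> R \<inter> ball a \<rho> \<longrightarrow> \<tau> x = (if rtan m R x \<in> Grass m then orth_proj (rtan m R x) else 0)"
    by (rule flat_varifold_of_second_fund_form[OF m assms(4,6,7) \<rho>(2)])
  interpret flat_varifold m \<mu> \<tau> h a \<rho> "R \<inter> ball a \<rho>" \<theta> by (rule fvf)
  \<comment> \<open>Three radii are in play: mass is detected within \<open>r\<close>, constancy and
    the lower mass bound hold within \<open>r'\<close>, and the translation estimates need the room
    up to \<open>\<rho>\<close>. Thirds are just a choice.\<close>
  define r where "r = \<rho> / 3"
  define r' where "r' = 2 * \<rho> / 3"
  have r: "0 < r" "r < r'" "r' < \<rho>" "r < \<rho>" using \<rho>(1) by (auto simp: r_def r'_def)
  have fin: "finite (charged_planes r)" by (rule finite_charged_planes[OF r(2,3)])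
  define N where "N = card (charged_planes r)"
  obtain A where A: "bij_betw A {0..<N} (charged_planes r)" using ex_bij_betw_nat_finite[OF fin] by (auto simp: N_def)
  have Ac: "A j \<in> charged_planes r" if "j < N" for j using A that by (auto simp: bij_betw_def)
  have "\<forall>j. \<exists>k. j < N \<longrightarrow> 0 < k \<and> (AE x in HB m. x \<in> A j \<inter> ball a r' \<longrightarrow> x \<in> R \<inter> ball a \<rho> \<and> \<tau> x = orth_proj (dirn (A j)) \<and> \<theta> x = k)"
  proof
    fix j
    show "\<exists>k. j < N \<longrightarrow> 0 < k \<and> (AE x in HB m. x \<in> A j \<inter> ball a r' \<longrightarrow> x \<in> R \<inter> ball a \<rho> \<and> \<tau> x = orth_proj (dirn (A j)) \<and> \<theta> x = k)"
    proof (cases "j < N")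
      case True
      show ?thesis by (rule charged_plane_mult[OF Ac[OF True] r(2,3)]) blast
    qed simp
  qed
  from choice[OF this] obtain k where k: "\<And>j. j < N \<Longrightarrow> 0 < k j"
    "\<And>j. j < N \<Longrightarrow> AE x in HB m. x \<in> A j \<inter> ball a r' \<longrightarrow> x \<in> R \<inter> ball a \<rho> \<and> \<tau> x = orth_proj (dirn (A j)) \<and> \<theta> x = k j"
    by blast
  have pl: "dirn (A j) \<in> Grass m \<and> (\<exists>p. A j = (+) p ` dirn (A j))" if j: "j < N" for j
  proof -
    obtain P p where P: "P \<in> Grass m" "A j = (+) p ` P" using Ac[OF j] unfolding charged_planes_def by blast
    then have "dirn (A j) = P" using dirn_plane by (simp add: Grass_def)
    then show ?thesis using P by auto
  qed
  have Ab: "A j \<in> sets borel" if "j < N" for j using pl[OF that] borel_plane by metis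
  \<comment> \<open>Almost no point lies on two of the planes, so at most one summand is active and
    multiplicities are not counted twice.\<close>
  have disj: "AE x in HB m. \<forall>i\<in>{..<N}. \<forall>j\<in>{..<N}. i \<noteq> j \<longrightarrow> x \<notin> A i \<inter> A j"
  proof (intro AE_finite_allI finite_lessThan)
    fix i j assume ij: "i \<in> {..<N}" "j \<in> {..<N}"
    show "AE x in HB m. i \<noteq> j \<longrightarrow> x \<notin> A i \<inter> A j"
    proof (cases "i = j")
      case False
      then have ne: "A i \<noteq> A j" using A ij by (auto simp: bij_betw_def inj_on_def)
      have ijN: "i < N" "j < N" using ij by auto
      obtain p where p: "A i = (+) p ` dirn (A i)" using pl[OF ijN(1)] by blast
      obtain q where q: "A j = (+) q ` dirn (A j)" using pl[OF ijN(2)] by blast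
      have "Hm m ((+) p ` dirn (A i) \<inter> (+) q ` dirn (A j)) = 0"
        by (rule Hm_plane_Int_null[OF conjunct1[OF pl[OF ijN(1)]] conjunct1[OF pl[OF ijN(2)]] _ m])
           (unfold p[symmetric] q[symmetric], rule ne)
      then have "Hm m (A i \<inter> A j) = 0" unfolding p[symmetric] q[symmetric] .
      then have "emeasure (HB m) (A i \<inter> A j) = 0" using Ab ijN by (simp add: emeasure_HB[OF m])
      then have "A i \<inter> A j \<in> null_sets (HB m)" using Ab ij by (auto simp: null_sets_def)
      then have "AE x in HB m. x \<notin> A i \<inter> A j" by (rule AE_not_in)
      then show ?thesis by eventually_elim simp
    qed simp
  qed
  have on: "AE x in HB m. \<forall>j\<in>{..<N}. x \<in> A j \<inter> ball a r' \<longrightarrow> x \<in> R \<inter> ball a \<rho> \<and> \<tau> x = orth_proj (dirn (A j)) \<and> \<theta> x = k j"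
    by (intro AE_finite_allI finite_lessThan k(2)) simp
  have vm: "vmeas m R \<theta> E = (\<Sum>j<N. vmeas m (A j) (\<lambda>_. k j) E)"
    if E[measurable]: "E \<in> sets (borel :: ('a \<times> ('a \<Rightarrow>\<^sub>L 'a)) measure)" and Es: "E \<subseteq> ball a r \<times> UNIV" for E
  proof -
    \<comment> \<open>The integrand of \<open>vmeas\<close> for the plane \<open>A j\<close>, with
      its tangent plane already replaced by the constant direction.\<close>
    define g where "g j x = (if x \<in> A j \<and> (x, orth_proj (dirn (A j))) \<in> E then ennreal (real (k j)) else 0)" for j x
    have gm: "g j \<in> borel_measurable (HM m)" if j: "j < N" for j
    proof (rule measurable_HM_borel)
      have [measurable]: "A j \<in> sets borel" using Ab[OF j] .
      have "(\<lambda>x :: 'a. (x, orth_proj (dirn (A j)))) \<in> borel_measurable borel"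
        by (intro borel_measurable_continuous_onI continuous_intros)
      from measurable_sets[OF this E] have [measurable]: "{x. (x, orth_proj (dirn (A j))) \<in> E} \<in> sets borel"
        by (simp add: vimage_def)
      have "g j = (\<lambda>x. indicator (A j \<inter> {x. (x, orth_proj (dirn (A j))) \<in> E}) x * ennreal (real (k j)))"
        by (auto simp: g_def fun_eq_iff split: split_indicator)
      then show "g j \<in> borel_measurable borel" by simp
    qed
    have vmA: "vmeas m (A j) (\<lambda>_. k j) E = (\<integral>\<^sup>+x. g j x \<partial>HM m)" if j: "j < N" for j
      unfolding vmeas_def
    proof (intro nn_integral_cong)
      fix x :: 'a
      obtain p where p: "A j = (+) p ` dirn (A j)" using pl[OF j] by blast
      have "rtan m (A j) x = dirn (A j)" if "x \<in> A j"
        using rtan_plane[OF conjunct1[OF pl[OF j]] m, of x p] that unfolding p[symmetric] by blast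
      then show "(if x \<in> A j \<and> rtan m (A j) x \<in> Grass m \<and> (x, orth_proj (rtan m (A j) x)) \<in> E then ennreal (real (k j)) else 0) = g j x"
        using pl[OF j] by (auto simp: g_def)
    qed
    have "vmeas m R \<theta> E = (\<integral>\<^sup>+x. (\<Sum>j<N. g j x) \<partial>HM m)"
      unfolding vmeas_def
    proof (rule nn_integral_cong_AE, unfold AE_HM_iff)
      let ?f = "\<lambda>x. if x \<in> R \<and> rtan m R x \<in> Grass m \<and> (x, orth_proj (rtan m R x)) \<in> E then ennreal (real (\<theta> x)) else 0"
      show "AE x in HB m. ?f x = (\<Sum>j<N. g j x)"
        using \<tau>S disj on AE_in_charged_plane[OF r(4)]
      proof eventually_elim
        case (elim x)
        show ?case
        proof (cases "x \<in> ball a r")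
          case False
          then have "(x, T) \<notin> E" for T using Es by auto
          then show ?thesis by (simp add: g_def)
        next
          case xr: True
          then have xb: "x \<in> ball a r'" "x \<in> ball a \<rho>" using r by auto
          show ?thesis
          proof (cases "\<exists>j<N. x \<in> A j")
            case True
            then obtain j where j: "j < N" "x \<in> A j" by blast
            then have x: "x \<in> R" "\<tau> x = orth_proj (dirn (A j))" "\<theta> x = k j" using elim(3) xb by auto
            \<comment> \<open>Being nonzero, \<open>\<tau> x\<close> cannot be the default value;
              hence \<open>rtan m R x\<close> is a genuine plane with this projection.\<close>
            have "\<tau> x \<noteq> 0" using x(2) orth_proj_neq_0[OF conjunct1[OF pl[OF j(1)]] m] by simp
            then have rt: "rtan m R x \<in> Grass m" "orth_proj (rtan m R x) = orth_proj (dirn (A j))"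
              using elim(1) x xb by (auto split: if_splits)
            have "(\<Sum>i<N. g i x) = (\<Sum>i<N. if i = j then g j x else 0)"
            proof (intro sum.cong refl)
              fix i assume "i \<in> {..<N}"
              then show "g i x = (if i = j then g j x else 0)" using elim(2) j by (auto simp: g_def)
            qed
            also have "\<dots> = g j x" using j by simp
            finally show ?thesis using x rt j by (simp add: g_def)
          next
            case no: False
            then have "(\<Sum>j<N. g j x) = 0" by (intro sum.neutral) (auto simp: g_def)
            \<comment> \<open>Off all charged planes a generic point of the ball is outside
              \<open>R\<close> or has no tangent plane, and then it does not contribute to the
              varifold.\<close>
            moreover have "?f x = 0"
            proof (rule ccontr)
              assume "?f x \<noteq> 0"
              then have x: "x \<in> R" "rtan m R x \<in> Grass m" by (auto split: if_splits)
              then have "\<tau> x \<noteq> 0" using elim(1) xb orth_proj_neq_0[OF x(2) m] by simp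
              then obtain B where B: "B \<in> charged_planes r" "x \<in> B" using elim(4) x xr xb by auto
              then obtain j where "j < N" "B = A j" using A unfolding bij_betw_def by (metis atLeastLessThan_iff imageE)
              then show False using no B by blast
            qed
            ultimately show ?thesis by simp
          qed
        qed
      qed
    qed
    also have "\<dots> = (\<Sum>j<N. \<integral>\<^sup>+x. g j x \<partial>HM m)" by (rule nn_integral_sum) (use gm in auto)
    also have "\<dots> = (\<Sum>j<N. vmeas m (A j) (\<lambda>_. k j) E)" by (intro sum.cong) (auto simp: vmA)
    finally show ?thesis .
  qed
  have bU: "ball a r \<subseteq> U" using \<rho>(2) r(4) by (meson ball_subset_cball order_trans subset_ball less_imp_le)
  have af: "\<forall>j<N. 0 < k j \<and> affine_plane m (A j)" using k(1) pl unfolding affine_plane_def by blast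
  show ?thesis
    by (rule exI[of _ r], rule conjI[OF r(1)], rule conjI[OF bU], rule exI[of _ N], rule exI[of _ k], rule exI[of _ A], rule conjI[OF af])
       (use vm in blast)
qed

end
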